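(* Let $E$ be a Banach space and let $\mathbb{T}_1,\mathbb{T}_2$ be time scales both containing $0$. Let $G:\mathbb{T}_1\times\mathbb{T}_2\times[0,\infty)\to[0,\infty)$ be continuous and nondecreasing in the last variable, and assume that the integral inequality $$g(x,y)\ge\int_0^x\int_0^y G(s,t,g(s,t))\,\Delta t\,\Gamma s$$ has a locally bounded solution $g_0:\mathbb{T}_1\times\mathbb{T}_2\to[0,\infty)$ on $\mathbb{T}_1\times\mathbb{T}_2$. Let $B_{g_0}$ be the set of all continuous $z:\mathbb{T}_1\times\mathbb{T}_2\to E$ such that $\|z(x,y)\|\le g_0(x,y)$ on $\mathbb{T}_1\times\mathbb{T}_2$ and $$\|z(x_1,y_1)-z(x_2,y_2)\|\le\Bigl|\int_0^{x_2}\int_{y_1}^{y_2}G(s,t,g_0(s,t))\,\Delta t\,\Gamma s\Bigr|+\Bigl|\int_{x_1}^{x_2}\int_0^{y_1}G(s,t,g_0(s,t))\,\Delta t\,\Gamma s\Bigr|$$ for all $x_1,x_2\in\mathbb{T}_1$ and $y_1,y_2\in\mathbb{T}_2$. Let $h:\mathbb{T}_1\times\mathbb{T}_2\times[0,\infty)\to[0,\infty)$ be a continuous function such that $h(x,y,0)=0$ for all $(x,y)$, and such that $u\equiv0$ is the unique continuous (nonnegative) solution of the integral inequality $$u(x,y)\le\int_0^x\int_0^y h(s,t,u(s,t))\,\Delta t\,\Gamma s$$ satisfying $u(0,0)=0$. Assume that $f:\mathbb{T}_1\times\mathbb{T}_2\times E\to E$ satisfies: (C1) for each $(x,y)\in\mathbb{T}_1\times\mathbb{T}_2$,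 $f(x,y,\cdot)$ is weakly-weakly sequentially continuous; (C2) for each strongly absolutely continuous function $z:\mathbb{T}_1\times\mathbb{T}_2\to E$, the function $f(\cdot,\cdot,z(\cdot,\cdot))$ is weakly continuous; (C3) $\|f(x,y,u)\|\le G(x,y,\|u\|)$ for all $(x,y)\in\mathbb{T}_1\times\mathbb{T}_2$ and $u\in E$; (C4) for each $W\subset B_{g_0}$ and all $I_x\subset\mathbb{T}_1$, $I_y\subset\mathbb{T}_2$, $$\beta\bigl(f(I_x\times I_y\times W(I_x\times I_y))\bigr)\le h\bigl(x,y,\beta(W(I_x\times I_y))\bigr)\quad\text{for all }(x,y)\in I_x\times I_y,$$ where $W(I_x\times I_y)=\{w(s,t):w\in W,\ (s,t)\in I_x\times I_y\}\subset E$ and $\beta$ is the DeBlasi measure of weak noncompactness. Then there exists a weak solution $z:\mathbb{T}_1\times\mathbb{T}_2\to E$ of the partial dynamic problem $$z^{\Gamma_w\Delta_w}(x,y)=f(x,y,z(x,y)),\qquad z(x,0)=0,\quad z(0,y)=0,\qquad x\in\mathbb{T}_1,\ y\in\mathbb{T}_2 .$$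
   Context: A time scale is a nonempty closed subset of $\mathbb{R}$, with the induced topology; $\sigma(t)=\inf\{s\in\mathbb{T}:s>t\}$ is the forward jump operator. Intervals are intersected with the time scale. $\Gamma$ refers to the forward (delta) derivative/integral in the first variable $x$ (or $s$) $\in\mathbb{T}_1$, and $\Delta$ to the forward (delta) derivative/integral in the second variable $y$ (or $t$) $\in\mathbb{T}_2$; the scalar integrals are the usual time scale delta double integrals. $E^*$ is the dual of $E$. Partial derivatives. For $\psi:\mathbb{T}_1\times\mathbb{T}_2\to\mathbb{R}$, $\psi^{\Gamma}(s,t)$ is the number (if it exists) such that for every $\varepsilon>0$ there is $\delta>0$ with $|[\psi(\sigma(s),t)-\psi(u,t)]-\psi^{\Gamma}(s,t)[\sigma(s)-u]|\le\varepsilon|\sigma(s)-u|$ for all $u\in(s-\delta,s+\delta)\cap\mathbb{T}_1$; $\psi^{\Delta}(s,t)$ is the number (if it exists) such that for every $\varepsilon>0$ there is $\delta>0$ with $|[\psi(s,\sigma(t))-\psi(s,u)]-\psi^{\Delta}(s,t)[\sigma(t)-u]|\le\varepsilon|\sigma(t)-u|$ for all $u\in(t-\delta,t+\delta)\cap\mathbb{T}_2$. (As usual, derivatives are considered at points of $\mathbb{T}^k$, i.e. excluding a left-scattered maximum of the relevant time scale.) Weak partial derivatives. A function $\phi:\mathbb{T}_1\times\mathbb{T}_2\to E$ is $\Gamma$-weak partial differentiable at $(s,t)$ if there is $F(s,t)\in E$ such that for each $z^*\in E^*$ the real function $z^*\phi$ is $\Gamma$ partial differentiable at $(s,t)$ and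 $(z^*\phi)^{\Gamma}(s,t)=z^*(F(s,t))$; then $\phi^{\Gamma_w}(s,t)=F(s,t)$. The $\Delta$-weak partial derivative $\phi^{\Delta_w}$ is defined in the same way with $\Delta$ in place of $\Gamma$. $z^{\Gamma_w\Delta_w}$ denotes $(z^{\Gamma_w})^{\Delta_w}$. A weak solution of the problem is a weakly continuous function $z:\mathbb{T}_1\times\mathbb{T}_2\to E$ (i.e. $z^*z$ is continuous for each $z^*\in E^*$) satisfying the equation with weak partial derivatives and the boundary conditions. "Weakly-weakly sequentially continuous" means that $u_n\to u$ weakly in $E$ implies $f(x,y,u_n)\to f(x,y,u)$ weakly in $E$. "Strongly" means with respect to the norm of $E$. DeBlasi measure of weak noncompactness: for a nonempty bounded $A\subset E$, $\beta(A)=\inf\{t>0:\text{there exists a weakly compact set }C\subset E\text{ with }A\subset C+tB_1\}$, where $B_1$ is the unit ball of $E$. In (C4) the sets are understood to be nonempty and bounded, so that $\beta$ is defined.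
   Formalization: In the integral inequalities for g and for u the double integral is taken in absolute value; this changes nothing where xy ≥ 0, but where xy < 0 the signed inequalities give no control and the claim as written is false. *)

theory Defs
  imports "HOL-Analysis.Analysis"
begin

text \<open>
  Functions on \<open>T1 \<times> T2\<close> are total functions on the reals; only their values at
  points of \<open>T1 \<times> T2\<close> matter below.
\<close>

section \<open>Time scales and delta derivatives\<close>

definition time_scale :: "real set \<Rightarrow> bool" where
  "time_scale T \<longleftrightarrow> T \<noteq> {} \<and> closed T"

text \<open>
  The usual conventions \<open>inf {} = sup T\<close> and \<open>sup {} = inf T\<close> have to be spelled out.
  The forward jump is defined at every real number, because it also serves as
  the distribution function of the delta measure.
\<close>

definition fjump :: "real set \<Rightarrow> real \<Rightarrow> real" where
  "fjump T t = (if \<exists>s\<in>T. t < s then Inf {s\<in>T. t < s} else Sup T)"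

definition bjump :: "real set \<Rightarrow> real \<Rightarrow> real" where
  "bjump T t = (if \<exists>s\<in>T. s < t then Sup {s\<in>T. s < t} else Inf T)"

definition tskappa :: "real set \<Rightarrow> real set" where
  "tskappa T = {t\<in>T. \<not> ((\<forall>s\<in>T. s \<le> t) \<and> bjump T t < t)}"

definition has_delta_deriv :: "real set \<Rightarrow> (real \<Rightarrow> real) \<Rightarrow> real \<Rightarrow> real \<Rightarrow> bool" where
  "has_delta_deriv T \<psi> d t \<longleftrightarrow>
     (\<forall>\<epsilon>>0. \<exists>\<delta>>0. \<forall>u \<in> {t - \<delta><..<t + \<delta>} \<inter> T.
        \<bar>(\<psi> (fjump T t) - \<psi> u) - d * (fjump T t - u)\<bar> \<le> \<epsilon> * \<bar>fjump T t - u\<bar>)"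

text \<open>
  Derivatives are relations: on a one-point time scale every number is a
  derivative, in all other cases the derivative at a point of \<open>tskappa T\<close> is unique.
\<close>

definition has_Gamma_weak_deriv ::
    "real set \<Rightarrow> (real \<Rightarrow> real \<Rightarrow> 'a::real_normed_vector) \<Rightarrow> 'a \<Rightarrow> real \<Rightarrow> real \<Rightarrow> bool" where
  "has_Gamma_weak_deriv T1 \<phi> F s t \<longleftrightarrow>
     (\<forall>\<xi> :: 'a \<Rightarrow>\<^sub>L real. has_delta_deriv T1 (\<lambda>x. \<xi> (\<phi> x t)) (\<xi> F) s)"

definition has_Delta_weak_deriv ::
    "real set \<Rightarrow> (real \<Rightarrow> real \<Rightarrow> 'a::real_normed_vector) \<Rightarrow> 'a \<Rightarrow> real \<Rightarrow> real \<Rightarrow> bool" where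
  "has_Delta_weak_deriv T2 \<phi> F s t \<longleftrightarrow>
     (\<forall>\<xi> :: 'a \<Rightarrow>\<^sub>L real. has_delta_deriv T2 (\<lambda>y. \<xi> (\<phi> s y)) (\<xi> F) t)"


section \<open>Delta double integrals\<close>

text \<open>
  The Lebesgue delta measure of \<open>T\<close>, as the Lebesgue-Stieltjes measure of the forward jump
  operator: it gives \<open>[a, b) \<inter> T\<close> mass \<open>b - a\<close> for \<open>a, b \<in> T\<close>
  (lemma \<open>emeasure_delta_measure\<close>).
\<close>

definition delta_measure :: "real set \<Rightarrow> real measure" where
  "delta_measure T = interval_measure (fjump T)"

definition delta_measure2 :: "real set \<Rightarrow> real set \<Rightarrow> (real \<times> real) measure" where
  "delta_measure2 T1 T2 = completion (delta_measure T1 \<Otimes>\<^sub>M delta_measure T2)"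

definition tsrect ::
    "real set \<Rightarrow> real set \<Rightarrow> real \<Rightarrow> real \<Rightarrow> real \<Rightarrow> real \<Rightarrow> (real \<times> real) set" where
  "tsrect T1 T2 a b c d = ({min a b..<max a b} \<inter> T1) \<times> ({min c d..<max c d} \<inter> T2)"

definition delta_integrable2 ::
    "real set \<Rightarrow> real set \<Rightarrow> real \<Rightarrow> real \<Rightarrow> real \<Rightarrow> real \<Rightarrow> (real \<Rightarrow> real \<Rightarrow> real) \<Rightarrow> bool" where
  "delta_integrable2 T1 T2 a b c d \<phi> \<longleftrightarrow>
     set_integrable (delta_measure2 T1 T2) (tsrect T1 T2 a b c d) (\<lambda>(s, t). \<phi> s t)"

text \<open>The integral of \<open>\<phi>\<close> for \<open>s\<close> from \<open>a\<close> to \<open>b\<close> and \<open>t\<close> from \<open>c\<close> to \<open>d\<close>, oriented in each variable.\<close>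

definition delta_integral2 ::
    "real set \<Rightarrow> real set \<Rightarrow> real \<Rightarrow> real \<Rightarrow> real \<Rightarrow> real \<Rightarrow> (real \<Rightarrow> real \<Rightarrow> real) \<Rightarrow> real" where
  "delta_integral2 T1 T2 a b c d \<phi> =
     (if a \<le> b then 1 else - 1) * (if c \<le> d then 1 else - 1) *
     set_lebesgue_integral (delta_measure2 T1 T2) (tsrect T1 T2 a b c d) (\<lambda>(s, t). \<phi> s t)"


section \<open>Weak topology and the DeBlasi measure of weak noncompactness\<close>

definition weak_topology :: "'a::real_normed_vector topology" where
  "weak_topology = topology_generated_by {blinfun_apply \<xi> -` U | (\<xi> :: 'a \<Rightarrow>\<^sub>L real) U. open U}"

definition weakly_tendsto :: "(nat \<Rightarrow> 'a::real_normed_vector) \<Rightarrow> 'a \<Rightarrow> bool" where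
  "weakly_tendsto u l \<longleftrightarrow> (\<forall>\<xi> :: 'a \<Rightarrow>\<^sub>L real. (\<lambda>n. \<xi> (u n)) \<longlonglongrightarrow> \<xi> l)"

definition weakly_continuous_on2 ::
    "real set \<Rightarrow> real set \<Rightarrow> (real \<Rightarrow> real \<Rightarrow> 'a::real_normed_vector) \<Rightarrow> bool" where
  "weakly_continuous_on2 T1 T2 z \<longleftrightarrow>
     (\<forall>\<xi> :: 'a \<Rightarrow>\<^sub>L real. continuous_on (T1 \<times> T2) (\<lambda>(x, y). \<xi> (z x y)))"

definition deblasi :: "'a::real_normed_vector set \<Rightarrow> real" where
  "deblasi A = Inf {t. 0 < t \<and> (\<exists>C. compactin weak_topology C \<and>
     A \<subseteq> {c + t *\<^sub>R b | c b. c \<in> C \<and> b \<in> cball 0 1})}"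


section \<open>Strong absolute continuity\<close>

text \<open>
  Absolute continuity in the sense of Caratheodory with respect to the norm, on every
  compact rectangle with corners in \<open>T1 \<times> T2\<close>.
\<close>

definition strongly_AC_on :: "real set \<Rightarrow> (real \<Rightarrow> 'a::real_normed_vector) \<Rightarrow> bool" where
  "strongly_AC_on S v \<longleftrightarrow>
     (\<forall>\<epsilon>>0. \<exists>\<delta>>0. \<forall>P. finite P \<longrightarrow>
        (\<forall>(s, s')\<in>P. s \<in> S \<and> s' \<in> S \<and> s < s') \<longrightarrow>
        disjoint_family_on (\<lambda>(s, s'). {s..<s'}) P \<longrightarrow>
        (\<Sum>(s, s')\<in>P. s' - s) < \<delta> \<longrightarrow>
        (\<Sum>(s, s')\<in>P. norm (v s' - v s)) < \<epsilon>)"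

definition strongly_AC_rect ::
    "real set \<Rightarrow> real set \<Rightarrow> (real \<Rightarrow> real \<Rightarrow> 'a::real_normed_vector) \<Rightarrow> bool" where
  "strongly_AC_rect S1 S2 z \<longleftrightarrow>
     (\<forall>\<epsilon>>0. \<exists>\<delta>>0. \<forall>P. finite P \<longrightarrow>
        (\<forall>(s, s', t, t')\<in>P. s \<in> S1 \<and> s' \<in> S1 \<and> s < s' \<and> t \<in> S2 \<and> t' \<in> S2 \<and> t < t') \<longrightarrow>
        disjoint_family_on (\<lambda>(s, s', t, t'). {s..<s'} \<times> {t..<t'}) P \<longrightarrow>
        (\<Sum>(s, s', t, t')\<in>P. (s' - s) * (t' - t)) < \<delta> \<longrightarrow>
        (\<Sum>(s, s', t, t')\<in>P. norm (z s' t' - z s' t - z s t' + z s t)) < \<epsilon>) \<and>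
     (\<forall>t\<in>S2. strongly_AC_on S1 (\<lambda>s. z s t)) \<and>
     (\<forall>s\<in>S1. strongly_AC_on S2 (\<lambda>t. z s t))"

definition strongly_AC2 ::
    "real set \<Rightarrow> real set \<Rightarrow> (real \<Rightarrow> real \<Rightarrow> 'a::real_normed_vector) \<Rightarrow> bool" where
  "strongly_AC2 T1 T2 z \<longleftrightarrow>
     (\<forall>a\<in>T1. \<forall>b\<in>T1. \<forall>c\<in>T2. \<forall>d\<in>T2. strongly_AC_rect ({a..b} \<inter> T1) ({c..d} \<inter> T2) z)"


section \<open>The dynamic problem\<close>

definition locally_bounded2 :: "real set \<Rightarrow> real set \<Rightarrow> (real \<Rightarrow> real \<Rightarrow> real) \<Rightarrow> bool" where
  "locally_bounded2 T1 T2 g \<longleftrightarrow>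
     (\<forall>p \<in> T1 \<times> T2. \<exists>\<delta>>0. bounded ((\<lambda>(s, t). g s t) ` (ball p \<delta> \<inter> T1 \<times> T2)))"

text \<open>
  The absolute values in the two inequalities below change nothing when \<open>x * y \<ge> 0\<close>, in
  particular when \<open>0\<close> is the least element of both time scales. Where \<open>x < 0 < y\<close>
  or \<open>y < 0 < x\<close>, the oriented integral of a nonnegative function is nonpositive, and the
  inequalities without absolute values are no majorant conditions: with both time scales and \<open>E\<close>
  the real line, \<open>f x y u = G x y u = max 0 (- x * y) * (1 + u\<^sup>2)\<close> would admit \<open>g0 = 0\<close>,
  but the problem has no global solution.
  Being a solution of the first one includes the existence of the integral.
\<close>

definition majorant_solution ::
    "real set \<Rightarrow> real set \<Rightarrow> (real \<Rightarrow> real \<Rightarrow> real \<Rightarrow> real) \<Rightarrow> (real \<Rightarrow> real \<Rightarrow> real) \<Rightarrow> bool" where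
  "majorant_solution T1 T2 G g \<longleftrightarrow>
     (\<forall>x\<in>T1. \<forall>y\<in>T2. delta_integrable2 T1 T2 0 x 0 y (\<lambda>s t. G s t (g s t)) \<and>
        g x y \<ge> \<bar>delta_integral2 T1 T2 0 x 0 y (\<lambda>s t. G s t (g s t))\<bar>)"

definition minorant_solution ::
    "real set \<Rightarrow> real set \<Rightarrow> (real \<Rightarrow> real \<Rightarrow> real \<Rightarrow> real) \<Rightarrow> (real \<Rightarrow> real \<Rightarrow> real) \<Rightarrow> bool" where
  "minorant_solution T1 T2 h u \<longleftrightarrow>
     (\<forall>x\<in>T1. \<forall>y\<in>T2. u x y \<le> \<bar>delta_integral2 T1 T2 0 x 0 y (\<lambda>s t. h s t (u s t))\<bar>)"

definition B_set ::
    "real set \<Rightarrow> real set \<Rightarrow> (real \<Rightarrow> real \<Rightarrow> real \<Rightarrow> real) \<Rightarrow> (real \<Rightarrow> real \<Rightarrow> real)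
      \<Rightarrow> (real \<Rightarrow> real \<Rightarrow> 'a::real_normed_vector) set" where
  "B_set T1 T2 G g =
     {z. continuous_on (T1 \<times> T2) (\<lambda>(x, y). z x y) \<and>
         (\<forall>x\<in>T1. \<forall>y\<in>T2. norm (z x y) \<le> g x y) \<and>
         (\<forall>x1\<in>T1. \<forall>x2\<in>T1. \<forall>y1\<in>T2. \<forall>y2\<in>T2.
            norm (z x1 y1 - z x2 y2)
              \<le> \<bar>delta_integral2 T1 T2 0 x2 y1 y2 (\<lambda>s t. G s t (g s t))\<bar>
               + \<bar>delta_integral2 T1 T2 x1 x2 0 y1 (\<lambda>s t. G s t (g s t))\<bar>)}"

definition value_set ::
    "(real \<Rightarrow> real \<Rightarrow> 'a) set \<Rightarrow> real set \<Rightarrow> real set \<Rightarrow> 'a set" where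
  "value_set W Ix Iy = {w s t | w s t. w \<in> W \<and> s \<in> Ix \<and> t \<in> Iy}"

text \<open>
  \<open>zG\<close> is the \<open>\<Gamma>\<close>-weak partial derivative of \<open>z\<close>; the equation is required at the points of
  \<open>tskappa T1 \<times> tskappa T2\<close>.
\<close>

definition weak_solution ::
    "real set \<Rightarrow> real set \<Rightarrow> (real \<Rightarrow> real \<Rightarrow> 'a::real_normed_vector \<Rightarrow> 'a)
      \<Rightarrow> (real \<Rightarrow> real \<Rightarrow> 'a) \<Rightarrow> bool" where
  "weak_solution T1 T2 f z \<longleftrightarrow>
     weakly_continuous_on2 T1 T2 z \<and>
     (\<exists>zG. (\<forall>x\<in>tskappa T1. \<forall>y\<in>T2. has_Gamma_weak_deriv T1 z (zG x y) x y) \<and>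
           (\<forall>x\<in>tskappa T1. \<forall>y\<in>tskappa T2. has_Delta_weak_deriv T2 zG (f x y (z x y)) x y)) \<and>
     (\<forall>x\<in>T1. z x 0 = 0) \<and>
     (\<forall>y\<in>T2. z 0 y = 0)"


section \<open>The delta measure of half-open intervals\<close>

lemma fjump_gt:
  assumes "b \<in> T" "x < b"
  shows "x \<le> fjump T x" "fjump T x \<le> b"
proof -
  have ex: "\<exists>s\<in>T. x < s" using assms by auto
  have bdd: "bdd_below {s\<in>T. x < s}" by (rule bdd_belowI[of _ x]) auto
  show "x \<le> fjump T x"
    unfolding fjump_def using ex by (auto intro!: cInf_greatest)
  show "fjump T x \<le> b"
    unfolding fjump_def using ex bdd assms by (auto intro!: cInf_lower)
qed

lemma fjump_mono:
  assumes "T \<noteq> {}" "x \<le> y"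
  shows "fjump T x \<le> fjump T y"
proof (cases "\<exists>s\<in>T. y < s")
  case True
  moreover from True assms have "\<exists>s\<in>T. x < s" by force
  moreover have "Inf {s\<in>T. x < s} \<le> Inf {s\<in>T. y < s}"
    using True assms by (intro cInf_superset_mono bdd_belowI[of _ x]) auto
  ultimately show ?thesis by (simp add: fjump_def)
next
  case False
  hence bdd: "bdd_above T" by (metis bdd_above.I not_le)
  show ?thesis
  proof (cases "\<exists>s\<in>T. x < s")
    case True
    then obtain s where s: "s \<in> T" "x < s" by auto
    have "fjump T x \<le> s" using fjump_gt(2)[OF s] .
    also have "s \<le> Sup T" using s bdd by (simp add: cSup_upper)
    finally show ?thesis using False by (simp add: fjump_def)
  next
    case F2: False
    thus ?thesis unfolding fjump_def using False by simp
  qed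
qed

lemma fjump_right_cont:
  assumes "T \<noteq> {}"
  shows "continuous (at_right x) (fjump T)"
proof (cases "\<exists>s\<in>T. x < s")
  case False
  have ev: "eventually (\<lambda>y. fjump T y = fjump T x) (at_right x)"
    using False by (intro eventually_at_rightI[of x "x+1"]) (auto simp: fjump_def)
  show ?thesis unfolding continuous_within
    by (rule tendsto_eventually[OF ev])
next
  case True
  have bdd: "bdd_below {s\<in>T. x < s}" by (rule bdd_belowI[of _ x]) auto
  show ?thesis unfolding continuous_within
  proof (rule order_tendstoI)
    fix a assume "a < fjump T x"
    thus "eventually (\<lambda>y. a < fjump T y) (at_right x)"
      using fjump_mono[OF assms] 
      by (intro eventually_at_rightI[of x "x+1"]) (auto intro: less_le_trans)
  next
    fix a assume "fjump T x < a"
    then obtain s where s: "s \<in> T" "x < s" "s < a"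
      using True cInf_less_iff[OF _ bdd, of a] by (auto simp: fjump_def)
    show "eventually (\<lambda>y. fjump T y < a) (at_right x)"
      by (rule eventually_at_rightI[of x s]) (use s fjump_gt(2)[OF s(1)] in \<open>auto intro: le_less_trans\<close>)
  qed
qed

lemma emeasure_delta_Ioo:
  assumes "b \<in> T" "x < b"
  shows "emeasure (delta_measure T) {x<..<b} = ennreal (b - fjump T x)"
proof -
  have T: "T \<noteq> {}" using assms by auto
  define A where "A n = {x<..b - (b - x) / Suc n}" for n :: nat
  have em: "emeasure (delta_measure T) (A n) = ennreal (fjump T (b - (b - x) / Suc n) - fjump T x)" for n
    unfolding delta_measure_def A_def
  proof (rule emeasure_interval_measure_Ioc)
    have "(b - x) / real (Suc n) \<le> (b - x) / 1"
      using assms by (intro divide_left_mono) auto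
    thus "x \<le> b - (b - x) / real (Suc n)" by simp
  qed (use fjump_mono[OF T] fjump_right_cont[OF T] in auto)
  have UN: "(\<Union>n. A n) = {x<..<b}"
  proof (intro equalityI subsetI)
    fix y assume "y \<in> (\<Union>n. A n)"
    then obtain n where "x < y" "y \<le> b - (b - x) / Suc n" by (auto simp: A_def)
    moreover have "(b - x) / Suc n > 0" using assms by simp
    ultimately show "y \<in> {x<..<b}" by (auto simp del: of_nat_Suc)
  next
    fix y assume y: "y \<in> {x<..<b}"
    obtain n where n: "(b - x) / (b - y) < real (Suc n)"
      by (metis reals_Archimedean2 less_trans lessI of_nat_less_iff)
    hence "(b - x) / Suc n < b - y" using y assms by (auto simp: field_simps simp del: of_nat_Suc)
    thus "y \<in> (\<Union>n. A n)" using y by (intro UN_I[of n]) (auto simp: A_def simp del: of_nat_Suc)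
  qed
  have "incseq A"
  proof (rule incseq_SucI)
    fix n
    have "(b - x) / real (Suc (Suc n)) \<le> (b - x) / real (Suc n)"
      using assms by (intro divide_left_mono) auto
    thus "A n \<subseteq> A (Suc n)" by (auto simp: A_def simp del: of_nat_Suc)
  qed
  moreover have "range A \<subseteq> sets (delta_measure T)"
    by (auto simp: A_def delta_measure_def)
  ultimately have lim:
    "(\<lambda>n. emeasure (delta_measure T) (A n)) \<longlonglongrightarrow> emeasure (delta_measure T) {x<..<b}"
    using Lim_emeasure_incseq[of A "delta_measure T"] by (simp only: UN)
  have l0: "(\<lambda>n. b - (b - x) / Suc n) \<longlonglongrightarrow> b"
    using tendsto_diff[OF tendsto_const[of b], OF lim_const_over_n[THEN LIMSEQ_Suc, of "b - x"]] by simp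
  have lt: "b - (b - x) / real (Suc n) < b" for n using assms by simp
  have "(\<lambda>n. fjump T (b - (b - x) / Suc n)) \<longlonglongrightarrow> b"
    by (rule tendsto_sandwich[OF _ _ l0 tendsto_const[of b]])
       (use fjump_gt[OF assms(1) lt] in \<open>auto simp del: of_nat_Suc\<close>)
  hence "(\<lambda>n. emeasure (delta_measure T) (A n)) \<longlonglongrightarrow> ennreal (b - fjump T x)"
    unfolding em by (intro tendsto_intros)
  with lim show ?thesis by (rule LIMSEQ_unique)
qed

lemma emeasure_delta_measure:
  assumes "a \<in> T" "b \<in> T" "a \<le> b"
  shows "emeasure (delta_measure T) {a..<b} = ennreal (b - a)"
proof -
  have eq: "{a..<b} = {a - 1<..<b} - {a - 1<..<a}" using assms by auto
  have "emeasure (delta_measure T) {a..<b}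
      = emeasure (delta_measure T) {a - 1<..<b} - emeasure (delta_measure T) {a - 1<..<a}"
    unfolding eq using assms
    by (intro emeasure_Diff) (auto simp: emeasure_delta_Ioo, auto simp: delta_measure_def)
  also have "\<dots> = ennreal (b - fjump T (a - 1)) - ennreal (a - fjump T (a - 1))"
    using assms by (simp add: emeasure_delta_Ioo)
  also have "\<dots> = ennreal (b - a)"
    using fjump_gt(2)[OF assms(1), of "a - 1"] by (simp add: ennreal_minus)
  finally show ?thesis .
qed

end

theory Submission
  imports Defs "HOL-Probability.Probability"
begin

text \<open>
  The equation is the fixed point equation for \<open>F z(x,y) = \<integral>\<^sub>0\<^sup>x \<integral>\<^sub>0\<^sup>y f(s,t,z(s,t)) \<Delta>t \<Gamma>s\<close>,
  a Pettis integral. To the left of a right-scattered point the delta integral makes this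
  equation implicit, so no stepwise construction is available. Inside a separable closed subspace
  left invariant by \<open>f\<close>, let \<open>K\<close> be the smallest convex set of functions that contains \<open>0\<close> and is
  invariant under \<open>F\<close>. Then \<open>K = conv ({0} \<union> F K)\<close>, so (C4) and the mean value property of the
  Pettis integral show that \<open>v(x,y) = \<beta>(K(x,y))\<close> satisfies \<open>v \<le> \<integral> \<integral> h(s,t,v)\<close>; hence \<open>v = 0\<close> and \<open>K\<close> is
  pointwise relatively weakly compact. Brouwer's theorem gives elements of \<open>K\<close> that are almost fixed
  by \<open>F\<close> when tested on finitely many functionals at finitely many points. A weak limit of
  these is a fixed point of \<open>F\<close>, because \<open>F\<close> is weakly sequentially continuous on \<open>K\<close>.
\<close>

section \<open>The Hahn-Banach theorem\<close>

text \<open>The hypotheses live on different levels: \<open>C1\<close> concerns weakly convergent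
  sequences, \<open>C2\<close> applies only to strongly absolutely continuous functions, and
  \<open>C4\<close> speaks of compact sets of the weak topology. Dominated convergence works with
  sequences, so compactness is treated as relative weak sequential compactness and is translated to
  and from the weak topology only around \<open>deblasi\<close>. Separability provides a countable
  norming family of functionals. It makes norm balls measurable for the Pettis integral and gives
  countably many coordinates that identify weak limits. \<open>C2\<close> forces a bound on
  rectangular increments. Together with the bound on differences it yields Lipschitz constants
  common to all functions considered, hence the continuity of \<open>v\<close> that uniqueness for
  \<open>h\<close> demands. The hull in \<open>K\<close> is harmless by the Krein-Smulian theorem:
  convex hulls of relatively weakly compact sets remain so. \<open>F\<close> is continuous along
  weakly convergent sequences only, so a fixed point theorem for the weak topology does not apply
  directly. On a simplex spanned by finitely many functions sequential continuity is all that is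
  needed.\<close>

definition sublinear :: "('a::real_vector \<Rightarrow> real) \<Rightarrow> bool" where
  "sublinear q \<longleftrightarrow> (\<forall>x y. q (x + y) \<le> q x + q y) \<and> (\<forall>c x. 0 < c \<longrightarrow> q (c *\<^sub>R x) = c * q x)"

lemma sublinear_zero: "sublinear q \<Longrightarrow> q 0 = 0"
proof -
  assume "sublinear q"
  then have "q (2 *\<^sub>R 0) = 2 * q 0" unfolding sublinear_def by (metis zero_less_numeral)
  then show "q 0 = 0" by simp
qed

lemma sublinear_neg: "sublinear q \<Longrightarrow> - q (- x) \<le> q x"
proof -
  assume q: "sublinear q"
  then have "q (x + - x) \<le> q x + q (- x)" unfolding sublinear_def by blast
  then show ?thesis using sublinear_zero[OF q] by simp
qed

text \<open>The formula is forced: a sublinear \<open>r\<close> below \<open>q\<close> with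
  \<open>r (- y) \<le> - q y\<close> satisfies \<open>r x \<le> r (x + t *\<^sub>R y) + t * r (- y)
  \<le> q (x + t *\<^sub>R y) - t * q y\<close>. A minimal sublinear functional equals all its
  tilts, hence is odd, hence linear.\<close>

lemma sublinear_tilt:
  assumes q: "sublinear q"
  defines "q' \<equiv> \<lambda>y x. INF t\<in>{0..}. q (x + t *\<^sub>R y) - t * q y"
  shows "sublinear (q' y)" "q' y x \<le> q x" "q' y (- y) \<le> - q y"
proof -
  have add: "q (u + v) \<le> q u + q v" and hom: "0 < c \<Longrightarrow> q (c *\<^sub>R u) = c * q u" for c u v
    using q by (auto simp: sublinear_def)
  have hom0: "0 \<le> c \<Longrightarrow> q (c *\<^sub>R u) = c * q u" for c u
    using hom[of c u] sublinear_zero[OF q] by (cases "c = 0") auto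
  \<comment> \<open>The infimum is finite because \<open>t *\<^sub>R y\<close> is the sum of
    \<open>x + t *\<^sub>R y\<close> and \<open>- x\<close>.\<close>
  have lb: "- q (- x) \<le> q (x + t *\<^sub>R y) - t * q y" if "t \<ge> 0" for x t
    using add[of "x + t *\<^sub>R y" "- x"] hom0[OF that, of y] by simp
  have bdd: "bdd_below ((\<lambda>t. q (x + t *\<^sub>R y) - t * q y) ` {0..})" for x
    using lb[of _ x] by (intro bdd_belowI2[where m = "- q (- x)"]) auto
  have le: "q' y x \<le> q (x + t *\<^sub>R y) - t * q y" if "t \<ge> 0" for x t
    unfolding q'_def using that by (intro cINF_lower bdd) auto
  have ge: "c \<le> q' y x" if "\<And>t. t \<ge> 0 \<Longrightarrow> c \<le> q (x + t *\<^sub>R y) - t * q y" for c x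
    unfolding q'_def using that by (intro cINF_greatest) auto
  show "q' y x \<le> q x" using le[of 0 x] by simp
  show "q' y (- y) \<le> - q y"
    using le[of 1 "- y"] sublinear_zero[OF q] by simp
  have sub: "q' y (u + v) \<le> q' y u + q' y v" for u v
  proof -
    have "q' y (u + v) - (q (v + s *\<^sub>R y) - s * q y) \<le> q' y u" if "s \<ge> 0" for s
    proof (rule ge)
      fix t :: real assume "t \<ge> 0"
      with le[of "t + s" "u + v"] add[of "u + t *\<^sub>R y" "v + s *\<^sub>R y"] that
      show "q' y (u + v) - (q (v + s *\<^sub>R y) - s * q y) \<le> q (u + t *\<^sub>R y) - t * q y"
        by (simp add: algebra_simps)
    qed
    then have "q' y (u + v) - q' y u \<le> q' y v"
      by (intro ge) (simp add: algebra_simps)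
    then show ?thesis by simp
  qed
  have scale_le: "q' y (c *\<^sub>R x) \<le> c * q' y x" if "c > 0" for c x
  proof -
    have "q' y (c *\<^sub>R x) / c \<le> q' y x"
    proof (rule ge)
      fix t :: real assume "t \<ge> 0"
      have "q' y (c *\<^sub>R x) \<le> q (c *\<^sub>R x + (c * t) *\<^sub>R y) - (c * t) * q y"
        using \<open>t \<ge> 0\<close> that by (intro le) auto
      also have "\<dots> = c * (q (x + t *\<^sub>R y) - t * q y)"
        using hom[OF that, of "x + t *\<^sub>R y"] by (simp add: algebra_simps)
      finally show "q' y (c *\<^sub>R x) / c \<le> q (x + t *\<^sub>R y) - t * q y"
        using that by (simp add: field_simps)
    qed
    then show ?thesis using that by (simp add: field_simps)
  qed
  have "q' y (c *\<^sub>R x) = c * q' y x" if "c > 0" for c x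
  proof (rule antisym[OF scale_le[OF that]])
    have "q' y ((1 / c) *\<^sub>R c *\<^sub>R x) \<le> 1 / c * q' y (c *\<^sub>R x)"
      using that by (intro scale_le) auto
    then show "c * q' y x \<le> q' y (c *\<^sub>R x)" using that by (simp add: field_simps)
  qed
  with sub show "sublinear (q' y)" by (auto simp: sublinear_def)
qed

text \<open>Zorn's lemma for the reversed pointwise order. The lower bound of a chain is its
  pointwise infimum, which is finite because every member is at least \<open>- p (- x)\<close> at
  \<open>x\<close>.\<close>

lemma minimal_sublinear:
  assumes p: "sublinear p"
  obtains q where "sublinear q" "\<And>x. q x \<le> p x"
    "\<And>r. sublinear r \<Longrightarrow> (\<And>x. r x \<le> q x) \<Longrightarrow> r = q"
proof -
  let ?A = "{q. sublinear q \<and> (\<forall>x. q x \<le> p x)}"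
  let ?P = "\<lambda>q r :: 'a \<Rightarrow> real. \<forall>x. r x \<le> q x"
  have "\<exists>m\<in>?A. \<forall>a\<in>?A. ?P m a \<longrightarrow> a = m"
  proof (rule predicate_Zorn)
    show "partial_order_on ?A (relation_of ?P ?A)"
      by (intro partial_order_on_relation_ofI) (auto intro: order_trans intro!: ext antisym)
    fix C assume C: "C \<in> Chains (relation_of ?P ?A)"
    have CA: "q \<in> ?A" if "q \<in> C" for q
      using C that by (auto simp: Chains_def relation_of_def)
    have Cc: "?P q r \<or> ?P r q" if "q \<in> C" "r \<in> C" for q r
      using C that by (auto simp: Chains_def relation_of_def)
    show "\<exists>u\<in>?A. \<forall>a\<in>C. ?P a u"
    proof (cases "C = {}")
      case True
      then show ?thesis using p by auto
    next
      case False
      define u where "u x = (INF q\<in>C. q x)" for x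
      have lb: "- p (- x) \<le> q x" if "q \<in> C" for q x
        using CA[OF that] sublinear_neg[of q x] by (smt (verit) mem_Collect_eq)
      have bdd: "bdd_below ((\<lambda>q. q x) ` C)" for x
        using lb by (intro bdd_belowI2[where m = "- p (- x)"]) auto
      have le: "u x \<le> q x" if "q \<in> C" for q x
        unfolding u_def using that by (intro cINF_lower bdd) auto
      have ge: "c \<le> u x" if "\<And>q. q \<in> C \<Longrightarrow> c \<le> q x" for c x
        unfolding u_def using that False by (intro cINF_greatest) auto
      have "u (x + y) \<le> u x + u y" for x y
      proof -
        have "u (x + y) - r y \<le> u x" if r: "r \<in> C" for r
        proof (rule ge)
          fix q assume q: "q \<in> C"
          \<comment> \<open>Two members of the chain are comparable, so the smaller one can serve
            both summands.\<close>
          obtain s where s: "s \<in> C" "\<And>x. s x \<le> q x" "\<And>x. s x \<le> r x"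
            using Cc[OF q r] q r by blast
          have "u (x + y) \<le> s (x + y)" by (rule le[OF s(1)])
          also have "\<dots> \<le> s x + s y" using CA[OF s(1)] by (auto simp: sublinear_def)
          finally show "u (x + y) - r y \<le> q x" using s(2)[of x] s(3)[of y] by simp
        qed
        then have "u (x + y) - u x \<le> u y" by (intro ge) (simp add: algebra_simps)
        then show ?thesis by simp
      qed
      moreover have "u (c *\<^sub>R x) = c * u x" if "c > 0" for c x
      proof (rule antisym)
        have hom: "q (c *\<^sub>R x) = c * q x" if "q \<in> C" for q
          using CA[OF that] \<open>c > 0\<close> by (auto simp: sublinear_def)
        have "u (c *\<^sub>R x) / c \<le> u x"
          using le hom that by (intro ge) (force simp: field_simps)
        then show "u (c *\<^sub>R x) \<le> c * u x" using that by (simp add: field_simps)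
        show "c * u x \<le> u (c *\<^sub>R x)"
          using le hom that by (intro ge) (force simp: field_simps)
      qed
      ultimately have "sublinear u" by (auto simp: sublinear_def)
      moreover have "u x \<le> p x" for x
      proof -
        obtain q where q: "q \<in> C" using False by blast
        show ?thesis using le[OF q, of x] CA[OF q] by (auto intro: order_trans)
      qed
      ultimately show ?thesis using le by blast
    qed
  qed
  then obtain q where q: "sublinear q" "\<And>x. q x \<le> p x"
    and min: "\<And>a. a \<in> ?A \<Longrightarrow> ?P q a \<Longrightarrow> a = q" by blast
  show thesis
  proof (rule that[OF q])
    fix r assume r: "sublinear r" "\<And>x. r x \<le> q x"
    have "r x \<le> p x" for x using r(2)[of x] q(2)[of x] by simp
    with r show "r = q" by (intro min) auto
  qed
qed

text \<open>Tilting \<open>p\<close> along \<open>y\<close> before minimising is what makes the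
  functional attain \<open>p y\<close>: it forces \<open>q (- y) \<le> - p y\<close>, and oddness
  turns this into \<open>p y \<le> q y\<close>.\<close>

lemma Hahn_Banach_sublinear:
  fixes p :: "'a::real_vector \<Rightarrow> real"
  assumes p: "sublinear p"
  obtains l where "linear l" "\<And>x. l x \<le> p x" "l y = p y"
proof -
  define p' where "p' = (\<lambda>x. INF t\<in>{0..}. p (x + t *\<^sub>R y) - t * p y)"
  have p': "sublinear p'" "p' x \<le> p x" "p' (- y) \<le> - p y" for x
    using sublinear_tilt[OF p] unfolding p'_def by auto
  obtain q where q: "sublinear q" "\<And>x. q x \<le> p' x"
    and min: "\<And>r. sublinear r \<Longrightarrow> (\<And>x. r x \<le> q x) \<Longrightarrow> r = q"
    using minimal_sublinear[OF p'(1)] by blast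
  have odd: "q (- x) = - q x" for x
  proof -
    \<comment> \<open>By minimality a further tilt along \<open>x\<close> changes nothing, so the
      value of the tilt at \<open>- x\<close> is that of \<open>q\<close>.\<close>
    have "(\<lambda>z. INF t\<in>{0..}. q (z + t *\<^sub>R x) - t * q x) = q"
      using sublinear_tilt[OF q(1)] by (intro min) auto
    from fun_cong[OF this, of "- x"] sublinear_tilt(3)[OF q(1), of x]
    have "q (- x) \<le> - q x" by linarith
    with sublinear_neg[OF q(1), of x] show ?thesis by simp
  qed
  have add: "q (a + b) \<le> q a + q b" and hom: "0 < c \<Longrightarrow> q (c *\<^sub>R a) = c * q a" for a b c
    using q(1) by (auto simp: sublinear_def)
  have "linear q"
  proof (rule linearI)
    show "q (a + b) = q a + q b" for a b
      using add[of a b] add[of "- a" "- b"] odd[of "a + b"] odd[of a] odd[of b] by simp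
    fix c :: real and a
    consider "c > 0" | "c = 0" | "c < 0" by linarith
    then show "q (c *\<^sub>R a) = c *\<^sub>R q a"
    proof cases
      case 3
      then have "q ((- c) *\<^sub>R a) = - c * q a" by (intro hom) simp
      then show ?thesis using odd[of "c *\<^sub>R a"] by simp
    qed (auto simp: hom sublinear_zero[OF q(1)])
  qed
  moreover have "q x \<le> p x" for x using q(2)[of x] p'(2)[of x] by simp
  moreover have "q y = p y"
    using q(2)[of "- y"] p'(3) odd[of y] q(2)[of y] p'(2)[of y] by simp
  ultimately show thesis by (rule that)
qed

section \<open>Functionals measuring the distance to a subspace\<close>

lemma sublinear_infdist:
  fixes Y :: "'a::real_normed_vector set"
  assumes Y: "subspace Y"
  shows "sublinear (\<lambda>x. infdist x Y)"
proof -
  have ne: "Y \<noteq> {}" using subspace_0[OF Y] by auto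
  have approx: "\<exists>w\<in>Y. dist x w < infdist x Y + e" if "e > 0" for x e
  proof -
    have "(INF w\<in>Y. dist x w) < infdist x Y + e" using that by (simp add: infdist_notempty[OF ne])
    then show ?thesis by (subst (asm) cINF_less_iff[OF ne]) auto
  qed
  have add: "infdist (x + y) Y \<le> infdist x Y + infdist y Y" for x y
  proof (rule field_le_epsilon)
    fix e :: real assume "e > 0"
    obtain u where u: "u \<in> Y" "dist x u < infdist x Y + e / 2" using approx[of "e/2" x] \<open>e > 0\<close> by fastforce
    obtain v where v: "v \<in> Y" "dist y v < infdist y Y + e / 2" using approx[of "e/2" y] \<open>e > 0\<close> by fastforce
    have "infdist (x + y) Y \<le> dist (x + y) (u + v)"
      using subspace_add[OF Y u(1) v(1)] by (rule infdist_le)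
    also have "\<dots> \<le> dist x u + dist y v" by (rule dist_triangle_add)
    finally show "infdist (x + y) Y \<le> infdist x Y + infdist y Y + e" using u v by simp
  qed
  have scale_le: "infdist (c *\<^sub>R x) Y \<le> c * infdist x Y" if "c > 0" for c x
  proof (rule field_le_epsilon)
    fix e :: real assume "e > 0"
    obtain u where u: "u \<in> Y" "dist x u < infdist x Y + e / c"
      using approx[of "e / c" x] divide_pos_pos[OF \<open>e > 0\<close> \<open>c > 0\<close>] by blast
    have "infdist (c *\<^sub>R x) Y \<le> dist (c *\<^sub>R x) (c *\<^sub>R u)"
      using subspace_scale[OF Y u(1)] by (rule infdist_le)
    also have "\<dots> = c * dist x u" using that by (simp add: dist_norm flip: scaleR_diff_right)
    also have "\<dots> \<le> c * (infdist x Y + e / c)" using u that by (intro mult_left_mono) auto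
    also have "\<dots> = c * infdist x Y + e" using that by (simp add: distrib_left)
    finally show "infdist (c *\<^sub>R x) Y \<le> c * infdist x Y + e" .
  qed
  have "infdist (c *\<^sub>R x) Y = c * infdist x Y" if "c > 0" for c x
  proof (rule antisym[OF scale_le[OF that]])
    have "infdist ((1 / c) *\<^sub>R c *\<^sub>R x) Y \<le> 1 / c * infdist (c *\<^sub>R x) Y"
      using that by (intro scale_le) auto
    then show "c * infdist x Y \<le> infdist (c *\<^sub>R x) Y" using that by (simp add: field_simps)
  qed
  with add show ?thesis by (auto simp: sublinear_def)
qed

text \<open>Domination by the distance gives everything at once: it vanishes on \<open>Y\<close>,
  and it is at most the norm because \<open>0 \<in> Y\<close>. With \<open>Y = {0}\<close> the
  functional is norming; for closed \<open>Y\<close> it decides membership in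
  \<open>Y\<close>.\<close>

lemma Hahn_Banach_infdist:
  fixes Y :: "'a::real_normed_vector set"
  assumes Y: "subspace Y"
  obtains \<xi> :: "'a \<Rightarrow>\<^sub>L real" where "norm \<xi> \<le> 1" "\<xi> y = infdist y Y" "\<And>w. w \<in> Y \<Longrightarrow> \<xi> w = 0"
proof -
  obtain l where l: "linear l" "\<And>x. l x \<le> infdist x Y" "l y = infdist y Y"
    using Hahn_Banach_sublinear[OF sublinear_infdist[OF Y]] by blast
  have "infdist x Y \<le> norm x" for x
    using infdist_le[OF subspace_0[OF Y], of x] by simp
  then have le: "l x \<le> norm x" for x using l(2)[of x] by (rule order_trans[rotated])
  have abs: "\<bar>l x\<bar> \<le> norm x" for x
    using le[of x] le[of "- x"] linear_neg[OF l(1), of x] by auto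
  have bl: "bounded_linear l"
    using linear_add[OF l(1)] linear_scale[OF l(1)] abs
    by (intro bounded_linear_intro[of l 1]) auto
  define \<xi> where "\<xi> = Blinfun l"
  have app: "blinfun_apply \<xi> = l" unfolding \<xi>_def by (rule bounded_linear_Blinfun_apply[OF bl])
  show thesis
  proof (rule that[of \<xi>])
    show "norm \<xi> \<le> 1" using abs by (intro norm_blinfun_bound) (auto simp: app)
    show "\<xi> y = infdist y Y" by (simp add: app l)
    fix w assume w: "w \<in> Y"
    have "l w \<le> 0" using l(2)[of w] w by simp
    moreover have "l (- w) \<le> 0" using l(2)[of "- w"] subspace_neg[OF Y w] by simp
    ultimately show "\<xi> w = 0" by (simp add: app linear_neg[OF l(1)])
  qed
qed

lemma norming_functional:
  fixes x :: "'a::real_normed_vector"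
  obtains \<xi> :: "'a \<Rightarrow>\<^sub>L real" where "norm \<xi> \<le> 1" "\<xi> x = norm x"
  using Hahn_Banach_infdist[of "{0}" x] by (auto simp: subspace_def)

lemma blinfun_le_norm:
  fixes \<xi> :: "'a::real_normed_vector \<Rightarrow>\<^sub>L real"
  shows "norm \<xi> \<le> 1 \<Longrightarrow> \<bar>\<xi> x\<bar> \<le> norm x"
  using norm_blinfun[of \<xi> x] mult_right_mono[of "norm \<xi>" 1 "norm x"] by simp

lemma norm_le_of_functionals:
  fixes x :: "'a::real_normed_vector"
  assumes "\<And>\<xi> :: 'a \<Rightarrow>\<^sub>L real. norm \<xi> \<le> 1 \<Longrightarrow> blinfun_apply \<xi> x \<le> c"
  shows "norm x \<le> c"
proof -
  obtain \<xi> :: "'a \<Rightarrow>\<^sub>L real" where "norm \<xi> \<le> 1" "\<xi> x = norm x" by (rule norming_functional)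
  with assms[of \<xi>] show ?thesis by simp
qed

lemma functionals_eqI:
  fixes x y :: "'a::real_normed_vector"
  assumes "\<And>\<xi> :: 'a \<Rightarrow>\<^sub>L real. blinfun_apply \<xi> x = \<xi> y"
  shows "x = y"
proof -
  have "norm (x - y) \<le> 0" using assms by (intro norm_le_of_functionals) (simp add: blinfun.diff_right)
  then show ?thesis by simp
qed

lemma tendsto_imp_weakly_tendsto: "u \<longlonglongrightarrow> l \<Longrightarrow> weakly_tendsto u l"
  unfolding weakly_tendsto_def by (intro allI tendsto_intros) auto

lemma weakly_tendsto_subseq: "weakly_tendsto u l \<Longrightarrow> strict_mono s \<Longrightarrow> weakly_tendsto (u \<circ> s) l"
  using LIMSEQ_subseq_LIMSEQ[of "\<lambda>n. blinfun_apply \<xi> (u n)" "blinfun_apply \<xi> l" s for \<xi> :: "_ \<Rightarrow>\<^sub>L real"]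
  by (simp add: weakly_tendsto_def comp_def)

lemma weakly_tendsto_norm_le:
  assumes "weakly_tendsto u l" "\<And>n. norm (u n) \<le> c"
  shows "norm l \<le> c"
proof (rule norm_le_of_functionals)
  fix \<xi> :: "'a \<Rightarrow>\<^sub>L real" assume "norm \<xi> \<le> 1"
  then have "\<xi> (u n) \<le> c" for n
    using blinfun_le_norm[of \<xi> "u n"] assms(2)[of n] by simp
  then show "\<xi> l \<le> c"
    using assms(1) unfolding weakly_tendsto_def by (intro LIMSEQ_le_const2[of "\<lambda>n. \<xi> (u n)"]) auto
qed

text \<open>The functional whose value at \<open>l\<close> is the distance to \<open>Y\<close>
  vanishes along the sequence, hence also at its weak limit.\<close>

lemma closed_subspace_weakly_closed:
  fixes Y :: "'a::real_normed_vector set"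
  assumes Y: "subspace Y" "closed Y" and "weakly_tendsto u l" "\<And>n. u n \<in> Y"
  shows "l \<in> Y"
proof -
  obtain \<xi> :: "'a \<Rightarrow>\<^sub>L real" where \<xi>: "\<xi> l = infdist l Y" "\<And>w. w \<in> Y \<Longrightarrow> \<xi> w = 0"
    using Hahn_Banach_infdist[OF Y(1)] by metis
  have "(\<lambda>n. \<xi> (u n)) \<longlonglongrightarrow> \<xi> l" using assms(3) by (simp add: weakly_tendsto_def)
  then have "infdist l Y = 0" using \<xi> assms(4) by (simp add: LIMSEQ_const_iff)
  then show ?thesis using in_closed_iff_infdist_zero[OF Y(2)] subspace_0[OF Y(1)] by auto
qed

section \<open>Separable subspaces and the Pettis integral\<close>

text \<open>Only rational multiples are added, to keep \<open>S\<close> countable; the real subspace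
  appears after taking the closure. The maps \<open>\<Phi> n\<close> will be sections of
  \<open>f\<close> at a countable dense set of points; with the identity the lemma just yields a
  separable closed span.\<close>

lemma countable_subspace_hull:
  fixes S0 :: "'a::real_normed_vector set" and \<Phi> :: "nat \<Rightarrow> 'a \<Rightarrow> 'a"
  assumes "countable S0"
  obtains S where "countable S" "S0 \<subseteq> S" "subspace (closure S)" "\<And>n a. a \<in> S \<Longrightarrow> \<Phi> n a \<in> S"
proof -
  define H where "H S = insert 0 S \<union> (\<lambda>(a, b). a + b) ` (S \<times> S)
      \<union> (\<lambda>(q, a). q *\<^sub>R a) ` (\<rat> \<times> S) \<union> (\<lambda>(n, a). \<Phi> n a) ` (UNIV \<times> S)" for S :: "'a set"
  define S where "S = (\<Union>n. (H ^^ n) S0)"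
  have cnt: "countable ((H ^^ n) S0)" for n
  proof (induction n)
    case (Suc n)
    then show ?case by (auto simp: H_def countable_rat)
  qed (simp add: assms)
  have mono: "(H ^^ m) S0 \<subseteq> (H ^^ n) S0" if "m \<le> n" for m n
    using that by (rule lift_Suc_mono_le[rotated]) (auto simp: H_def)
  have step: "H ((H ^^ n) S0) \<subseteq> S" for n
    unfolding S_def using UN_upper[of "Suc n" UNIV "\<lambda>n. (H ^^ n) S0"] by simp
  have zero: "0 \<in> S" using step[of 0] by (auto simp: H_def)
  have add: "a + b \<in> S" if "a \<in> S" "b \<in> S" for a b
  proof -
    from that obtain m n where "a \<in> (H ^^ m) S0" "b \<in> (H ^^ n) S0" unfolding S_def by blast
    then have "a \<in> (H ^^ max m n) S0" "b \<in> (H ^^ max m n) S0"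
      using mono[of m "max m n"] mono[of n "max m n"] by auto
    then show ?thesis using step[of "max m n"] by (force simp: H_def)
  qed
  have scale: "q *\<^sub>R a \<in> S" if "a \<in> S" "q \<in> \<rat>" for q a
  proof -
    from that obtain n where "a \<in> (H ^^ n) S0" unfolding S_def by blast
    then show ?thesis using step[of n] that(2) by (force simp: H_def)
  qed
  have map: "\<Phi> n a \<in> S" if "a \<in> S" for n a
  proof -
    from that obtain m where "a \<in> (H ^^ m) S0" unfolding S_def by blast
    then show ?thesis using step[of m] by (force simp: H_def)
  qed
  have "subspace (closure S)"
  proof (rule subspaceI)
    show "0 \<in> closure S" using zero closure_subset by blast
    fix x assume "x \<in> closure S"
    then obtain u where u: "\<And>n. u n \<in> S" "u \<longlonglongrightarrow> x" unfolding closure_sequential by blast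
    {
      fix y assume "y \<in> closure S"
      then obtain v where v: "\<And>n. v n \<in> S" "v \<longlonglongrightarrow> y" unfolding closure_sequential by blast
      have "(\<lambda>n. u n + v n) \<longlonglongrightarrow> x + y" using u v by (intro tendsto_intros)
      then show "x + y \<in> closure S" unfolding closure_sequential using add u v by (intro exI[of _ "\<lambda>n. u n + v n"]) auto
    }
    fix c :: real
    have "c \<in> closure \<rat>" using Rats_closure_real by simp
    then obtain q where q: "\<And>n. q n \<in> \<rat>" "q \<longlonglongrightarrow> c" unfolding closure_sequential by blast
    have "(\<lambda>n. q n *\<^sub>R u n) \<longlonglongrightarrow> c *\<^sub>R x" using u q by (intro tendsto_intros)
    then show "c *\<^sub>R x \<in> closure S" unfolding closure_sequential using scale u q by (intro exI[of _ "\<lambda>n. q n *\<^sub>R u n"]) auto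
  qed
  moreover have "countable S" unfolding S_def using cnt by blast
  moreover have "S0 \<subseteq> S" unfolding S_def using UN_upper[of 0 UNIV "\<lambda>n. (H ^^ n) S0"] by simp
  ultimately show thesis using map that by blast
qed

text \<open>A countable substitute for the dual unit ball. It turns norm inequalities on
  \<open>Y\<close> into countably many scalar ones, which is what measurability and diagonal
  arguments require.\<close>

definition norming_for :: "'a::real_normed_vector set \<Rightarrow> (nat \<Rightarrow> 'a \<Rightarrow>\<^sub>L real) \<Rightarrow> bool" where
  "norming_for Y \<xi> \<longleftrightarrow> (\<forall>k. norm (\<xi> k) \<le> 1) \<and> (\<forall>y\<in>Y. \<forall>e>0. \<exists>k. norm y - e < \<xi> k y)"

text \<open>Norming functionals of a countable dense set suffice, since functionals of norm at most
  1 and the norm itself are 1-Lipschitz: moving from \<open>y\<close> to a nearby \<open>s\<close>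
  costs half of \<open>e\<close> for each.\<close>

lemma norming_sequence:
  fixes S :: "'a::real_normed_vector set"
  assumes "countable S" "subspace (closure S)"
  obtains \<xi> where "norming_for (closure S) \<xi>"
proof -
  have "S \<noteq> {}" using subspace_0[OF assms(2)] by auto
  then have rng: "range (from_nat_into S) = S" using assms(1) by (rule range_from_nat_into)
  have "\<exists>\<xi> :: 'a \<Rightarrow>\<^sub>L real. norm \<xi> \<le> 1 \<and> blinfun_apply \<xi> x = norm x" for x
    using norming_functional[of x] by blast
  then obtain N :: "'a \<Rightarrow> 'a \<Rightarrow>\<^sub>L real" where N: "\<And>x. norm (N x) \<le> 1" "\<And>x. N x x = norm x" by metis
  have "norming_for (closure S) (\<lambda>k. N (from_nat_into S k))"
    unfolding norming_for_def
  proof (intro conjI ballI allI impI)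
    fix y and e :: real assume "y \<in> closure S" "e > 0"
    then obtain s where s: "s \<in> S" "dist s y < e / 2"
      unfolding closure_approachable by (meson half_gt_zero)
    then obtain k where k: "s = from_nat_into S k" using rng by blast
    have "norm y \<le> norm s + e / 2" using s(2) norm_triangle_ineq2[of y s] by (simp add: dist_norm norm_minus_commute)
    moreover have "\<bar>N s (s - y)\<bar> < e / 2" using blinfun_le_norm[OF N(1), of s "s - y"] s(2) by (simp add: dist_norm)
    ultimately show "\<exists>k. norm y - e < N (from_nat_into S k) y"
      using N(2)[of s] unfolding k blinfun.diff_right by (intro exI[of _ k]) linarith
  qed (rule N)
  then show thesis by (rule that)
qed

lemma norming_for_norm_le_iff:
  assumes "norming_for Y \<xi>" "y \<in> Y"
  shows "norm y \<le> c \<longleftrightarrow> (\<forall>k. \<xi> k y \<le> c)"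
proof
  assume "norm y \<le> c"
  then show "\<forall>k. \<xi> k y \<le> c"
    using assms(1) blinfun_le_norm[of "\<xi> _" y] unfolding norming_for_def
    by (meson abs_le_D1 order_trans)
next
  assume le: "\<forall>k. \<xi> k y \<le> c"
  show "norm y \<le> c"
  proof (rule field_le_epsilon)
    fix e :: real assume "e > 0"
    then obtain k where "norm y - e < \<xi> k y" using assms unfolding norming_for_def by blast
    with le show "norm y \<le> c + e" by (smt (verit))
  qed
qed

lemma norming_for_eqI:
  assumes "norming_for Y \<xi>" "subspace Y" "x \<in> Y" "y \<in> Y" "\<And>k. \<xi> k x = \<xi> k y"
  shows "x = y"
proof -
  have "norm (x - y) \<le> 0"
    using norming_for_norm_le_iff[OF assms(1) subspace_diff[OF assms(2-4)], of 0] assms(5)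
    by (simp add: blinfun.diff_right)
  then show ?thesis by simp
qed

text \<open>The given dense points need not lie in \<open>A\<close>. Each small ball around one of
  them that meets \<open>A\<close> contributes one point of \<open>A\<close>.\<close>

lemma separable_subset:
  fixes A :: "'a::metric_space set"
  assumes "countable S" "A \<subseteq> closure S"
  obtains T where "countable T" "T \<subseteq> A" "A \<subseteq> closure T"
proof -
  define P where "P = {(s, n :: nat). s \<in> S \<and> (\<exists>a\<in>A. dist s a < 1 / Suc n)}"
  define t where "t p = (SOME a. a \<in> A \<and> dist (fst p) a < 1 / Suc (snd p))" for p :: "'a \<times> nat"
  have t: "t p \<in> A" "dist (fst p) (t p) < 1 / Suc (snd p)" if "p \<in> P" for p
  proof -
    have "\<exists>a. a \<in> A \<and> dist (fst p) a < 1 / Suc (snd p)" using that by (auto simp: P_def)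
    from someI_ex[OF this] show "t p \<in> A" "dist (fst p) (t p) < 1 / Suc (snd p)" by (simp_all add: t_def)
  qed
  have "P \<subseteq> S \<times> UNIV" unfolding P_def by auto
  then have "countable P" using assms(1) by (meson countable_SIGMA countableI_type countable_subset)
  moreover have "A \<subseteq> closure (t ` P)"
  proof
    fix a assume a: "a \<in> A"
    show "a \<in> closure (t ` P)"
      unfolding closure_approachable
    proof (intro allI impI)
      fix e :: real assume "e > 0"
      then obtain n where n: "1 / Suc n < e / 2" by (metis half_gt_zero nat_approx_posE)
      obtain s where s: "s \<in> S" "dist s a < 1 / Suc n"
        using assms(2) a unfolding closure_approachable by (metis closure_approachable of_nat_0_less_iff subsetD zero_less_Suc zero_less_divide_1_iff)
      then have P: "(s, n) \<in> P" using a unfolding P_def by auto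
      have "dist (t (s, n)) a \<le> dist s (t (s, n)) + dist s a" by (metis dist_commute dist_triangle)
      also have "\<dots> < e" using t(2)[OF P] s(2) n by simp
      finally show "\<exists>y\<in>t ` P. dist y a < e" using P by blast
    qed
  qed
  ultimately show thesis using t(1) by (intro that[of "t ` P"]) auto
qed

text \<open>Although \<open>g\<close> is only weakly measurable, its separable range is covered by
  countably many small balls with measurable preimages. Finitely many of them exhaust the space up
  to small measure, and the resulting simple function has a barycentre in the hull. The error is
  uniform over functionals of bounded norm, which later gives convergence in norm.\<close>

lemma (in finite_measure) pettis_approx:
  fixes g :: "'a \<Rightarrow> 'b::real_normed_vector"
  assumes S: "countable S" "g ` space M \<subseteq> closure S"
    and ne: "space M \<noteq> {}"
    and meas: "\<And>\<xi> :: 'b \<Rightarrow>\<^sub>L real. (\<lambda>p. \<xi> (g p)) \<in> borel_measurable M"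
    and bdd: "\<And>p. p \<in> space M \<Longrightarrow> norm (g p) \<le> B"
    and "e > 0"
  obtains w where "w \<in> convex hull (g ` space M)"
    "\<And>\<xi> :: 'b \<Rightarrow>\<^sub>L real. \<bar>measure M (space M) * blinfun_apply \<xi> w - (\<integral>p. blinfun_apply \<xi> (g p) \<partial>M)\<bar> \<le> e * norm \<xi>"
proof -
  obtain S' where S': "countable S'" "S \<subseteq> S'" "subspace (closure S')"
    using countable_subspace_hull[OF S(1), of "\<lambda>n a. a"] by metis
  obtain \<eta> where \<eta>: "norming_for (closure S') \<eta>" using norming_sequence[OF S'(1,3)] by blast
  obtain T where T: "countable T" "T \<subseteq> g ` space M" "g ` space M \<subseteq> closure T"
    using separable_subset[OF S] by blast
  define m where "m = measure M (space M)"
  have m: "m \<ge> 0" by (simp add: m_def)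
  have "T \<noteq> {}" using T ne by auto
  define d where "d = from_nat_into T"
  have rng: "range d = T" unfolding d_def using \<open>T \<noteq> {}\<close> T(1) by (rule range_from_nat_into)
  have dT: "d k \<in> g ` space M" for k using T(2) rng by blast
  have B: "B \<ge> 0" using bdd ne norm_ge_zero order_trans by blast
  \<comment> \<open>\<open>e1\<close> is the pointwise error where \<open>g\<close> is approximated,
    \<open>e2\<close> the measure of the rest, where the error is at most \<open>2 * B\<close>. Each
    part contributes at most \<open>e / 2\<close>; the added 1 keeps the denominators
    positive.\<close>
  define e1 where "e1 = e / (2 * (m + 1))"
  define e2 where "e2 = e / (4 * (B + 1))"
  have e1: "e1 > 0" "e1 * m \<le> e / 2" and e2: "e2 > 0" "2 * B * e2 \<le> e / 2"
    using \<open>e > 0\<close> m B by (auto simp: e1_def e2_def field_simps)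
  define A where "A k = {p \<in> space M. norm (g p - d k) \<le> e1}" for k
  \<comment> \<open>The norming family writes the preimage of a ball as a countable intersection of
    scalar conditions, so weak measurability is enough.\<close>
  have Aeq: "A k = {p \<in> space M. \<forall>j. \<eta> j (g p) - \<eta> j (d k) \<le> e1}" for k
  proof -
    have "norm (g p - d k) \<le> e1 \<longleftrightarrow> (\<forall>j. \<eta> j (g p - d k) \<le> e1)" if "p \<in> space M" for p
      using that dT[of k] S(2) closure_mono[OF S'(2)]
      by (intro norming_for_norm_le_iff[OF \<eta>] subspace_diff[OF S'(3)]) auto
    then show ?thesis unfolding A_def by (auto simp: blinfun.diff_right)
  qed
  have A[measurable]: "A k \<in> sets M" for k
    unfolding Aeq using meas by measurable
  have cover: "(\<Union>k. A k) = space M"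
  proof (intro equalityI subsetI)
    fix p assume p: "p \<in> space M"
    then have "g p \<in> closure T" using T(3) by blast
    then obtain t where "t \<in> T" "dist t (g p) < e1" using e1(1) unfolding closure_approachable by blast
    then obtain k where "dist (d k) (g p) < e1" using rng by blast
    then show "p \<in> (\<Union>k. A k)" using p by (auto simp: A_def dist_norm norm_minus_commute intro!: exI[of _ k])
  qed (auto simp: A_def)
  define U where "U n = (\<Union>k<n. A k)" for n
  have U[measurable]: "U n \<in> sets M" for n unfolding U_def by measurable
  have "(\<lambda>n. measure M (U n)) \<longlonglongrightarrow> measure M (\<Union>n. U n)"
    by (intro finite_Lim_measure_incseq) (auto simp: U_def incseq_def, meson lessThan_iff less_le_trans)
  moreover have "(\<Union>n. U n) = space M" unfolding cover[symmetric] by (auto simp: U_def)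
  ultimately have "eventually (\<lambda>n. m - e2 < measure M (U n)) sequentially"
    using e2(1) by (intro order_tendstoD(1)) (auto simp: m_def)
  then obtain N where N: "m - e2 < measure M (U N)" by (auto simp: eventually_sequentially)
  \<comment> \<open>The least index makes the overlapping sets \<open>A k\<close> disjoint; index 0
    is an arbitrary value off \<open>U N\<close>.\<close>
  define \<kappa> where "\<kappa> p = (if p \<in> U N then LEAST k. p \<in> A k else 0)" for p
  have \<kappa>[measurable]: "\<kappa> \<in> measurable M (count_space UNIV)" unfolding \<kappa>_def by measurable
  have \<kappa>A: "p \<in> A (\<kappa> p)" "\<kappa> p < N" if pU: "p \<in> U N" for p
  proof -
    from pU obtain k where k: "k < N" "p \<in> A k" by (auto simp: U_def)
    then show "p \<in> A (\<kappa> p)" using pU by (auto simp: \<kappa>_def intro: LeastI)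
    have "\<kappa> p \<le> k" using pU k by (auto simp: \<kappa>_def intro: Least_le)
    with k show "\<kappa> p < N" by simp
  qed
  have \<kappa>N: "\<kappa> p \<le> N" for p
    using \<kappa>A(2)[of p] by (cases "p \<in> U N") (auto simp: \<kappa>_def)
  define P where "P k = measure M {p \<in> space M. \<kappa> p = k}" for k
  have int_ind: "integrable M (\<lambda>p. indicator {p \<in> space M. \<kappa> p = k} p * c)" for k and c :: real
    by (intro integrable_mult_left integrable_real_indicator) (auto simp: less_top[symmetric])
  have ind: "(\<integral>p. indicator {p \<in> space M. \<kappa> p = k} p * c \<partial>M) = P k * c" for k and c :: real
    by (auto simp: P_def)
  have decomp: "\<phi> (\<kappa> p) = (\<Sum>k\<le>N. indicator {p \<in> space M. \<kappa> p = k} p * \<phi> k)"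
    if "p \<in> space M" for p and \<phi> :: "nat \<Rightarrow> real"
  proof -
    have "(\<Sum>k\<le>N. indicator {p \<in> space M. \<kappa> p = k} p * \<phi> k) = (\<Sum>k\<le>N. if k = \<kappa> p then \<phi> k else 0)"
      using that by (intro sum.cong) (auto simp: indicator_def)
    then show ?thesis using \<kappa>N by simp
  qed
  have int\<kappa>: "(\<integral>p. \<phi> (\<kappa> p) \<partial>M) = (\<Sum>k\<le>N. P k * \<phi> k)" "integrable M (\<lambda>p. \<phi> (\<kappa> p))" for \<phi> :: "nat \<Rightarrow> real"
  proof -
    have "(\<integral>p. \<phi> (\<kappa> p) \<partial>M) = (\<integral>p. (\<Sum>k\<le>N. indicator {p \<in> space M. \<kappa> p = k} p * \<phi> k) \<partial>M)"
      using decomp by (intro Bochner_Integration.integral_cong) auto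
    also have "\<dots> = (\<Sum>k\<le>N. P k * \<phi> k)"
      by (subst Bochner_Integration.integral_sum) (auto simp only: ind intro!: int_ind)
    finally show "(\<integral>p. \<phi> (\<kappa> p) \<partial>M) = (\<Sum>k\<le>N. P k * \<phi> k)" .
    have "integrable M (\<lambda>p. (\<Sum>k\<le>N. indicator {p \<in> space M. \<kappa> p = k} p * \<phi> k))"
      by (intro Bochner_Integration.integrable_sum int_ind)
    then show "integrable M (\<lambda>p. \<phi> (\<kappa> p))"
      using decomp by (subst Bochner_Integration.integrable_cong) auto
  qed
  have sumP: "(\<Sum>k\<le>N. P k) = m" using int\<kappa>(1)[of "\<lambda>_. 1"] by (simp add: m_def)
  have intg: "integrable M (\<lambda>p. \<xi> (g p))" for \<xi> :: "'b \<Rightarrow>\<^sub>L real"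
  proof (rule integrable_const_bound[where B = "norm \<xi> * B"])
    show "AE p in M. norm (\<xi> (g p)) \<le> norm \<xi> * B"
      using bdd by (intro AE_I2) (meson mult_left_mono norm_blinfun norm_ge_zero order_trans)
  qed (rule meas)
  \<comment> \<open>For a space of measure zero any point of the range serves, since
    \<open>w\<close> is only ever multiplied by \<open>m\<close>.\<close>
  define w where "w = (if m = 0 then d 0 else (\<Sum>k\<le>N. (P k / m) *\<^sub>R d k))"
  have mw: "m * \<xi> w = (\<Sum>k\<le>N. P k * \<xi> (d k))" for \<xi> :: "'b \<Rightarrow>\<^sub>L real"
  proof (cases "m = 0")
    case True
    then have "P k = 0" for k by (metis P_def m_def measure_mono_fmeasurable antisym measure_nonneg bounded_measure)
    then show ?thesis using True by simp
  next
    case False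
    then show ?thesis by (simp add: w_def blinfun.sum_right blinfun.scaleR_right sum_distrib_left)
  qed
  have intU: "integrable M (\<lambda>p. indicator (space M - U N) p :: real)"
    by (intro integrable_real_indicator) (auto simp: less_top[symmetric])
  have err: "\<bar>\<xi> (g p) - \<xi> (d (\<kappa> p))\<bar> \<le> norm \<xi> * (e1 + 2 * B * indicator (space M - U N) p)"
    if p: "p \<in> space M" for p and \<xi> :: "'b \<Rightarrow>\<^sub>L real"
  proof -
    have "norm (g p - d (\<kappa> p)) \<le> e1 + 2 * B * indicator (space M - U N) p"
    proof (cases "p \<in> U N")
      case True
      then show ?thesis using \<kappa>A(1)[OF True] by (auto simp: A_def)
    next
      case False
      have "norm (d (\<kappa> p)) \<le> B" using dT[of "\<kappa> p"] bdd by auto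
      then show ?thesis using False p bdd[OF p] e1(1) norm_triangle_ineq4[of "g p" "d (\<kappa> p)"] by simp
    qed
    then have "norm \<xi> * norm (g p - d (\<kappa> p)) \<le> norm \<xi> * (e1 + 2 * B * indicator (space M - U N) p)"
      by (intro mult_left_mono) auto
    then show ?thesis using norm_blinfun[of \<xi> "g p - d (\<kappa> p)"] by (simp add: blinfun.diff_right)
  qed
  show thesis
  proof (rule that[of w])
    show "w \<in> convex hull (g ` space M)"
    proof (cases "m = 0")
      case True
      then show ?thesis using dT hull_subset[of "g ` space M" convex] by (auto simp: w_def)
    next
      case False
      then show ?thesis using m sumP hull_subset[of "g ` space M" convex] dT
        by (auto simp: w_def P_def simp flip: sum_divide_distrib intro!: convex_sum convex_convex_hull)
    qed
    fix \<xi> :: "'b \<Rightarrow>\<^sub>L real"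
    have "\<bar>m * blinfun_apply \<xi> w - (\<integral>p. blinfun_apply \<xi> (g p) \<partial>M)\<bar> = \<bar>\<integral>p. \<xi> (g p) - \<xi> (d (\<kappa> p)) \<partial>M\<bar>"
      using int\<kappa>[of "\<lambda>k. \<xi> (d k)"] intg[of \<xi>] by (simp add: mw abs_minus_commute)
    also have "\<dots> \<le> (\<integral>p. \<bar>\<xi> (g p) - \<xi> (d (\<kappa> p))\<bar> \<partial>M)" by (rule integral_abs_bound)
    also have "\<dots> \<le> (\<integral>p. norm \<xi> * (e1 + 2 * B * indicator (space M - U N) p) \<partial>M)"
    proof (rule integral_mono)
      show "integrable M (\<lambda>p. norm \<xi> * (e1 + 2 * B * indicator (space M - U N) p))"
        using intU by (intro integrable_mult_right Bochner_Integration.integrable_add integrable_const)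
    qed (use err int\<kappa>(2)[of "\<lambda>k. \<xi> (d k)"] intg[of \<xi>] in auto)
    also have "\<dots> = norm \<xi> * (e1 * m + 2 * B * measure M (space M - U N))"
      using intU by (simp add: m_def)
    also have "measure M (space M - U N) = m - measure M (U N)"
      by (simp add: m_def finite_measure_compl)
    also have "norm \<xi> * (e1 * m + 2 * B * (m - measure M (U N))) \<le> norm \<xi> * (e / 2 + e / 2)"
    proof (intro mult_left_mono add_mono e1(2) norm_ge_zero)
      have "2 * B * (m - measure M (U N)) \<le> 2 * B * e2" using N B by (intro mult_left_mono) auto
      with e2(2) show "2 * B * (m - measure M (U N)) \<le> e / 2" by simp
    qed
    finally show "\<bar>measure M (space M) * blinfun_apply \<xi> w - (\<integral>p. blinfun_apply \<xi> (g p) \<partial>M)\<bar> \<le> e * norm \<xi>"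
      by (simp add: m_def mult.commute)
  qed
qed

text \<open>The second claim is the mean value property: the integral is a norm limit of the total
  mass times points of the convex hull of the range. It is the only way in which compactness of
  values passes through the integral.\<close>

lemma (in finite_measure) pettis_integral:
  fixes g :: "'a \<Rightarrow> 'b::banach"
  assumes S: "countable S" "g ` space M \<subseteq> closure S"
    and ne: "space M \<noteq> {}"
    and meas: "\<And>\<xi> :: 'b \<Rightarrow>\<^sub>L real. (\<lambda>p. \<xi> (g p)) \<in> borel_measurable M"
    and bdd: "\<And>p. p \<in> space M \<Longrightarrow> norm (g p) \<le> B"
  obtains x where "\<And>\<xi> :: 'b \<Rightarrow>\<^sub>L real. \<xi> x = (\<integral>p. \<xi> (g p) \<partial>M)"
    "\<And>e. e > 0 \<Longrightarrow> \<exists>w \<in> convex hull (g ` space M). norm (x - measure M (space M) *\<^sub>R w) \<le> e"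
proof -
  define m where "m = measure M (space M)"
  have "\<exists>w. w \<in> convex hull (g ` space M) \<and>
      (\<forall>\<xi> :: 'b \<Rightarrow>\<^sub>L real. \<bar>m * blinfun_apply \<xi> w - (\<integral>p. blinfun_apply \<xi> (g p) \<partial>M)\<bar> \<le> (1 / real (Suc n)) * norm \<xi>)" for n :: nat
    using pettis_approx[OF S ne meas bdd, of "1 / real (Suc n)"] unfolding m_def by (metis zero_less_Suc of_nat_0_less_iff zero_less_divide_1_iff)
  then obtain w where w: "\<And>n. w n \<in> convex hull (g ` space M)"
    and err: "\<And>n \<xi>. \<bar>m * blinfun_apply \<xi> (w n) - (\<integral>p. \<xi> (g p) \<partial>M)\<bar> \<le> (1 / real (Suc n)) * norm \<xi>"
    by metis
  \<comment> \<open>Because the error bound is uniform on the dual unit ball, the barycentres are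
    Cauchy in norm and completeness applies; being weakly Cauchy would not produce a limit.\<close>
  have diff: "norm (m *\<^sub>R w i - m *\<^sub>R w j) \<le> 1 / real (Suc i) + 1 / real (Suc j)" for i j
  proof (rule norm_le_of_functionals)
    fix \<xi> :: "'b \<Rightarrow>\<^sub>L real" assume \<xi>: "norm \<xi> \<le> 1"
    have le: "\<bar>m * blinfun_apply \<xi> (w n) - (\<integral>p. blinfun_apply \<xi> (g p) \<partial>M)\<bar> \<le> 1 / real (Suc n)" for n
      using err[of \<xi> n] \<xi> mult_left_mono[OF \<xi>, of "1 / real (Suc n)"] by simp
    show "\<xi> (m *\<^sub>R w i - m *\<^sub>R w j) \<le> 1 / real (Suc i) + 1 / real (Suc j)"
      using le[of i] le[of j] by (simp add: blinfun.diff_right blinfun.scaleR_right)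
  qed
  have "Cauchy (\<lambda>n. m *\<^sub>R w n)"
  proof (rule metric_CauchyI)
    fix e :: real assume "e > 0"
    then obtain N where N: "1 / real (Suc N) < e / 2" by (metis half_gt_zero nat_approx_posE)
    have "dist (m *\<^sub>R w i) (m *\<^sub>R w j) < e" if "i \<ge> N" "j \<ge> N" for i j
    proof -
      have "1 / real (Suc i) \<le> 1 / real (Suc N)" "1 / real (Suc j) \<le> 1 / real (Suc N)"
        using that by (auto intro!: divide_left_mono)
      then show ?thesis using diff[of i j] N by (simp add: dist_norm)
    qed
    then show "\<exists>N. \<forall>i\<ge>N. \<forall>j\<ge>N. dist (m *\<^sub>R w i) (m *\<^sub>R w j) < e" by blast
  qed
  then obtain x where x: "(\<lambda>n. m *\<^sub>R w n) \<longlonglongrightarrow> x" using Cauchy_convergent convergent_def by blast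
  show thesis
  proof (rule that[of x])
    fix \<xi> :: "'b \<Rightarrow>\<^sub>L real"
    have "(\<lambda>n. m * blinfun_apply \<xi> (w n) - (\<integral>p. blinfun_apply \<xi> (g p) \<partial>M)) \<longlonglongrightarrow> 0"
    proof (rule Lim_null_comparison)
      show "\<forall>\<^sub>F n in sequentially. norm (m * blinfun_apply \<xi> (w n) - (\<integral>p. blinfun_apply \<xi> (g p) \<partial>M)) \<le> (1 / real (Suc n)) * norm \<xi>"
        using err by auto
      show "(\<lambda>n. (1 / real (Suc n)) * norm \<xi>) \<longlonglongrightarrow> 0"
        using tendsto_mult_left_zero[OF LIMSEQ_inverse_real_of_nat] by (simp add: inverse_eq_divide)
    qed
    then have "(\<lambda>n. \<xi> (m *\<^sub>R w n)) \<longlonglongrightarrow> (\<integral>p. \<xi> (g p) \<partial>M)"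
      by (simp add: blinfun.scaleR_right LIM_zero_iff)
    moreover have "(\<lambda>n. \<xi> (m *\<^sub>R w n)) \<longlonglongrightarrow> \<xi> x" by (intro tendsto_intros x)
    ultimately show "\<xi> x = (\<integral>p. \<xi> (g p) \<partial>M)" by (blast intro: LIMSEQ_unique)
  next
    fix e :: real assume "e > 0"
    then obtain n where "dist (m *\<^sub>R w n) x < e" using x unfolding lim_sequentially by blast
    then show "\<exists>w \<in> convex hull (g ` space M). norm (x - measure M (space M) *\<^sub>R w) \<le> e"
      using w[of n] by (intro bexI[of _ "w n"]) (auto simp: m_def dist_norm norm_minus_commute)
  qed
qed

text \<open>The mean value clause needs a point of the convex hull, so \<open>R\<close> has to be
  nonempty; callers treat empty sets separately.\<close>

lemma pettis_set_integral:
  fixes g :: "'a \<Rightarrow> 'b::banach"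
  assumes R: "R \<in> sets M" "emeasure M R < \<infinity>" "R \<noteq> {}"
    and S: "countable S" "g ` R \<subseteq> closure S"
    and meas: "\<And>\<xi> :: 'b \<Rightarrow>\<^sub>L real. (\<lambda>p. indicator R p *\<^sub>R \<xi> (g p)) \<in> borel_measurable M"
    and bdd: "\<And>p. p \<in> R \<Longrightarrow> norm (g p) \<le> B"
  obtains x where "\<And>\<xi> :: 'b \<Rightarrow>\<^sub>L real. \<xi> x = (LINT p:R|M. \<xi> (g p))"
    "\<And>e. e > 0 \<Longrightarrow> \<exists>w \<in> convex hull (g ` R). norm (x - measure M R *\<^sub>R w) \<le> e"
proof -
  let ?N = "restrict_space M R"
  have Rsp: "R \<inter> space M = R" using sets.sets_into_space[OF R(1)] by auto
  have sp: "space ?N = R" using Rsp by (auto simp: space_restrict_space)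
  have ms: "measure ?N R = measure M R" using R Rsp by (simp add: measure_restrict_space)
  interpret N: finite_measure ?N
    using R Rsp by (intro finite_measureI) (simp add: sp emeasure_restrict_space)
  have int: "(\<integral>p. \<xi> (g p) \<partial>?N) = (LINT p:R|M. \<xi> (g p))" for \<xi> :: "'b \<Rightarrow>\<^sub>L real"
    using R Rsp by (subst integral_restrict_space) (auto simp: set_lebesgue_integral_def)
  have meas': "(\<lambda>p. \<xi> (g p)) \<in> borel_measurable ?N" for \<xi> :: "'b \<Rightarrow>\<^sub>L real"
    using meas[of \<xi>] R Rsp by (subst borel_measurable_restrict_space_iff) auto
  show thesis
  proof (rule N.pettis_integral[of S g B, unfolded sp int ms])
    show "countable S" "g ` R \<subseteq> closure S" "R \<noteq> {}" by fact+
  qed (use meas' bdd that in blast)+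
qed

section \<open>Relative weak sequential compactness\<close>

lemma LIMSEQ_fun_iff:
  fixes x :: "nat \<Rightarrow> 'i \<Rightarrow> 'b::topological_space"
  shows "x \<longlonglongrightarrow> r \<longleftrightarrow> (\<forall>k. (\<lambda>n. x n k) \<longlonglongrightarrow> r k)"
  unfolding limitin_canonical_iff[symmetric] euclidean_product_topology[symmetric] limitin_componentwise
  by simp

lemma compact_cube_fun: "compact {r :: 'i \<Rightarrow> real. \<forall>k. r k \<in> {a k..b k}}"
proof -
  have "compactin (product_topology (\<lambda>_. euclidean) UNIV) (PiE UNIV (\<lambda>k. {a k..b k}))"
    unfolding compactin_PiE by simp
  moreover have "PiE UNIV (\<lambda>k. {a k..b k}) = {r :: 'i \<Rightarrow> real. \<forall>k. r k \<in> {a k..b k}}"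
    by (auto simp: PiE_def)
  ultimately show ?thesis by (simp add: euclidean_product_topology)
qed

text \<open>The diagonal extraction is hidden in Tychonoff's theorem: a cube with countably many
  coordinates is compact and first countable, hence sequentially compact.\<close>

lemma bounded_coordinates_subseq:
  fixes x :: "nat \<Rightarrow> nat \<Rightarrow> real"
  assumes "\<And>n k. \<bar>x n k\<bar> \<le> B k"
  obtains s r where "strict_mono s" "\<And>k. (\<lambda>n. x (s n) k) \<longlonglongrightarrow> r k"
proof -
  have "seq_compact {r :: nat \<Rightarrow> real. \<forall>k. r k \<in> {- B k..B k}}"
    by (intro compact_imp_seq_compact compact_cube_fun)
  moreover have "\<forall>n. x n \<in> {r. \<forall>k. r k \<in> {- B k..B k}}"
    using assms by (auto simp: abs_le_iff minus_le_iff)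
  ultimately obtain r s where "strict_mono s" "(x \<circ> s) \<longlonglongrightarrow> r" unfolding seq_compact_def by meson
  then show thesis using that[of s r] by (simp add: LIMSEQ_fun_iff comp_def)
qed

text \<open>The limit need not belong to \<open>A\<close>: this is relative compactness, so it
  passes to subsets and no weak closures have to be taken.\<close>

definition weakly_seq_compact :: "'a::real_normed_vector set \<Rightarrow> bool" where
  "weakly_seq_compact A \<longleftrightarrow>
     (\<forall>u. (\<forall>n. u n \<in> A) \<longrightarrow> (\<exists>l s. strict_mono (s :: nat \<Rightarrow> nat) \<and> weakly_tendsto (u \<circ> s) l))"

lemma weakly_seq_compactD:
  assumes "weakly_seq_compact A" "\<And>n. u n \<in> A"
  obtains l s where "strict_mono (s :: nat \<Rightarrow> nat)" "weakly_tendsto (u \<circ> s) l"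
  using assms unfolding weakly_seq_compact_def by metis

lemma weakly_seq_compact_subset: "weakly_seq_compact B \<Longrightarrow> A \<subseteq> B \<Longrightarrow> weakly_seq_compact A"
  unfolding weakly_seq_compact_def by (meson subsetD)

lemma weakly_tendsto_const: "weakly_tendsto (\<lambda>n. c) c"
  by (simp add: weakly_tendsto_def)

lemma weakly_tendsto_add:
  "weakly_tendsto u a \<Longrightarrow> weakly_tendsto v b \<Longrightarrow> weakly_tendsto (\<lambda>n. u n + v n) (a + b)"
  unfolding weakly_tendsto_def by (simp add: blinfun.add_right tendsto_add)

lemma weakly_tendsto_diff:
  "weakly_tendsto u a \<Longrightarrow> weakly_tendsto v b \<Longrightarrow> weakly_tendsto (\<lambda>n. u n - v n) (a - b)"
  unfolding weakly_tendsto_def by (simp add: blinfun.diff_right tendsto_diff)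

lemma weakly_tendsto_scaleR:
  "weakly_tendsto u a \<Longrightarrow> weakly_tendsto (\<lambda>n. c *\<^sub>R u n) (c *\<^sub>R a)"
  unfolding weakly_tendsto_def by (simp add: blinfun.scaleR_right tendsto_mult_left)

lemma weakly_seq_compact_scaleR:
  assumes "weakly_seq_compact A"
  shows "weakly_seq_compact ((\<lambda>a. c *\<^sub>R a) ` A)"
  unfolding weakly_seq_compact_def
proof (intro allI impI)
  fix u :: "nat \<Rightarrow> 'a" assume "\<forall>n. u n \<in> (\<lambda>a. c *\<^sub>R a) ` A"
  then have "\<forall>n. \<exists>a. a \<in> A \<and> u n = c *\<^sub>R a" by blast
  then obtain v where v: "\<And>n. v n \<in> A" "\<And>n. u n = c *\<^sub>R v n" by metis
  obtain l and s :: "nat \<Rightarrow> nat" where s: "strict_mono s" "weakly_tendsto (v \<circ> s) l"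
    using weakly_seq_compactD[of A v, OF assms v(1)] by blast
  have "u \<circ> s = (\<lambda>n. c *\<^sub>R (v \<circ> s) n)" using v(2) by auto
  then have "weakly_tendsto (u \<circ> s) (c *\<^sub>R l)" using weakly_tendsto_scaleR[OF s(2)] by simp
  with s(1) show "\<exists>l s. strict_mono s \<and> weakly_tendsto (u \<circ> s) l" by blast
qed

lemma weakly_seq_compact_plus:
  assumes "weakly_seq_compact A" "weakly_seq_compact B"
  shows "weakly_seq_compact {a + b | a b. a \<in> A \<and> b \<in> B}"
  unfolding weakly_seq_compact_def
proof (intro allI impI)
  fix u :: "nat \<Rightarrow> 'a" assume "\<forall>n. u n \<in> {a + b | a b. a \<in> A \<and> b \<in> B}"
  then have "\<forall>n. \<exists>a b. a \<in> A \<and> b \<in> B \<and> u n = a + b" by blast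
  then obtain v w where v: "\<And>n. v n \<in> A" and w: "\<And>n. w n \<in> B" and u: "\<And>n. u n = v n + w n" by metis
  obtain l and s :: "nat \<Rightarrow> nat" where s: "strict_mono s" "weakly_tendsto (v \<circ> s) l"
    using weakly_seq_compactD[of A v, OF assms(1) v] by blast
  have "\<And>n. (w \<circ> s) n \<in> B" using w by simp
  then obtain l' and s' :: "nat \<Rightarrow> nat" where s': "strict_mono s'" "weakly_tendsto ((w \<circ> s) \<circ> s') l'"
    using weakly_seq_compactD[of B "w \<circ> s", OF assms(2)] by blast
  have "weakly_tendsto (\<lambda>n. ((v \<circ> s) \<circ> s') n + ((w \<circ> s) \<circ> s') n) (l + l')"
    using weakly_tendsto_subseq[OF s(2) s'(1)] s'(2) by (rule weakly_tendsto_add)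
  then have "weakly_tendsto (u \<circ> (s \<circ> s')) (l + l')" using u by (simp add: comp_def)
  with strict_mono_o[OF s(1) s'(1)] show "\<exists>l s. strict_mono s \<and> weakly_tendsto (u \<circ> s) l" by blast
qed

lemma weakly_seq_compact_singleton: "weakly_seq_compact {c}"
proof -
  have "\<exists>l s. strict_mono s \<and> weakly_tendsto (u \<circ> s) l" if "\<forall>n. u n \<in> {c}" for u :: "nat \<Rightarrow> 'a"
  proof -
    have "u = (\<lambda>n. c)" using that by auto
    then have "strict_mono (id :: nat \<Rightarrow> nat) \<and> weakly_tendsto (u \<circ> id) c"
      by (simp add: weakly_tendsto_const strict_mono_def)
    then show ?thesis by blast
  qed
  then show ?thesis unfolding weakly_seq_compact_def by blast
qed

text \<open>A sequence is eventually in \<open>A\<close> or equals \<open>c\<close> infinitely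
  often.\<close>

lemma weakly_seq_compact_insert:
  assumes "weakly_seq_compact A"
  shows "weakly_seq_compact (insert c A)"
  unfolding weakly_seq_compact_def
proof (intro allI impI)
  fix u :: "nat \<Rightarrow> 'a" assume u: "\<forall>n. u n \<in> insert c A"
  show "\<exists>l s. strict_mono (s :: nat \<Rightarrow> nat) \<and> weakly_tendsto (u \<circ> s) l"
  proof (cases "eventually (\<lambda>n. u n \<in> A) sequentially")
    case True
    then obtain N where N: "\<And>n. n \<ge> N \<Longrightarrow> u n \<in> A" by (auto simp: eventually_sequentially)
    obtain l and s :: "nat \<Rightarrow> nat" where s: "strict_mono s" "weakly_tendsto ((\<lambda>n. u (n + N)) \<circ> s) l"
      using weakly_seq_compactD[of A "\<lambda>n. u (n + N)", OF assms N[OF le_add2]] by blast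
    then have "strict_mono (\<lambda>n. s n + N)" "weakly_tendsto (u \<circ> (\<lambda>n. s n + N)) l"
      by (auto simp: strict_mono_def comp_def)
    then show ?thesis by blast
  next
    case False
    obtain s :: "nat \<Rightarrow> nat" where s: "strict_mono s" "\<And>n. u (s n) \<notin> A"
      using not_eventually_sequentiallyD[OF False] by blast
    have "u \<circ> s = (\<lambda>n. c)" using u s(2) by (auto simp: fun_eq_iff)
    then show ?thesis using s(1) weakly_tendsto_const[of c] by metis
  qed
qed

lemma LIMSEQ_subseq_criterion:
  fixes x :: "nat \<Rightarrow> 'b::metric_space"
  assumes "\<And>s. strict_mono (s :: nat \<Rightarrow> nat) \<Longrightarrow> \<exists>r. strict_mono (r :: nat \<Rightarrow> nat) \<and> (\<lambda>n. x (s (r n))) \<longlonglongrightarrow> l"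
  shows "x \<longlonglongrightarrow> l"
proof (rule ccontr)
  assume "\<not> x \<longlonglongrightarrow> l"
  then obtain e where "e > 0" and e: "\<not> eventually (\<lambda>n. dist (x n) l < e) sequentially"
    unfolding tendsto_iff by blast
  obtain s :: "nat \<Rightarrow> nat" where s: "strict_mono s" "\<And>n. \<not> dist (x (s n)) l < e"
    using not_eventually_sequentiallyD[OF e] by blast
  obtain r where "(\<lambda>n. x (s (r n))) \<longlonglongrightarrow> l" using assms[OF s(1)] by blast
  then have "eventually (\<lambda>n. dist (x (s (r n))) l < e) sequentially"
    using \<open>e > 0\<close> by (rule tendstoD)
  then show False using s(2) by simp
qed

text \<open>All subsequential weak limits lie in \<open>Z\<close> and agree on the norming family,
  so they coincide. Compactness thereby upgrades convergence on countably many functionals to weak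
  convergence of the whole sequence.\<close>

lemma weakly_seq_compact_tendsto:
  fixes Z :: "'a::real_normed_vector set"
  assumes A: "weakly_seq_compact A" "\<And>n. u n \<in> A"
    and Z: "subspace Z" "closed Z" "\<And>n. u n \<in> Z" and \<xi>: "norming_for Z \<xi>"
    and lim: "\<And>k. convergent (\<lambda>n. \<xi> k (u n))"
  obtains l where "l \<in> Z" "weakly_tendsto u l"
proof -
  obtain l and s :: "nat \<Rightarrow> nat" where s: "strict_mono s" "weakly_tendsto (u \<circ> s) l" using weakly_seq_compactD[of A u, OF A] by blast
  have coord: "\<xi> k m = lim (\<lambda>n. \<xi> k (u n))" if "strict_mono t" "weakly_tendsto (u \<circ> t) m" for k m t
  proof -
    have "(\<lambda>n. \<xi> k (u (t n))) \<longlonglongrightarrow> lim (\<lambda>n. \<xi> k (u n))"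
      using lim[of k] LIMSEQ_subseq_LIMSEQ[of "\<lambda>n. \<xi> k (u n)", OF _ that(1)]
      by (simp add: convergent_LIMSEQ_iff comp_def)
    moreover have "(\<lambda>n. \<xi> k (u (t n))) \<longlonglongrightarrow> \<xi> k m" using that(2) by (simp add: weakly_tendsto_def)
    ultimately show ?thesis by (metis LIMSEQ_unique)
  qed
  have memZ: "m \<in> Z" if "weakly_tendsto (u \<circ> t) m" for m t
    using closed_subspace_weakly_closed[OF Z(1,2) that] Z(3) by simp
  have "weakly_tendsto u l"
    unfolding weakly_tendsto_def
  proof (intro allI LIMSEQ_subseq_criterion)
    fix \<eta> :: "'a \<Rightarrow>\<^sub>L real" and t :: "nat \<Rightarrow> nat" assume t: "strict_mono t"
    obtain m and r :: "nat \<Rightarrow> nat" where r: "strict_mono r" "weakly_tendsto ((u \<circ> t) \<circ> r) m"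
      using weakly_seq_compactD[of A "u \<circ> t", OF A(1)] A(2) by (metis comp_apply)
    have r': "weakly_tendsto (u \<circ> (t \<circ> r)) m" using r(2) by (simp add: comp_assoc)
    have "m = l"
      using coord[OF s] coord[OF strict_mono_o[OF t r(1)] r'] memZ[OF s(2)] memZ[OF r']
      by (intro norming_for_eqI[OF \<xi> Z(1)]) auto
    then show "\<exists>r. strict_mono r \<and> (\<lambda>n. \<eta> (u (t (r n)))) \<longlonglongrightarrow> \<eta> l"
      using r by (intro exI[of _ r]) (auto simp: weakly_tendsto_def)
  qed
  then show thesis using memZ[OF s(2)] by (rule that[rotated])
qed

section \<open>Compactness in the weak topology and weakly convergent sequences\<close>

lemma topspace_weak_topology [simp]: "topspace weak_topology = UNIV"
proof -
  have "UNIV \<in> {blinfun_apply \<xi> -` U | (\<xi> :: 'a \<Rightarrow>\<^sub>L real) U. open U}"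
    using open_UNIV by force
  then show ?thesis unfolding weak_topology_def topology_generated_by_topspace by blast
qed

lemma openin_weak_topology_vimage:
  fixes \<xi> :: "'a::real_normed_vector \<Rightarrow>\<^sub>L real"
  shows "open U \<Longrightarrow> openin weak_topology (blinfun_apply \<xi> -` U)"
  unfolding weak_topology_def by (intro topology_generated_by_Basis) blast

text \<open>Functionals are tested one at a time. This is weaker than being a cluster point of the
  weak topology, but it suffices to identify the point when the values of the functionals are known
  to converge. If no point of \<open>C\<close> qualified, finitely many half-space-type
  neighbourhoods would cover \<open>C\<close> while missing a late term of the sequence.\<close>

lemma weakly_compact_cluster:
  fixes C :: "'a::real_normed_vector set" and u :: "nat \<Rightarrow> 'a"
  assumes C: "compactin weak_topology C" and u: "\<And>n. u n \<in> C"
  obtains l where "l \<in> C"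
    "\<And>(\<eta> :: 'a \<Rightarrow>\<^sub>L real) e N. e > 0 \<Longrightarrow> \<exists>n\<ge>N. \<bar>blinfun_apply \<eta> (u n) - blinfun_apply \<eta> l\<bar> < e"
proof (rule ccontr)
  assume "\<not> thesis"
  then have "\<forall>l\<in>C. \<exists>(\<eta> :: 'a \<Rightarrow>\<^sub>L real) e (N :: nat). e > 0 \<and> (\<forall>n\<ge>N. \<not> \<bar>blinfun_apply \<eta> (u n) - blinfun_apply \<eta> l\<bar> < e)"
    using that by metis
  then obtain \<eta> :: "'a \<Rightarrow> 'a \<Rightarrow>\<^sub>L real" and e and N :: "'a \<Rightarrow> nat" where e: "\<And>l. l \<in> C \<Longrightarrow> e l > 0"
    and far: "\<And>l n. l \<in> C \<Longrightarrow> n \<ge> N l \<Longrightarrow> \<not> \<bar>blinfun_apply (\<eta> l) (u n) - blinfun_apply (\<eta> l) l\<bar> < e l"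
    by metis
  define U where "U l = blinfun_apply (\<eta> l) -` ball (\<eta> l l) (e l)" for l
  have "\<And>l. openin weak_topology (U l)" unfolding U_def by (intro openin_weak_topology_vimage) simp
  moreover have "C \<subseteq> \<Union> (U ` C)" using e by (auto simp: U_def)
  ultimately obtain \<F> where \<F>: "finite \<F>" "\<F> \<subseteq> U ` C" "C \<subseteq> \<Union> \<F>"
    using C unfolding compactin_def by (metis (no_types, lifting) imageE)
  then obtain L where L: "finite L" "L \<subseteq> C" "\<F> = U ` L" using finite_subset_image by metis
  \<comment> \<open>A sum of natural numbers bounds each of them, so one index is late enough for
    all members of the subcover.\<close>
  define n where "n = (\<Sum>l\<in>L. N l)"
  obtain l where l: "l \<in> L" "u n \<in> U l" using u[of n] \<F>(3) L(3) by blast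
  have "N l \<le> n" unfolding n_def using L(1) l(1) by (intro member_le_sum) auto
  with far[of l n] l L(2) show False by (auto simp: U_def dist_real_def abs_minus_commute)
qed

text \<open>The easy half of the Eberlein-Smulian theorem. After a diagonal extraction the norming
  coordinates of the sequence converge, so every subsequence has one and the same cluster point, and
  that forces weak convergence.\<close>

lemma weakly_compact_imp_seq_compact:
  fixes C :: "'a::real_normed_vector set"
  assumes C: "compactin weak_topology C"
  shows "weakly_seq_compact C"
  unfolding weakly_seq_compact_def
proof (intro allI impI)
  fix u :: "nat \<Rightarrow> 'a" assume u: "\<forall>n. u n \<in> C"
  obtain S where S: "countable S" "range u \<subseteq> S" "subspace (closure S)"
    using countable_subspace_hull[of "range u" "\<lambda>n a. a"] by auto
  obtain \<xi> where \<xi>: "norming_for (closure S) \<xi>" using norming_sequence[OF S(1,3)] by blast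
  have cont: "continuous_map weak_topology euclidean (blinfun_apply \<eta>)" for \<eta> :: "'a \<Rightarrow>\<^sub>L real"
    using openin_weak_topology_vimage[of _ \<eta>] by (simp add: continuous_map_def vimage_def)
  have "\<exists>b. \<forall>x\<in>C. \<bar>\<xi> k x\<bar> \<le> b" for k
  proof -
    have "compact (\<xi> k ` C)" using image_compactin[OF C cont] by simp
    then have "bounded (\<xi> k ` C)" by (rule compact_imp_bounded)
    then show ?thesis by (auto simp: bounded_iff)
  qed
  then obtain b where "\<And>k x. x \<in> C \<Longrightarrow> \<bar>\<xi> k x\<bar> \<le> b k" by metis
  then obtain s :: "nat \<Rightarrow> nat" and r where s: "strict_mono s" and r: "\<And>k. (\<lambda>n. \<xi> k (u (s n))) \<longlonglongrightarrow> r k"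
    using bounded_coordinates_subseq[of "\<lambda>n k. \<xi> k (u n)" b] u by metis
  define w where "w n = u (s n)" for n
  have w: "w n \<in> C" "w n \<in> closure S" for n
    using u S(2) closure_subset[of S] by (auto simp: w_def)
  \<comment> \<open>A distance functional places the cluster point in the separable subspace; there
    the limits \<open>r\<close> of the coordinates determine it.\<close>
  have cluster: "l \<in> closure S \<and> (\<forall>k. \<xi> k l = r k)"
    if t: "strict_mono t" and cl: "\<And>(\<eta> :: 'a \<Rightarrow>\<^sub>L real) e N. e > 0 \<Longrightarrow> \<exists>n\<ge>N. \<bar>blinfun_apply \<eta> (w (t n)) - blinfun_apply \<eta> l\<bar> < e"
    for l and t :: "nat \<Rightarrow> nat"
  proof
    obtain \<eta> :: "'a \<Rightarrow>\<^sub>L real" where \<eta>: "\<eta> l = infdist l (closure S)" "\<And>y. y \<in> closure S \<Longrightarrow> \<eta> y = 0"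
      using Hahn_Banach_infdist[OF S(3)] by metis
    have "\<eta> l = 0"
    proof (rule ccontr)
      assume "\<eta> l \<noteq> 0"
      then obtain n where "\<bar>blinfun_apply \<eta> (w (t n)) - blinfun_apply \<eta> l\<bar> < \<bar>\<eta> l\<bar>" using cl[of "\<bar>\<eta> l\<bar>" 0 \<eta>] by auto
      with \<eta>(2)[OF w(2)] show False by simp
    qed
    then show "l \<in> closure S"
      using \<eta>(1) in_closed_iff_infdist_zero[of "closure S" l] subspace_0[OF S(3)]
      by (metis closed_closure empty_iff)
    show "\<forall>k. \<xi> k l = r k"
    proof (rule allI, rule ccontr)
      fix k assume "\<xi> k l \<noteq> r k"
      define e where "e = \<bar>\<xi> k l - r k\<bar> / 2"
      have "e > 0" using \<open>\<xi> k l \<noteq> r k\<close> by (simp add: e_def)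
      then obtain N where N: "\<And>n. n \<ge> N \<Longrightarrow> \<bar>\<xi> k (w n) - r k\<bar> < e"
        using r[of k] unfolding lim_sequentially w_def dist_real_def by blast
      obtain n where n: "n \<ge> N" "\<bar>\<xi> k (w (t n)) - \<xi> k l\<bar> < e" using cl[of e N "\<xi> k"] \<open>e > 0\<close> by blast
      have "t n \<ge> N" using n(1) seq_suble[OF t, of n] by linarith
      have "\<bar>\<xi> k l - r k\<bar> = 2 * e" by (simp add: e_def)
      with N[OF \<open>N \<le> t n\<close>] n(2) show False by arith
    qed
  qed
  obtain l where l: "l \<in> C"
    "\<And>(\<eta> :: 'a \<Rightarrow>\<^sub>L real) e N. e > 0 \<Longrightarrow> \<exists>n\<ge>N. \<bar>blinfun_apply \<eta> (w n) - blinfun_apply \<eta> l\<bar> < e"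
    using weakly_compact_cluster[of C w, OF C w(1)] by blast
  have lS: "l \<in> closure S" "\<And>k. \<xi> k l = r k"
    using cluster[of "\<lambda>n. n" l] l(2) by (auto simp: strict_mono_def)
  have "weakly_tendsto w l"
    unfolding weakly_tendsto_def
  proof (rule allI, rule ccontr)
    fix \<eta> :: "'a \<Rightarrow>\<^sub>L real"
    assume "\<not> (\<lambda>n. \<eta> (w n)) \<longlonglongrightarrow> \<eta> l"
    then obtain e where e: "e > 0" "\<not> eventually (\<lambda>n. dist (\<eta> (w n)) (\<eta> l) < e) sequentially"
      unfolding tendsto_iff by blast
    then obtain t :: "nat \<Rightarrow> nat" where t: "strict_mono t" "\<And>n. \<not> dist (\<eta> (w (t n))) (\<eta> l) < e"
      using not_eventually_sequentiallyD[OF e(2)] by blast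
    obtain m where m: "m \<in> C"
      "\<And>(\<eta> :: 'a \<Rightarrow>\<^sub>L real) e N. e > 0 \<Longrightarrow> \<exists>n\<ge>N. \<bar>blinfun_apply \<eta> (w (t n)) - blinfun_apply \<eta> m\<bar> < e"
      using weakly_compact_cluster[of C "\<lambda>n. w (t n)", OF C w(1)] by blast
    have "m = l"
      using cluster[OF t(1) m(2)] lS by (intro norming_for_eqI[OF \<xi> S(3)]) auto
    then show False using m(2)[of e 0 \<eta>] e(1) t(2) by (auto simp: dist_real_def)
  qed
  moreover have "w = u \<circ> s" by (auto simp: w_def)
  ultimately have "weakly_tendsto (u \<circ> s) l" by simp
  then show "\<exists>l s. strict_mono s \<and> weakly_tendsto (u \<circ> s) l" using s by blast
qed

text \<open>The converse half, for a countable bounded set. In norming coordinates the set has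
  compact metrizable closure \<open>L\<close>, and each point of \<open>L\<close> is the coordinate
  sequence of a unique weak limit of points of \<open>D\<close>. The inverse coordinate map
  \<open>\<Theta>\<close> is weakly continuous, so the compact set is its image.\<close>

lemma countable_weakly_seq_compact_superset:
  fixes D :: "'a::real_normed_vector set"
  assumes D: "countable D" "weakly_seq_compact D" and B: "\<And>x. x \<in> D \<Longrightarrow> norm x \<le> B"
  obtains C where "D \<subseteq> C" "compactin weak_topology C"
proof -
  obtain S where S: "countable S" "D \<subseteq> S" "subspace (closure S)"
    using countable_subspace_hull[of D "\<lambda>n a. a"] D(1) by auto
  obtain \<xi> where \<xi>: "norming_for (closure S) \<xi>" using norming_sequence[OF S(1,3)] by blast
  define J where "J x = (\<lambda>k. blinfun_apply (\<xi> k) x)" for x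
  define L where "L = closure (J ` D)"
  have JD: "J ` D \<subseteq> {r. \<forall>k. r k \<in> {- B..B}}"
  proof (clarsimp simp: J_def)
    fix x k assume "x \<in> D"
    have "\<bar>\<xi> k x\<bar> \<le> norm x" using \<xi> by (intro blinfun_le_norm) (simp add: norming_for_def)
    with B[OF \<open>x \<in> D\<close>] show "- B \<le> \<xi> k x \<and> \<xi> k x \<le> B" by linarith
  qed
  have cL: "compact L"
  proof -
    have "L \<subseteq> {r. \<forall>k. r k \<in> {- B..B}}"
      unfolding L_def using JD compact_cube_fun[of "\<lambda>_. - B" "\<lambda>_. B"]
      by (intro closure_minimal compact_imp_closed) auto
    then show ?thesis
      using compact_cube_fun[of "\<lambda>_. - B" "\<lambda>_. B"] compact_Int_closed[of "{r. \<forall>k. r k \<in> {- B..B}}" L]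
      by (simp add: L_def Int_absorb1)
  qed
  have lim: "\<exists>l\<in>closure S. weakly_tendsto d l \<and> J l = r"
    if d: "\<And>n. d n \<in> D" "\<And>k. (\<lambda>n. \<xi> k (d n)) \<longlonglongrightarrow> r k" for d r
  proof -
    have "d n \<in> closure S" for n using d(1) S(2) closure_subset[of S] by blast
    then obtain l where l: "l \<in> closure S" "weakly_tendsto d l"
      using weakly_seq_compact_tendsto[of D d "closure S" \<xi>] D(2) d S(3) \<xi> convergentI by (metis closed_closure)
    moreover have "\<xi> k l = r k" for k
      using l(2) d(2)[of k] unfolding weakly_tendsto_def by (blast intro: LIMSEQ_unique)
    ultimately show ?thesis by (auto simp: J_def)
  qed
  have approx: "\<exists>d. (\<forall>n. d n \<in> D) \<and> (\<forall>k. (\<lambda>n. \<xi> k (d n)) \<longlonglongrightarrow> r k)" if "r \<in> L" for r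
  proof -
    obtain x where x: "\<And>n. x n \<in> J ` D" "x \<longlonglongrightarrow> r" using \<open>r \<in> L\<close> unfolding L_def closure_sequential by blast
    from x(1) have "\<forall>n. \<exists>a. a \<in> D \<and> x n = J a" by blast
    then obtain d where d: "\<And>n. d n \<in> D" "\<And>n. x n = J (d n)" by metis
    then show ?thesis using x(2) unfolding LIMSEQ_fun_iff by (intro exI[of _ d]) (auto simp: J_def)
  qed
  define \<Theta> where "\<Theta> r = (THE l. l \<in> closure S \<and> J l = r)" for r
  have \<Theta>_eq: "\<Theta> (J l) = l" if "l \<in> closure S" for l
    unfolding \<Theta>_def using that
    by (intro the_equality conjI norming_for_eqI[OF \<xi> S(3)]) (auto simp: J_def dest: fun_cong)
  have \<Theta>_lim: "weakly_tendsto d (\<Theta> r)" if "\<And>n. d n \<in> D" "\<And>k. (\<lambda>n. \<xi> k (d n)) \<longlonglongrightarrow> r k" for d r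
    using lim[OF that] \<Theta>_eq by auto
  have cont: "continuous_on L (\<lambda>r. \<eta> (\<Theta> r))" for \<eta> :: "'a \<Rightarrow>\<^sub>L real"
  proof (rule continuous_on_sequentiallyI)
    fix x r assume x: "\<forall>n. x n \<in> L" "r \<in> L" "x \<longlonglongrightarrow> r"
    \<comment> \<open>Each \<open>x n\<close> is replaced by the coordinates of an actual point of
      \<open>D\<close>, close in the first \<open>n + 1\<close> coordinates and under
      \<open>\<eta>\<close>. The replaced sequence still tends to \<open>r\<close> coordinatewise,
      so compactness of \<open>D\<close> applies to it.\<close>
    have "\<exists>a. a \<in> D \<and> \<bar>\<eta> a - \<eta> (\<Theta> (x n))\<bar> < 1 / real (Suc n) \<and> (\<forall>k\<le>n. \<bar>\<xi> k a - x n k\<bar> < 1 / real (Suc n))" for n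
    proof -
      obtain d where d: "\<And>i. d i \<in> D" "\<And>k. (\<lambda>i. \<xi> k (d i)) \<longlonglongrightarrow> x n k" using approx[of "x n"] x(1) by metis
      have "(\<lambda>i. \<eta> (d i)) \<longlonglongrightarrow> \<eta> (\<Theta> (x n))" using \<Theta>_lim[OF d] by (simp add: weakly_tendsto_def)
      then have "eventually (\<lambda>i. \<bar>\<eta> (d i) - \<eta> (\<Theta> (x n))\<bar> < 1 / real (Suc n)) sequentially"
        using tendstoD[of _ _ _ "1 / real (Suc n)"] by (fastforce simp: dist_real_def)
      moreover have "eventually (\<lambda>i. \<forall>k\<in>{..n}. \<bar>\<xi> k (d i) - x n k\<bar> < 1 / real (Suc n)) sequentially"
        using tendstoD[OF d(2), of "1 / real (Suc n)"] by (intro eventually_ball_finite) (auto simp: dist_real_def)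
      ultimately have "eventually (\<lambda>i. \<bar>\<eta> (d i) - \<eta> (\<Theta> (x n))\<bar> < 1 / real (Suc n) \<and> (\<forall>k\<in>{..n}. \<bar>\<xi> k (d i) - x n k\<bar> < 1 / real (Suc n))) sequentially"
        by (rule eventually_conj)
      then obtain i where "\<bar>\<eta> (d i) - \<eta> (\<Theta> (x n))\<bar> < 1 / real (Suc n)" "\<forall>k\<in>{..n}. \<bar>\<xi> k (d i) - x n k\<bar> < 1 / real (Suc n)"
        by (auto simp: eventually_sequentially)
      then show ?thesis using d(1)[of i] by auto
    qed
    then obtain a where a: "\<And>n. a n \<in> D" "\<And>n. \<bar>\<eta> (a n) - \<eta> (\<Theta> (x n))\<bar> < 1 / real (Suc n)"
      "\<And>n k. k \<le> n \<Longrightarrow> \<bar>\<xi> k (a n) - x n k\<bar> < 1 / real (Suc n)" by metis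
    have inv0: "(\<lambda>n. 1 / real (Suc n)) \<longlonglongrightarrow> 0"
      using LIMSEQ_inverse_real_of_nat by (simp add: inverse_eq_divide)
    have "(\<lambda>n. \<xi> k (a n)) \<longlonglongrightarrow> r k" for k
    proof -
      have "eventually (\<lambda>n. norm (\<xi> k (a n) - x n k) \<le> 1 / real (Suc n)) sequentially"
        unfolding eventually_sequentially real_norm_def using a(3)[of k] by (intro exI[of _ k]) (auto intro: less_imp_le)
      then have "(\<lambda>n. \<xi> k (a n) - x n k) \<longlonglongrightarrow> 0" using inv0 by (rule Lim_null_comparison)
      moreover have "(\<lambda>n. x n k) \<longlonglongrightarrow> r k" using x(3) by (simp add: LIMSEQ_fun_iff)
      ultimately show ?thesis using tendsto_add by fastforce
    qed
    then have "(\<lambda>n. \<eta> (a n)) \<longlonglongrightarrow> \<eta> (\<Theta> r)" using \<Theta>_lim[OF a(1)] by (simp add: weakly_tendsto_def)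
    moreover have "(\<lambda>n. \<eta> (\<Theta> (x n)) - \<eta> (a n)) \<longlonglongrightarrow> 0"
      by (rule Lim_null_comparison[OF _ inv0])
         (use a(2) in \<open>auto simp: abs_minus_commute intro!: always_eventually less_imp_le\<close>)
    ultimately show "(\<lambda>n. \<eta> (\<Theta> (x n))) \<longlonglongrightarrow> \<eta> (\<Theta> r)" using tendsto_add by fastforce
  qed
  have "continuous_map (top_of_set L) weak_topology \<Theta>"
    unfolding weak_topology_def
  proof (rule continuous_on_generated_topo)
    fix U assume "U \<in> {blinfun_apply \<xi> -` U | (\<xi> :: 'a \<Rightarrow>\<^sub>L real) U. open U}"
    then obtain \<eta> :: "'a \<Rightarrow>\<^sub>L real" and V where U: "U = blinfun_apply \<eta> -` V" "open V" by blast
    have "\<Theta> -` U \<inter> L = (\<lambda>r. \<eta> (\<Theta> r)) -` V \<inter> L" unfolding U(1) by auto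
    then show "openin (top_of_set L) (\<Theta> -` U \<inter> topspace (top_of_set L))"
      using continuous_openin_preimage_gen[OF cont[of \<eta>] U(2)] by (simp add: Int_commute)
  qed (use topspace_weak_topology[where 'a = 'a] in \<open>simp add: weak_topology_def\<close>)
  then have "compactin weak_topology (\<Theta> ` L)" using cL by (intro image_compactin) auto
  moreover have "D \<subseteq> \<Theta> ` L"
  proof
    fix a assume "a \<in> D"
    then have "J a \<in> L" "\<Theta> (J a) = a"
      using S(2) closure_subset[of S] closure_subset[of "J ` D"] \<Theta>_eq[of a] by (auto simp: L_def)
    then show "a \<in> \<Theta> ` L" by (metis imageI)
  qed
  ultimately show thesis by (intro that)
qed

section \<open>The measure of weak noncompactness\<close>

text \<open>Pointwise form of the inclusion of \<open>A\<close> in \<open>C\<close> plus a ball of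
  radius \<open>t\<close>, which avoids dividing by \<open>t\<close> in estimates.\<close>

definition weakly_covered :: "'a::real_normed_vector set \<Rightarrow> real \<Rightarrow> bool" where
  "weakly_covered A t \<longleftrightarrow> 0 < t \<and> (\<exists>C. compactin weak_topology C \<and> (\<forall>a\<in>A. \<exists>c\<in>C. norm (a - c) \<le> t))"

lemma deblasi_eq: "deblasi A = Inf {t. weakly_covered A t}"
proof -
  have "A \<subseteq> {c + t *\<^sub>R b | c b. c \<in> C \<and> b \<in> cball 0 1} \<longleftrightarrow> (\<forall>a\<in>A. \<exists>c\<in>C. norm (a - c) \<le> t)"
    if "0 < t" for C t
  proof
    assume L: "A \<subseteq> {c + t *\<^sub>R b | c b. c \<in> C \<and> b \<in> cball 0 1}"
    show "\<forall>a\<in>A. \<exists>c\<in>C. norm (a - c) \<le> t"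
    proof
      fix a assume "a \<in> A"
      then obtain c b where "c \<in> C" "norm b \<le> 1" "a = c + t *\<^sub>R b" using L by auto
      then show "\<exists>c\<in>C. norm (a - c) \<le> t" using that by (intro bexI[of _ c]) auto
    qed
  next
    assume R: "\<forall>a\<in>A. \<exists>c\<in>C. norm (a - c) \<le> t"
    show "A \<subseteq> {c + t *\<^sub>R b | c b. c \<in> C \<and> b \<in> cball 0 1}"
    proof
      fix a assume "a \<in> A"
      then obtain c where "c \<in> C" "norm (a - c) \<le> t" using R by blast
      then show "a \<in> {c + t *\<^sub>R b | c b. c \<in> C \<and> b \<in> cball 0 1}"
        using that by (intro CollectI exI[of _ c] exI[of _ "(1 / t) *\<^sub>R (a - c)"]) auto
    qed
  qed
  then show ?thesis unfolding deblasi_def weakly_covered_def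
    by (intro arg_cong[where f = Inf] Collect_cong) blast
qed

lemma weakly_covered_mono: "weakly_covered A t \<Longrightarrow> t \<le> t' \<Longrightarrow> weakly_covered A t'"
  unfolding weakly_covered_def by (meson less_le_trans order_trans)

lemma bounded_weakly_covered:
  assumes "bounded A"
  obtains t where "weakly_covered A t"
proof -
  obtain b where b: "b > 0" "\<And>x. x \<in> A \<Longrightarrow> norm x \<le> b" using assms bounded_pos by metis
  have "compactin weak_topology {0 :: 'a}" by (intro finite_imp_compactin) auto
  moreover have "\<forall>a\<in>A. \<exists>c\<in>{0}. norm (a - c) \<le> b" using b by simp
  ultimately show thesis using b(1) that[of b] unfolding weakly_covered_def by blast
qed

lemma deblasi_le: "weakly_covered A t \<Longrightarrow> deblasi A \<le> t"
  unfolding deblasi_eq by (intro cInf_lower bdd_belowI[of _ 0]) (auto simp: weakly_covered_def)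

lemma deblasi_nonneg: "bounded A \<Longrightarrow> 0 \<le> deblasi A"
  unfolding deblasi_eq
  by (rule cInf_greatest) (blast elim: bounded_weakly_covered, simp add: weakly_covered_def)

lemma deblasi_less:
  assumes "bounded A" "deblasi A < t"
  shows "weakly_covered A t"
proof -
  have "{t. weakly_covered A t} \<noteq> {}" using bounded_weakly_covered[OF assms(1)] by blast
  moreover have "bdd_below {t. weakly_covered A t}"
    by (intro bdd_belowI[of _ 0]) (auto simp: weakly_covered_def)
  ultimately obtain t' where "weakly_covered A t'" "t' < t"
    using assms(2) cInf_less_iff[of "{t. weakly_covered A t}" t] unfolding deblasi_eq by blast
  then show ?thesis using weakly_covered_mono by (meson less_imp_le)
qed

text \<open>Cutting \<open>C\<close> down to a ball loses nothing, since a point within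
  \<open>t\<close> of a bounded set is bounded. The boundedness is needed for the Krein-Smulian
  theorem.\<close>

lemma weakly_coveredE:
  fixes A :: "'a::real_normed_vector set"
  assumes "weakly_covered A t" "bounded A"
  obtains C where "weakly_seq_compact C" "bounded C" "\<And>a. a \<in> A \<Longrightarrow> \<exists>c\<in>C. norm (a - c) \<le> t"
proof -
  obtain C where C: "compactin weak_topology C" "\<forall>a\<in>A. \<exists>c\<in>C. norm (a - c) \<le> t"
    using assms(1) unfolding weakly_covered_def by blast
  obtain b where b: "\<And>x. x \<in> A \<Longrightarrow> norm x \<le> b" using assms(2) unfolding bounded_iff by blast
  show thesis
  proof (rule that[of "C \<inter> cball 0 (b + t)"])
    show "weakly_seq_compact (C \<inter> cball 0 (b + t))"
      using weakly_compact_imp_seq_compact[OF C(1)] by (rule weakly_seq_compact_subset) auto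
    fix a assume a: "a \<in> A"
    then obtain c where c: "c \<in> C" "norm (a - c) \<le> t" using C(2) by blast
    have "norm c \<le> norm a + norm (a - c)" using norm_triangle_ineq4[of a "a - c"] by simp
    then show "\<exists>c\<in>C \<inter> cball 0 (b + t). norm (a - c) \<le> t" using c b[OF a] by (intro bexI[of _ c]) auto
  qed (auto intro: bounded_subset[OF bounded_cball])
qed

text \<open>The way back from sequences to compact sets. Only a countable dense part of
  \<open>A\<close> is matched with points of \<open>D\<close>; these countably many points have a
  weakly compact superset, and density costs an arbitrarily small \<open>e\<close>.\<close>

lemma deblasi_le_of_seq_compact:
  fixes A :: "'a::real_normed_vector set"
  assumes S: "countable S" "A \<subseteq> closure S" and D: "weakly_seq_compact D" "bounded D"
    and AD: "\<And>a. a \<in> A \<Longrightarrow> \<exists>d\<in>D. norm (a - d) \<le> t" and "t \<ge> 0"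
  shows "deblasi A \<le> t"
proof (rule field_le_epsilon)
  fix e :: real assume "e > 0"
  obtain T where T: "countable T" "T \<subseteq> A" "A \<subseteq> closure T" using separable_subset[OF S] by blast
  have "\<forall>a\<in>A. \<exists>d. d \<in> D \<and> norm (a - d) \<le> t" using AD by blast
  then obtain d where d: "\<And>a. a \<in> A \<Longrightarrow> d a \<in> D" "\<And>a. a \<in> A \<Longrightarrow> norm (a - d a) \<le> t" by metis
  obtain B where B: "\<And>x. x \<in> D \<Longrightarrow> norm x \<le> B" using D(2) unfolding bounded_iff by blast
  have dT: "d ` T \<subseteq> D" using T(2) d(1) by blast
  obtain C where C: "d ` T \<subseteq> C" "compactin weak_topology C"
    using countable_weakly_seq_compact_superset[OF countable_image[OF T(1)] weakly_seq_compact_subset[OF D(1) dT] B[OF subsetD[OF dT]]]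
    by blast
  have "\<exists>c\<in>C. norm (a - c) \<le> t + e" if "a \<in> A" for a
  proof -
    have "a \<in> closure T" using that T(3) by blast
    then obtain x where x: "x \<in> T" "dist x a < e"
      using \<open>e > 0\<close> unfolding closure_approachable by blast
    have "norm (a - d x) \<le> norm (a - x) + norm (x - d x)" using norm_triangle_ineq[of "a - x" "x - d x"] by simp
    also have "\<dots> \<le> e + t" using x d(2)[of x] T(2) by (auto simp: dist_norm norm_minus_commute intro!: add_mono less_imp_le)
    finally show ?thesis using x(1) C(1) by (intro bexI[of _ "d x"]) auto
  qed
  then have "weakly_covered A (t + e)" using C(2) \<open>t \<ge> 0\<close> \<open>e > 0\<close> unfolding weakly_covered_def by auto
  then show "deblasi A \<le> t + e" by (rule deblasi_le)
qed

text \<open>The same compact set covers a neighbourhood of \<open>A'\<close> with a larger radius.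
  With \<open>e = 0\<close> this is monotonicity; for families with a common Lipschitz bound it
  gives continuity of the measure in the point.\<close>

lemma deblasi_perturb:
  fixes A A' :: "'a::real_normed_vector set"
  assumes "bounded A'" "\<And>a. a \<in> A \<Longrightarrow> \<exists>a'\<in>A'. norm (a - a') \<le> e" "e \<ge> 0"
  shows "deblasi A \<le> deblasi A' + e"
proof (rule field_le_epsilon)
  fix \<epsilon> :: real assume "\<epsilon> > 0"
  then have "weakly_covered A' (deblasi A' + \<epsilon>)" by (intro deblasi_less assms) simp
  then obtain C where C: "compactin weak_topology C" "\<forall>a\<in>A'. \<exists>c\<in>C. norm (a - c) \<le> deblasi A' + \<epsilon>"
    unfolding weakly_covered_def by blast
  have "\<exists>c\<in>C. norm (a - c) \<le> deblasi A' + e + \<epsilon>" if a: "a \<in> A" for a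
  proof -
    obtain a' where a': "a' \<in> A'" "norm (a - a') \<le> e" using assms(2)[OF a] by blast
    obtain c where c: "c \<in> C" "norm (a' - c) \<le> deblasi A' + \<epsilon>" using C(2) a'(1) by blast
    have "norm (a - c) \<le> norm (a - a') + norm (a' - c)" using norm_triangle_ineq[of "a - a'" "a' - c"] by simp
    then show ?thesis using a' c by (intro bexI[of _ c]) auto
  qed
  then have "weakly_covered A (deblasi A' + e + \<epsilon>)"
    using C(1) deblasi_nonneg[OF assms(1)] assms(3) \<open>\<epsilon> > 0\<close> unfolding weakly_covered_def by auto
  then show "deblasi A \<le> deblasi A' + e + \<epsilon>" by (rule deblasi_le)
qed

lemma diagonal_weak_subseq:
  fixes u :: "'i \<Rightarrow> nat \<Rightarrow> 'a::real_normed_vector"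
  assumes I: "countable I" and A: "\<And>i. i \<in> I \<Longrightarrow> weakly_seq_compact (A i)" "\<And>i n. i \<in> I \<Longrightarrow> u i n \<in> A i"
  obtains s :: "nat \<Rightarrow> nat" where "strict_mono s" "\<And>i. i \<in> I \<Longrightarrow> \<exists>l. weakly_tendsto (u i \<circ> s) l"
proof (cases "I = {}")
  case True
  then show ?thesis by (intro that[of id]) (auto simp: strict_mono_def)
next
  case False
  define P where "P k s \<longleftrightarrow> (\<exists>l. weakly_tendsto (u (from_nat_into I k) \<circ> s) l)" for k and s :: "nat \<Rightarrow> nat"
  have inI: "from_nat_into I k \<in> I" for k using False by (rule from_nat_into)
  interpret subseqs P
  proof
    fix k and s :: "nat \<Rightarrow> nat" assume "strict_mono s"
    obtain l and r :: "nat \<Rightarrow> nat" where "strict_mono r" "weakly_tendsto ((u (from_nat_into I k) \<circ> s) \<circ> r) l"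
      using weakly_seq_compactD[of "A (from_nat_into I k)" "u (from_nat_into I k) \<circ> s", OF A(1)[OF inI]]
        A(2)[OF inI] by (metis comp_apply)
    then show "\<exists>r. strict_mono r \<and> P k (s \<circ> r)" unfolding P_def by (auto simp: comp_assoc)
  qed
  have "\<exists>l. weakly_tendsto (u i \<circ> diagseq) l" if i: "i \<in> I" for i
  proof -
    obtain k where k: "i = from_nat_into I k" using from_nat_into_surj[OF I i] by metis
    \<comment> \<open>The diagonal sequence is a subsequence of the \<open>k\<close>-th extraction
      only from index \<open>Suc k\<close> on, hence the shift.\<close>
    have "P k (diagseq \<circ> (+) (Suc k))"
      by (rule diagseq_holds) (auto simp: P_def comp_assoc[symmetric] intro: weakly_tendsto_subseq)
    then obtain l where l: "weakly_tendsto (u i \<circ> (diagseq \<circ> (+) (Suc k))) l" unfolding P_def k by blast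
    have "(\<lambda>n. \<eta> (u i (diagseq n))) \<longlonglongrightarrow> \<eta> l" for \<eta> :: "'a \<Rightarrow>\<^sub>L real"
    proof (rule LIMSEQ_offset[of _ "Suc k"])
      show "(\<lambda>n. \<eta> (u i (diagseq (n + Suc k)))) \<longlonglongrightarrow> \<eta> l"
        using l by (simp add: weakly_tendsto_def add.commute)
    qed
    then show ?thesis by (auto simp: weakly_tendsto_def)
  qed
  then show thesis using subseq_diagseq that by blast
qed

text \<open>For each \<open>j\<close> the sequence is shadowed within \<open>1 / Suc j\<close> by
  one in a compact set. Along a common subsequence all shadows converge weakly, and their limits
  form a norm-Cauchy sequence whose limit is the weak limit sought.\<close>

lemma deblasi_zero_imp_seq_compact:
  fixes A :: "'a::banach set"
  assumes "bounded A" "deblasi A = 0"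
  shows "weakly_seq_compact A"
  unfolding weakly_seq_compact_def
proof (intro allI impI)
  fix u :: "nat \<Rightarrow> 'a" assume u: "\<forall>n. u n \<in> A"
  have "\<exists>C. weakly_seq_compact C \<and> (\<forall>a\<in>A. \<exists>c\<in>C. norm (a - c) \<le> 1 / real (Suc j))" for j
  proof -
    have "weakly_covered A (1 / real (Suc j))" using assms by (intro deblasi_less) auto
    then show ?thesis using weakly_coveredE[OF _ assms(1)] by metis
  qed
  then obtain C where C: "\<And>j. weakly_seq_compact (C j)"
    and AC: "\<And>j a. a \<in> A \<Longrightarrow> \<exists>c\<in>C j. norm (a - c) \<le> 1 / real (Suc j)" by metis
  have "\<forall>j n. \<exists>c. c \<in> C j \<and> norm (u n - c) \<le> 1 / real (Suc j)" using AC u by blast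
  then obtain c where c: "\<And>j n. c j n \<in> C j" "\<And>j n. norm (u n - c j n) \<le> 1 / real (Suc j)" by metis
  obtain s :: "nat \<Rightarrow> nat" where s: "strict_mono s" "\<And>j. \<exists>l. weakly_tendsto (c j \<circ> s) l"
    using diagonal_weak_subseq[of "UNIV :: nat set" C c] C c(1) by auto
  then obtain l where l: "\<And>j. weakly_tendsto (c j \<circ> s) (l j)" by metis
  \<comment> \<open>The norm is weakly lower semicontinuous, so the distance bound between two
    shadows of the same term passes to their limits.\<close>
  have diff: "norm (l i - l j) \<le> 1 / real (Suc i) + 1 / real (Suc j)" for i j
  proof (rule weakly_tendsto_norm_le[OF weakly_tendsto_diff[OF l[of i] l[of j]]])
    fix n
    have "norm (c i m - c j m) \<le> 1 / real (Suc i) + 1 / real (Suc j)" for m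
      using c(2)[of m i] c(2)[of m j] norm_triangle_ineq4[of "u m - c j m" "u m - c i m"] by simp
    then show "norm ((c i \<circ> s) n - (c j \<circ> s) n) \<le> 1 / real (Suc i) + 1 / real (Suc j)" by simp
  qed
  have "Cauchy l"
  proof (rule metric_CauchyI)
    fix e :: real assume "e > 0"
    then obtain N where N: "1 / real (Suc N) < e / 2" by (metis half_gt_zero nat_approx_posE)
    have "dist (l i) (l j) < e" if "i \<ge> N" "j \<ge> N" for i j
    proof -
      have "1 / real (Suc i) \<le> 1 / Suc N" "1 / real (Suc j) \<le> 1 / Suc N"
        using that by (auto intro!: divide_left_mono)
      then show ?thesis using diff[of i j] N by (simp add: dist_norm)
    qed
    then show "\<exists>N. \<forall>i\<ge>N. \<forall>j\<ge>N. dist (l i) (l j) < e" by blast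
  qed
  then obtain x where x: "l \<longlonglongrightarrow> x" using Cauchy_convergent convergent_def by blast
  have "weakly_tendsto (u \<circ> s) x"
    unfolding weakly_tendsto_def
  proof (intro allI metric_LIMSEQ_I)
    fix \<eta> :: "'a \<Rightarrow>\<^sub>L real" and e :: real assume "e > 0"
    define K where "K = norm \<eta> + 1"
    have K: "K > 0" by (simp add: K_def add_nonneg_pos)
    have \<eta>: "\<bar>\<eta> y\<bar> \<le> K * norm y" for y
      using norm_blinfun[of \<eta> y] mult_right_mono[of "norm \<eta>" K "norm y"] by (simp add: K_def)
    have "e / (4 * K) > 0" using \<open>e > 0\<close> K by simp
    then obtain N1 where N1: "\<And>j. j \<ge> N1 \<Longrightarrow> dist (l j) x < e / (4 * K)"
      using x unfolding lim_sequentially by blast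
    obtain N2 where N2: "1 / real (Suc N2) < e / (4 * K)"
      using \<open>e / (4 * K) > 0\<close> by (metis nat_approx_posE)
    define j where "j = max N1 N2"
    have j1: "norm (l j - x) < e / (4 * K)" using N1[of j] by (simp add: j_def dist_norm)
    have "1 / real (Suc j) \<le> 1 / real (Suc N2)" by (auto simp: j_def intro!: divide_left_mono)
    then have j2: "norm (u n - c j n) < e / (4 * K)" for n using c(2)[of n j] N2 by (meson le_less_trans order_trans)
    have "(\<lambda>n. \<eta> (c j (s n))) \<longlonglongrightarrow> \<eta> (l j)" using l[of j] by (simp add: weakly_tendsto_def)
    then obtain M where M: "\<And>n. n \<ge> M \<Longrightarrow> \<bar>\<eta> (c j (s n)) - \<eta> (l j)\<bar> < e / 2"
      using \<open>e > 0\<close> unfolding lim_sequentially dist_real_def by (meson half_gt_zero)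
    have "dist (\<eta> ((u \<circ> s) n)) (\<eta> x) < e" if n: "n \<ge> M" for n
    proof -
      have "\<bar>\<eta> (u (s n) - c j (s n))\<bar> < e / 4"
        using \<eta>[of "u (s n) - c j (s n)"] mult_strict_left_mono[OF j2[of "s n"] K] K by simp
      moreover have "\<bar>\<eta> (l j - x)\<bar> < e / 4"
        using \<eta>[of "l j - x"] mult_strict_left_mono[OF j1 K] K by simp
      ultimately show ?thesis using M[OF n] unfolding blinfun.diff_right dist_real_def comp_def by linarith
    qed
    then show "\<exists>M. \<forall>n\<ge>M. dist (\<eta> ((u \<circ> s) n)) (\<eta> x) < e" by blast
  qed
  with s(1) show "\<exists>l s. strict_mono s \<and> weakly_tendsto (u \<circ> s) l" by blast
qed

section \<open>The Krein-Smulian theorem\<close>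

text \<open>The Cantor set coding: digits 0 and 1 in base 3. In base 2 nearby numbers may have
  different leading digits; the missing digit leaves gaps that rule this out.\<close>

definition ternary_code :: "(nat \<Rightarrow> bool) \<Rightarrow> real" where
  "ternary_code b = (\<Sum>i. of_bool (b i) / 3 ^ i)"

lemma geometric_third: "(\<lambda>i. 1 / 3 ^ i :: real) sums (3 / 2)"
  using geometric_sums[of "1 / 3 :: real"] by (simp add: power_one_over)

lemma summable_ternary: "summable (\<lambda>i. of_bool (b i) / 3 ^ i :: real)"
  by (rule summable_comparison_test'[OF sums_summable[OF geometric_third]]) auto

lemma ternary_code_bounds: "0 \<le> ternary_code b" "ternary_code b \<le> 3 / 2"
proof -
  show "0 \<le> ternary_code b" unfolding ternary_code_def by (intro suminf_nonneg summable_ternary) auto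
  have "ternary_code b \<le> (\<Sum>i. 1 / 3 ^ i)" unfolding ternary_code_def
    by (intro suminf_le summable_ternary sums_summable[OF geometric_third]) (auto simp: divide_right_mono)
  then show "ternary_code b \<le> 3 / 2" using geometric_third by (simp add: sums_iff)
qed

text \<open>If the first difference is at \<open>j\<close>, it contributes \<open>1 / 3 ^ j\<close>,
  while all later digits together change at most \<open>1 / (2 * 3 ^ j)\<close>. The codes then stay
  half of \<open>1 / 3 ^ j\<close> apart.\<close>

lemma ternary_code_close:
  assumes "\<bar>ternary_code b - ternary_code b'\<bar> < 1 / (2 * 3 ^ n)" "i \<le> n"
  shows "b i = b' i"
proof (rule ccontr)
  assume ne: "b i \<noteq> b' i"
  define j where "j = (LEAST k. b k \<noteq> b' k)"
  have j: "b j \<noteq> b' j" "\<And>k. k < j \<Longrightarrow> b k = b' k"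
    unfolding j_def using ne LeastI[of "\<lambda>k. b k \<noteq> b' k"] not_less_Least[of _ "\<lambda>k. b k \<noteq> b' k"] by blast+
  have "j \<le> i" unfolding j_def using ne by (rule Least_le)
  define d where "d k = (of_bool (b k) / 3 ^ k - of_bool (b' k) / 3 ^ k :: real)" for k
  have sd: "summable d" unfolding d_def by (intro summable_diff summable_ternary)
  have "ternary_code b - ternary_code b' = suminf d"
    unfolding ternary_code_def d_def by (intro suminf_diff summable_ternary)
  also have "\<dots> = (\<Sum>k. d (k + Suc j)) + sum d {..<Suc j}" by (rule suminf_split_initial_segment[OF sd])
  also have "sum d {..<Suc j} = d j" using j(2) by (simp add: d_def)
  finally have eq: "ternary_code b - ternary_code b' = (\<Sum>k. d (k + Suc j)) + d j" .
  have dj: "\<bar>d j\<bar> = 1 / 3 ^ j" using j(1) by (cases "b j"; cases "b' j") (auto simp: d_def)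
  have tail: "(\<lambda>k. (1 / 3 ^ Suc j) * (1 / 3 ^ k) :: real) sums ((1 / 3 ^ Suc j) * (3 / 2))"
    by (intro sums_mult geometric_third)
  have "\<bar>\<Sum>k. d (k + Suc j)\<bar> \<le> (\<Sum>k. (1 / 3 ^ Suc j) * (1 / 3 ^ k))"
  proof (rule order_trans[OF summable_rabs])
    have le: "\<bar>d (k + Suc j)\<bar> \<le> (1 / 3 ^ Suc j) * (1 / 3 ^ k)" for k
      by (cases "b (k + Suc j)"; cases "b' (k + Suc j)") (auto simp: d_def power_add ac_simps)
    show "summable (\<lambda>k. \<bar>d (k + Suc j)\<bar>)"
      by (rule summable_comparison_test'[OF sums_summable[OF tail]]) (use le in auto)
    then show "(\<Sum>k. \<bar>d (k + Suc j)\<bar>) \<le> (\<Sum>k. (1 / 3 ^ Suc j) * (1 / 3 ^ k))"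
      using le sums_summable[OF tail] by (intro suminf_le)
  qed
  also have "\<dots> = 1 / (2 * 3 ^ j)" using tail by (simp add: sums_iff)
  finally have "\<bar>ternary_code b - ternary_code b'\<bar> \<ge> 1 / 3 ^ j - 1 / (2 * 3 ^ j)" unfolding eq using dj by linarith
  moreover have "1 / 3 ^ j - 1 / (2 * 3 ^ j) = 1 / (2 * 3 ^ j :: real)" by (simp add: field_simps)
  moreover have "1 / (2 * 3 ^ n) \<le> 1 / (2 * 3 ^ j :: real)"
    using \<open>j \<le> i\<close> \<open>i \<le> n\<close> by (intro divide_left_mono mult_left_mono power_increasing) auto
  ultimately show False using assms(1) by linarith
qed

lemma ternary_code_inject: "ternary_code b = ternary_code b' \<Longrightarrow> b = b'"
  using ternary_code_close[of b b' i i for i] by auto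

lemma ternary_code_eventually_const:
  assumes "convergent (\<lambda>n. ternary_code (b n))"
  shows "\<exists>N. \<forall>n\<ge>N. b n i = b N i"
proof -
  have "Cauchy (\<lambda>n. ternary_code (b n))" using assms by (rule convergent_Cauchy)
  then obtain N where "\<And>m n. m \<ge> N \<Longrightarrow> n \<ge> N \<Longrightarrow> dist (ternary_code (b m)) (ternary_code (b n)) < 1 / (2 * 3 ^ i)"
    by (rule metric_CauchyD[THEN exE, of _ "1 / (2 * 3 ^ i)"]) auto
  then show ?thesis
    by (intro exI[of _ N] allI impI ternary_code_close[of _ _ i]) (auto simp: dist_real_def)
qed

text \<open>A bounded sequence has a subsequential limit. A rational number strictly between it and
  a competing bound is eventually always or eventually never exceeded, and the subsequence decides
  which.\<close>

lemma convergent_thresholds: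
  fixes x :: "nat \<Rightarrow> real"
  assumes bdd: "\<And>n. \<bar>x n\<bar> \<le> B"
    and const: "\<And>q. q \<in> \<rat> \<Longrightarrow> \<exists>N. \<forall>n\<ge>N. (q < x n) = (q < x N)"
  shows "convergent x"
proof -
  have "bounded (range x)" using bdd by (auto simp: bounded_iff)
  then obtain l r where r: "strict_mono r" "(x \<circ> r) \<longlonglongrightarrow> l" using bounded_imp_convergent_subsequence by blast
  have "x \<longlonglongrightarrow> l"
  proof (rule order_tendstoI)
    fix a assume "a < l"
    then obtain q where q: "q \<in> \<rat>" "a < q" "q < l" using Rats_dense_in_real by blast
    obtain N where N: "\<And>n. n \<ge> N \<Longrightarrow> (q < x n) = (q < x N)" using const[OF q(1)] by blast
    have "eventually (\<lambda>n. q < (x \<circ> r) n) sequentially" using r(2) q(3) by (rule order_tendstoD)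
    then obtain M where M: "\<And>n. n \<ge> M \<Longrightarrow> q < x (r n)" by (auto simp: eventually_sequentially)
    have "q < x (r (max M N))" using M by simp
    moreover have "r (max M N) \<ge> N" using seq_suble[OF r(1), of "max M N"] by linarith
    ultimately have "q < x N" using N by blast
    then have "q < x n" if "n \<ge> N" for n using N that by blast
    then have "\<forall>n\<ge>N. a < x n" using q(2) by (meson less_trans)
    then show "eventually (\<lambda>n. a < x n) sequentially" by (auto simp: eventually_sequentially)
  next
    fix a assume "l < a"
    then obtain q where q: "q \<in> \<rat>" "l < q" "q < a" using Rats_dense_in_real by blast
    obtain N where N: "\<And>n. n \<ge> N \<Longrightarrow> (q < x n) = (q < x N)" using const[OF q(1)] by blast
    have "eventually (\<lambda>n. (x \<circ> r) n < q) sequentially" using r(2) q(2) by (rule order_tendstoD)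
    then obtain M where M: "\<And>n. n \<ge> M \<Longrightarrow> x (r n) < q" by (auto simp: eventually_sequentially)
    have "\<not> q < x (r (max M N))" using M[of "max M N"] by simp
    moreover have "r (max M N) \<ge> N" using seq_suble[OF r(1), of "max M N"] by linarith
    ultimately have "\<not> q < x N" using N by blast
    then have "x n \<le> q" if "n \<ge> N" for n using N that by (meson not_le)
    then have "\<forall>n\<ge>N. x n < a" using q(3) by (meson le_less_trans)
    then show "eventually (\<lambda>n. x n < a) sequentially" by (auto simp: eventually_sequentially)
  qed
  then show ?thesis by (rule convergentI)
qed

text \<open>The convex weights become a law on the real line, because the limit theorems for laws to
  be used are stated there.\<close>

lemma finite_convex_distribution:
  fixes \<theta> :: "'b \<Rightarrow> real"
  assumes F: "finite F" and u: "\<And>v. v \<in> F \<Longrightarrow> 0 \<le> u v" "sum u F = 1"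
  defines "\<mu> \<equiv> distr (point_measure F (\<lambda>v. ennreal (u v))) borel \<theta>"
  shows "real_distribution \<mu>"
    and "AE t in \<mu>. t \<in> \<theta> ` F"
    and "\<And>\<phi>. \<phi> \<in> borel_measurable borel \<Longrightarrow> (\<integral>t. \<phi> t \<partial>\<mu>) = (\<Sum>v\<in>F. u v * (\<phi> (\<theta> v) :: real))"
proof -
  let ?P = "point_measure F (\<lambda>v. ennreal (u v))"
  have sp: "space ?P = F" by (simp add: space_point_measure)
  interpret P: prob_space ?P
  proof
    have "emeasure ?P F = (\<Sum>v\<in>F. ennreal (u v))" using F by (intro emeasure_point_measure_finite) auto
    also have "\<dots> = 1" using u by (simp add: sum_ennreal)
    finally show "emeasure ?P (space ?P) = 1" by (simp add: sp)
  qed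
  have m: "\<theta> \<in> borel_measurable ?P" by simp
  show "real_distribution \<mu>" unfolding \<mu>_def by (rule P.real_distribution_distr[OF m])
  have "\<theta> ` F \<in> sets borel" using F by (intro finite_imp_closed borel_closed finite_imageI)
  then have meas: "{t \<in> space borel. t \<in> \<theta> ` F} \<in> sets borel" by simp
  have "AE v in ?P. \<theta> v \<in> \<theta> ` F" by (simp add: AE_point_measure)
  then show "AE t in \<mu>. t \<in> \<theta> ` F" unfolding \<mu>_def using AE_distr_iff[OF m meas] by simp
  fix \<phi> :: "real \<Rightarrow> real" assume "\<phi> \<in> borel_measurable borel"
  then have "(\<integral>t. \<phi> t \<partial>\<mu>) = (\<integral>v. \<phi> (\<theta> v) \<partial>?P)" unfolding \<mu>_def by (intro integral_distr m)
  also have "\<dots> = (\<Sum>v\<in>F. u v * \<phi> (\<theta> v))" using F u(1) by (subst lebesgue_integral_point_measure_finite) auto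
  finally show "(\<integral>t. \<phi> t \<partial>\<mu>) = (\<Sum>v\<in>F. u v * \<phi> (\<theta> v))" .
qed

text \<open>The digits record, for all pairs of a norming functional and a rational number, whether
  the functional exceeds the number. Convergence of the codes freezes every digit eventually, hence
  every coordinate converges. \<open>\<theta>\<close> need not be continuous; only this direction is
  wanted.\<close>

lemma ternary_coding_of_norming:
  fixes Z :: "'a::real_normed_vector set"
  assumes Z: "subspace Z" and \<xi>: "norming_for Z \<xi>"
  obtains \<theta> :: "'a \<Rightarrow> real" where "inj_on \<theta> Z" "\<And>c. 0 \<le> \<theta> c" "\<And>c. \<theta> c \<le> 3 / 2"
    "\<And>c B k. (\<And>n. norm (c n) \<le> B) \<Longrightarrow> convergent (\<lambda>n. \<theta> (c n)) \<Longrightarrow> convergent (\<lambda>n. \<xi> k (c n))"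
proof -
  define bit where "bit c i = (of_rat (snd (from_nat i :: nat \<times> rat)) < \<xi> (fst (from_nat i :: nat \<times> rat)) c)" for c i
  have bit: "bit c (to_nat (k, q)) = (of_rat q < \<xi> k c)" for c k q by (simp add: bit_def)
  show thesis
  proof (rule that[of "\<lambda>c. ternary_code (bit c)"])
    show "inj_on (\<lambda>c. ternary_code (bit c)) Z"
    proof (rule inj_onI)
      fix x y assume xy: "x \<in> Z" "y \<in> Z" "ternary_code (bit x) = ternary_code (bit y)"
      have b: "bit x = bit y" using xy(3) by (rule ternary_code_inject)
      have "\<xi> k x = \<xi> k y" for k
      proof (rule ccontr)
        assume "\<xi> k x \<noteq> \<xi> k y"
        then consider "\<xi> k x < \<xi> k y" | "\<xi> k y < \<xi> k x" by linarith
        then obtain q where "(of_rat q < \<xi> k x) \<noteq> (of_rat q < \<xi> k y)"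
          by cases (meson of_rat_dense not_less_iff_gr_or_eq)+
        then show False using bit[of x k q] bit[of y k q] b by simp
      qed
      then show "x = y" using xy by (intro norming_for_eqI[OF \<xi> Z])
    qed
    fix c :: "nat \<Rightarrow> 'a" and B k
    assume B: "\<And>n. norm (c n) \<le> B" and conv: "convergent (\<lambda>n. ternary_code (bit (c n)))"
    show "convergent (\<lambda>n. \<xi> k (c n))"
    proof (rule convergent_thresholds)
      have "norm (\<xi> k) \<le> 1" using \<xi> by (simp add: norming_for_def)
      then show "\<bar>\<xi> k (c n)\<bar> \<le> B" for n using blinfun_le_norm[of "\<xi> k" "c n"] B[of n] by linarith
      fix q :: real assume "q \<in> \<rat>"
      then obtain p where p: "q = of_rat p" by (auto simp: Rats_def)
      show "\<exists>N. \<forall>n\<ge>N. (q < \<xi> k (c n)) = (q < \<xi> k (c N))"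
        using ternary_code_eventually_const[OF conv, of "to_nat (k, p)"] by (simp add: bit p)
    qed
  qed (use ternary_code_bounds in auto)
qed

text \<open>
  A sequence of convex combinations of points of \<open>A\<close> is a sequence of barycentres of finitely
  supported laws. Coding points of \<open>A\<close> by reals, Helly's theorem and Skorohod's representation
  turn a subsequence of these laws into random points of \<open>A\<close> that converge weakly at every
  outcome, and the Pettis expectation of the limit is the weak limit of the barycentres.
\<close>

theorem weakly_seq_compact_convex_hull:
  fixes A :: "'a::banach set"
  assumes A: "weakly_seq_compact A" and B: "\<And>a. a \<in> A \<Longrightarrow> norm a \<le> B"
  shows "weakly_seq_compact (convex hull A)"
  unfolding weakly_seq_compact_def
proof (intro allI impI)
  fix x :: "nat \<Rightarrow> 'a" assume "\<forall>n. x n \<in> convex hull A"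
  then have "\<forall>n. \<exists>F u. finite F \<and> F \<subseteq> A \<and> (\<forall>v\<in>F. 0 \<le> u v) \<and> sum u F = 1 \<and> (\<Sum>v\<in>F. u v *\<^sub>R v) = x n"
    by (simp only: convex_hull_explicit mem_Collect_eq simp_thms)
  from choice[OF this] obtain F where F': "\<forall>n. \<exists>u. finite (F n) \<and> F n \<subseteq> A \<and> (\<forall>v\<in>F n. 0 \<le> u v)
      \<and> sum u (F n) = 1 \<and> (\<Sum>v\<in>F n. u v *\<^sub>R v) = x n" by (rule exE)
  from choice[OF F'] obtain u where u': "\<forall>n. finite (F n) \<and> F n \<subseteq> A \<and> (\<forall>v\<in>F n. 0 \<le> u n v)
      \<and> sum (u n) (F n) = 1 \<and> (\<Sum>v\<in>F n. u n v *\<^sub>R v) = x n" by (rule exE)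
  have F: "\<And>n. finite (F n)" "\<And>n. F n \<subseteq> A"
    and u: "\<And>n v. v \<in> F n \<Longrightarrow> 0 \<le> u n v" "\<And>n. sum (u n) (F n) = 1"
    and x: "\<And>n. (\<Sum>v\<in>F n. u n v *\<^sub>R v) = x n" using u' by auto
  have "F 0 \<noteq> {}" using u(2)[of 0] by auto
  then obtain c0 where c0: "c0 \<in> F 0" by blast
  have "countable (\<Union>n. F n)" using F(1) by (intro countable_UN) (auto intro: countable_finite)
  then obtain S where S: "countable S" "(\<Union>n. F n) \<subseteq> S" "subspace (closure S)"
    using countable_subspace_hull[of "\<Union>n. F n" "\<lambda>n a. a"] by auto
  have FZ: "F n \<subseteq> closure S" for n using S(2) closure_subset[of S] by blast
  obtain \<xi> where \<xi>: "norming_for (closure S) \<xi>" using norming_sequence[OF S(1,3)] by blast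
  obtain \<theta> :: "'a \<Rightarrow> real" where inj: "inj_on \<theta> (closure S)" and \<theta>: "\<And>c. 0 \<le> \<theta> c" "\<And>c. \<theta> c \<le> 3 / 2"
    and \<theta>_conv: "\<And>c B k. (\<And>n. norm (c n) \<le> B) \<Longrightarrow> convergent (\<lambda>n. \<theta> (c n)) \<Longrightarrow> convergent (\<lambda>n. \<xi> k (c n))"
    using ternary_coding_of_norming[OF S(3) \<xi>] by blast
  define \<mu> where "\<mu> n = distr (point_measure (F n) (\<lambda>v. ennreal (u n v))) borel \<theta>" for n
  have \<mu>: "real_distribution (\<mu> n)" "AE t in \<mu> n. t \<in> \<theta> ` F n" for n
    unfolding \<mu>_def using finite_convex_distribution[OF F(1)[of n] u] by auto
  have \<mu>_int: "(\<integral>t. \<phi> t \<partial>\<mu> n) = (\<Sum>v\<in>F n. u n v * (\<phi> (\<theta> v) :: real))" if "\<phi> \<in> borel_measurable borel" for \<phi> n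
    unfolding \<mu>_def using finite_convex_distribution(3)[OF F(1)[of n] u that] by auto
  have "tight \<mu>"
    unfolding tight_def
  proof (intro conjI allI impI \<mu>(1))
    fix \<epsilon> :: real assume "\<epsilon> > 0"
    \<comment> \<open>Codes lie between 0 and 3/2, so one half-open interval carries all the
      laws.\<close>
    have "measure (\<mu> n) {-1<..2} = 1" for n
    proof -
      interpret real_distribution "\<mu> n" by (rule \<mu>(1))
      have "AE t in \<mu> n. t \<in> {-1<..2}"
        using \<mu>(2)[of n]
      proof eventually_elim
        case (elim t)
        then obtain c where "t = \<theta> c" by blast
        then show ?case using \<theta>[of c] by simp
      qed
      then show ?thesis by (subst prob_eq_1) auto
    qed
    then show "\<exists>a b. a < b \<and> (\<forall>n. 1 - \<epsilon> < measure (\<mu> n) {a<..b})"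
      using \<open>\<epsilon> > 0\<close> by (intro exI[of _ "-1"] exI[of _ 2]) auto
  qed
  moreover have "strict_mono (id :: nat \<Rightarrow> nat)" by (simp add: strict_mono_def)
  ultimately obtain r M where r: "strict_mono (r :: nat \<Rightarrow> nat)" and M: "real_distribution M"
    and wc: "weak_conv_m (\<mu> \<circ> id \<circ> r) M"
    using tight_imp_convergent_subsubsequence by blast
  have \<mu>r: "real_distribution ((\<mu> \<circ> id \<circ> r) n)" for n using \<mu>(1) by simp
  from Skorohod[OF \<mu>r M wc] obtain \<Omega> :: "real measure" and Y :: "nat \<Rightarrow> real \<Rightarrow> real" and Yl :: "real \<Rightarrow> real"
    where "prob_space \<Omega>" and sk: "\<forall>n. Y n \<in> borel_measurable \<Omega>" "\<forall>n. distr \<Omega> borel (Y n) = (\<mu> \<circ> id \<circ> r) n"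
      "\<forall>\<omega>\<in>space \<Omega>. (\<lambda>n. Y n \<omega>) \<longlonglongrightarrow> Yl \<omega>"
    by (elim exE conjE)
  have Y[measurable]: "\<And>n. Y n \<in> borel_measurable \<Omega>" and dY: "\<And>n. distr \<Omega> borel (Y n) = \<mu> (r n)"
    and limY: "\<And>\<omega>. \<omega> \<in> space \<Omega> \<Longrightarrow> (\<lambda>n. Y n \<omega>) \<longlonglongrightarrow> Yl \<omega>"
    using sk by auto
  interpret \<Omega>: prob_space \<Omega> by fact
  have "AE \<omega> in \<Omega>. Y n \<omega> \<in> \<theta> ` F (r n)" for n
    using \<mu>(2)[of "r n"] unfolding dY[of n, symmetric] by (rule AE_distrD[OF Y])
  then have "AE \<omega> in \<Omega>. \<forall>n. Y n \<omega> \<in> \<theta> ` F (r n)" by (simp add: AE_all_countable)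
  then obtain N where N: "{\<omega> \<in> space \<Omega>. \<not> (\<forall>n. Y n \<omega> \<in> \<theta> ` F (r n))} \<subseteq> N" "N \<in> null_sets \<Omega>"
    by (auto elim: AE_E3 simp: eventually_ae_filter)
  have Nm[measurable]: "N \<in> sets \<Omega>" using N(2) by auto
  define \<kappa> where "\<kappa> n \<omega> = inv_into (F (r n)) \<theta> (Y n \<omega>)" for n \<omega>
  \<comment> \<open>Off the null set the Skorohod variables take codes of support points and can be
    decoded. On \<open>N\<close> the constant \<open>c0\<close> keeps every outcome inside
    \<open>A\<close>, so that convergence holds everywhere and not just almost surely.\<close>
  define g where "g n \<omega> = (if \<omega> \<in> N then c0 else \<kappa> n \<omega>)" for n \<omega>
  have \<kappa>: "\<kappa> n \<omega> \<in> F (r n)" "\<theta> (\<kappa> n \<omega>) = Y n \<omega>" if "\<omega> \<in> space \<Omega> - N" for n \<omega>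
  proof -
    have "Y n \<omega> \<in> \<theta> ` F (r n)" using N(1) that by blast
    then show "\<kappa> n \<omega> \<in> F (r n)" "\<theta> (\<kappa> n \<omega>) = Y n \<omega>" unfolding \<kappa>_def by (auto intro: inv_into_into f_inv_into_f)
  qed
  have gA: "g n \<omega> \<in> A" "g n \<omega> \<in> closure S" if "\<omega> \<in> space \<Omega>" for n \<omega>
    using that \<kappa>(1)[of \<omega> n] c0 F(2) FZ unfolding g_def by auto
  \<comment> \<open>Decoding is measurable after applying a functional, since on finitely many codes
    it is a finite sum of indicators.\<close>
  define \<Psi> where "\<Psi> n \<eta> t = (\<Sum>c\<in>F (r n). indicator {\<theta> c} t * blinfun_apply \<eta> c)" for n t and \<eta> :: "'a \<Rightarrow>\<^sub>L real"
  have \<Psi>m[measurable]: "\<Psi> n \<eta> \<in> borel_measurable borel" for n \<eta> unfolding \<Psi>_def by measurable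
  have \<Psi>\<theta>: "\<Psi> n \<eta> (\<theta> c) = \<eta> c" if c: "c \<in> F (r n)" for n \<eta> c
  proof -
    have "\<Psi> n \<eta> (\<theta> c) = (\<Sum>c'\<in>F (r n). if c' = c then blinfun_apply \<eta> c else 0)"
      unfolding \<Psi>_def using inj c FZ[of "r n"]
      by (intro sum.cong refl) (auto simp: indicator_def dest: inj_onD)
    then show ?thesis using F(1) c by simp
  qed
  have g\<Psi>: "\<eta> (g n \<omega>) = indicator N \<omega> * \<eta> c0 + indicator (space \<Omega> - N) \<omega> * \<Psi> n \<eta> (Y n \<omega>)"
    if "\<omega> \<in> space \<Omega>" for n \<omega> and \<eta> :: "'a \<Rightarrow>\<^sub>L real"
    using that \<kappa>[of \<omega> n] \<Psi>\<theta>[of "\<kappa> n \<omega>" n \<eta>] by (auto simp: g_def indicator_def)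
  have gm[measurable]: "(\<lambda>\<omega>. \<eta> (g n \<omega>)) \<in> borel_measurable \<Omega>" for n and \<eta> :: "'a \<Rightarrow>\<^sub>L real"
    by (subst measurable_cong[OF g\<Psi>]) auto
  have g_int: "(\<integral>\<omega>. \<eta> (g n \<omega>) \<partial>\<Omega>) = \<eta> (x (r n))" for n and \<eta> :: "'a \<Rightarrow>\<^sub>L real"
  proof -
    have "AE \<omega> in \<Omega>. \<eta> (g n \<omega>) = \<Psi> n \<eta> (Y n \<omega>)"
      using AE_not_in[OF N(2)] AE_space
      by eventually_elim (simp add: g\<Psi>)
    then have "(\<integral>\<omega>. \<eta> (g n \<omega>) \<partial>\<Omega>) = (\<integral>\<omega>. \<Psi> n \<eta> (Y n \<omega>) \<partial>\<Omega>)"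
      by (intro integral_cong_AE) auto
    also have "\<dots> = (\<integral>t. \<Psi> n \<eta> t \<partial>\<mu> (r n))" unfolding dY[of n, symmetric] by (subst integral_distr) auto
    also have "\<dots> = (\<Sum>v\<in>F (r n). u (r n) v * \<eta> v)" using \<mu>_int[OF \<Psi>m, of "r n" n \<eta>] \<Psi>\<theta> by simp
    also have "\<dots> = \<eta> (x (r n))" by (simp add: x[symmetric] blinfun.sum_right blinfun.scaleR_right)
    finally show ?thesis .
  qed
  have "\<exists>l. weakly_tendsto (\<lambda>n. g n \<omega>) l \<and> l \<in> closure S" if \<omega>: "\<omega> \<in> space \<Omega>" for \<omega>
  proof (cases "\<omega> \<in> N")
    case True
    then show ?thesis using weakly_tendsto_const[of c0] c0 FZ[of 0] by (auto simp: g_def)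
  next
    \<comment> \<open>Skorohod gives convergence of the codes, the coding gives convergence of the
      norming coordinates, and compactness of \<open>A\<close> gives weak convergence.\<close>
    case False
    have "convergent (\<lambda>n. \<theta> (g n \<omega>))"
      using limY[OF \<omega>] \<kappa>(2)[of \<omega>] False \<omega> by (auto simp: g_def intro: convergentI)
    then have "convergent (\<lambda>n. \<xi> k (g n \<omega>))" for k using gA(1)[OF \<omega>] B by (intro \<theta>_conv[of _ B]) auto
    then show ?thesis
      using weakly_seq_compact_tendsto[of A "\<lambda>n. g n \<omega>" "closure S" \<xi>] A gA[OF \<omega>] S(3) \<xi> by (metis closed_closure)
  qed
  then have "\<forall>\<omega>\<in>space \<Omega>. \<exists>l. weakly_tendsto (\<lambda>n. g n \<omega>) l \<and> l \<in> closure S" by blast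
  from bchoice[OF this] obtain gl where
    "\<forall>\<omega>\<in>space \<Omega>. weakly_tendsto (\<lambda>n. g n \<omega>) (gl \<omega>) \<and> gl \<omega> \<in> closure S" by (rule exE)
  then have gl: "\<And>\<omega>. \<omega> \<in> space \<Omega> \<Longrightarrow> weakly_tendsto (\<lambda>n. g n \<omega>) (gl \<omega>)"
    "\<And>\<omega>. \<omega> \<in> space \<Omega> \<Longrightarrow> gl \<omega> \<in> closure S" by auto
  have glm: "(\<lambda>\<omega>. \<eta> (gl \<omega>)) \<in> borel_measurable \<Omega>" for \<eta> :: "'a \<Rightarrow>\<^sub>L real"
    by (rule borel_measurable_LIMSEQ_real[of \<Omega> "\<lambda>n \<omega>. \<eta> (g n \<omega>)", OF _ gm]) (use gl(1) in \<open>simp add: weakly_tendsto_def\<close>)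
  have glB: "norm (gl \<omega>) \<le> B" if "\<omega> \<in> space \<Omega>" for \<omega>
    using gA(1)[OF that] B by (intro weakly_tendsto_norm_le[OF gl(1)[OF that]]) auto
  obtain y where y: "\<And>\<eta> :: 'a \<Rightarrow>\<^sub>L real. blinfun_apply \<eta> y = (\<integral>\<omega>. blinfun_apply \<eta> (gl \<omega>) \<partial>\<Omega>)"
    by (rule \<Omega>.pettis_integral[OF S(1) image_subsetI[OF gl(2)] \<Omega>.not_empty glm glB]) auto
  have "weakly_tendsto (x \<circ> r) y"
    unfolding weakly_tendsto_def
  proof
    fix \<eta> :: "'a \<Rightarrow>\<^sub>L real"
    have "(\<lambda>n. \<integral>\<omega>. \<eta> (g n \<omega>) \<partial>\<Omega>) \<longlonglongrightarrow> (\<integral>\<omega>. \<eta> (gl \<omega>) \<partial>\<Omega>)"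
    proof (rule integral_dominated_convergence[where w = "\<lambda>_. norm \<eta> * B"])
      show "AE \<omega> in \<Omega>. (\<lambda>n. \<eta> (g n \<omega>)) \<longlonglongrightarrow> \<eta> (gl \<omega>)"
        using gl(1) by (intro AE_I2) (simp add: weakly_tendsto_def)
      show "AE \<omega> in \<Omega>. norm (\<eta> (g n \<omega>)) \<le> norm \<eta> * B" for n
        using gA(1) B by (intro AE_I2) (meson mult_left_mono norm_blinfun norm_ge_zero order_trans)
    qed (use glm gm in auto)
    then show "(\<lambda>n. \<eta> ((x \<circ> r) n)) \<longlonglongrightarrow> \<eta> y" by (simp add: g_int y)
  qed
  with r show "\<exists>l s. strict_mono s \<and> weakly_tendsto (x \<circ> s) l" by blast
qed

section \<open>Approximate fixed points\<close>

text \<open>The dimension is a variable here, so points of the \<open>n\<close>-dimensional cube are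
  sequences that vanish from index \<open>n\<close> on.\<close>

definition fun_cube :: "nat \<Rightarrow> (nat \<Rightarrow> real) set" where
  "fun_cube n = {x. (\<forall>i<n. 0 \<le> x i \<and> x i \<le> 1) \<and> (\<forall>i\<ge>n. x i = 0)}"

definition fun_simplex :: "nat \<Rightarrow> (nat \<Rightarrow> real) set" where
  "fun_simplex n = {x. (\<forall>i<n. 0 \<le> x i) \<and> (\<forall>i\<ge>n. x i = 0) \<and> (\<Sum>i<n. x i) = 1}"

text \<open>Kuhn's combinatorial lemma yields, at mesh \<open>1 / Suc m\<close>, a cell that has for
  each \<open>i\<close> one vertex where \<open>f\<close> does not decrease coordinate
  \<open>i\<close> and one where it does not increase it. A limit point of these cells is fixed, and
  only sequential continuity is used.\<close>

lemma brouwer_fun_cube: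
  fixes f :: "(nat \<Rightarrow> real) \<Rightarrow> nat \<Rightarrow> real"
  assumes maps: "\<And>x i. x \<in> fun_cube n \<Longrightarrow> i < n \<Longrightarrow> 0 \<le> f x i \<and> f x i \<le> 1"
    and cont: "\<And>x l i. (\<And>m. x m \<in> fun_cube n) \<Longrightarrow> l \<in> fun_cube n \<Longrightarrow> (\<And>k. (\<lambda>m. x m k) \<longlonglongrightarrow> l k) \<Longrightarrow>
      i < n \<Longrightarrow> (\<lambda>m. f (x m) i) \<longlonglongrightarrow> f l i"
  obtains x where "x \<in> fun_cube n" "\<And>i. i < n \<Longrightarrow> f x i = x i"
proof -
  define y where "y p q i = (if i < n then real (q i) / real p else 0)" for p :: nat and q :: "nat \<Rightarrow> nat" and i
  have y_cube: "y p q \<in> fun_cube n" if "\<forall>i<n. q i \<le> p" "0 < p" for p q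
    using that by (auto simp: fun_cube_def y_def)
  define Q where "Q m q a b \<longleftrightarrow> (\<forall>i<n. q i < Suc m) \<and> (\<forall>i<n. (\<forall>j<n. q j \<le> a i j \<and> a i j \<le> q j + 1) \<and>
      (\<forall>j<n. q j \<le> b i j \<and> b i j \<le> q j + 1) \<and> y (Suc m) (a i) i \<le> f (y (Suc m) (a i)) i
      \<and> f (y (Suc m) (b i)) i \<le> y (Suc m) (b i) i)" for m q a b
  have "\<exists>q a b. Q m q a b" for m
  proof -
    \<comment> \<open>Kuhn's lemma prescribes the labels on the lower and upper faces. They agree
      with the sign conditions there because \<open>f\<close> takes values between 0 and 1.\<close>
    define label where "label q i = (if q i = 0 \<or> (q i \<noteq> Suc m \<and> y (Suc m) q i \<le> f (y (Suc m) q) i) then 0 else 1 :: nat)"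
      for q :: "nat \<Rightarrow> nat" and i
    have l0: "y (Suc m) q i \<le> f (y (Suc m) q) i" if "\<forall>i<n. q i \<le> Suc m" "i < n" "label q i = 0" for q i
      using that maps[OF y_cube[of q "Suc m"]] by (auto simp: label_def y_def split: if_splits)
    have l1: "f (y (Suc m) q) i \<le> y (Suc m) q i" if "\<forall>i<n. q i \<le> Suc m" "i < n" "label q i = 1" for q i
      using that maps[OF y_cube[of q "Suc m"]] by (auto simp: label_def y_def split: if_splits)
    have lab01: "label q i = 0 \<or> label q i = 1" for q i by (simp add: label_def)
    obtain q where q: "\<forall>i<n. q i < Suc m"
      and rs: "\<forall>i<n. \<exists>r s. (\<forall>j<n. q j \<le> r j \<and> r j \<le> q j + 1) \<and> (\<forall>j<n. q j \<le> s j \<and> s j \<le> q j + 1) \<and> label r i \<noteq> label s i"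
      by (rule kuhn_lemma[of "Suc m" n label]) (auto simp: label_def)
    have "\<exists>a b. (\<forall>j<n. q j \<le> a j \<and> a j \<le> q j + 1) \<and> (\<forall>j<n. q j \<le> b j \<and> b j \<le> q j + 1) \<and>
        y (Suc m) a i \<le> f (y (Suc m) a) i \<and> f (y (Suc m) b) i \<le> y (Suc m) b i" if i: "i < n" for i
    proof -
      obtain r s where r: "\<forall>j<n. q j \<le> r j \<and> r j \<le> q j + 1" and s: "\<forall>j<n. q j \<le> s j \<and> s j \<le> q j + 1"
        and ne: "label r i \<noteq> label s i" using rs i by blast
      have r': "\<forall>j<n. r j \<le> Suc m" and s': "\<forall>j<n. s j \<le> Suc m" using r s q by (metis Suc_eq_plus1 Suc_leI order_trans add_le_mono1 less_Suc_eq_le)+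
      show ?thesis
      proof (cases "label r i = 0")
        case True
        then have "label s i = 1" using ne lab01[of s i] by auto
        then show ?thesis using r s l0[OF r' i True] l1[OF s' i] by blast
      next
        case False
        then have "label r i = 1" "label s i = 0" using ne lab01[of s i] lab01[of r i] by auto
        then show ?thesis using r s l0[OF s' i] l1[OF r' i] by blast
      qed
    qed
    then have "\<forall>i. \<exists>ab. i < n \<longrightarrow> (\<forall>j<n. q j \<le> fst ab j \<and> fst ab j \<le> q j + 1) \<and> (\<forall>j<n. q j \<le> snd ab j \<and> snd ab j \<le> q j + 1) \<and>
        y (Suc m) (fst ab) i \<le> f (y (Suc m) (fst ab)) i \<and> f (y (Suc m) (snd ab)) i \<le> y (Suc m) (snd ab) i"
      by fastforce
    from choice[OF this] obtain ab where ab: "\<forall>i. i < n \<longrightarrow> (\<forall>j<n. q j \<le> fst (ab i) j \<and> fst (ab i) j \<le> q j + 1) \<and> (\<forall>j<n. q j \<le> snd (ab i) j \<and> snd (ab i) j \<le> q j + 1) \<and>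
        y (Suc m) (fst (ab i)) i \<le> f (y (Suc m) (fst (ab i))) i \<and> f (y (Suc m) (snd (ab i))) i \<le> y (Suc m) (snd (ab i)) i"
      by (rule exE)
    show ?thesis
      by (intro exI[of _ q] exI[of _ "\<lambda>i. fst (ab i)"] exI[of _ "\<lambda>i. snd (ab i)"]) (use q ab in \<open>auto simp: Q_def\<close>)
  qed
  then obtain q a b where Q: "\<And>m. Q m (q m) (a m) (b m)" by metis
  have q: "\<And>m i. i < n \<Longrightarrow> q m i < Suc m"
    and a: "\<And>m i j. i < n \<Longrightarrow> j < n \<Longrightarrow> q m j \<le> a m i j \<and> a m i j \<le> q m j + 1"
    and b: "\<And>m i j. i < n \<Longrightarrow> j < n \<Longrightarrow> q m j \<le> b m i j \<and> b m i j \<le> q m j + 1"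
    and fa: "\<And>m i. i < n \<Longrightarrow> y (Suc m) (a m i) i \<le> f (y (Suc m) (a m i)) i"
    and fb: "\<And>m i. i < n \<Longrightarrow> f (y (Suc m) (b m i)) i \<le> y (Suc m) (b m i) i"
    using Q by (auto simp: Q_def)
  have "\<bar>y (Suc m) (q m) k\<bar> \<le> 1" for m k using q[of k m] by (auto simp: y_def)
  then obtain s l where s: "strict_mono s" and l: "\<And>k. (\<lambda>m. y (Suc (s m)) (q (s m)) k) \<longlonglongrightarrow> l k"
    using bounded_coordinates_subseq[of "\<lambda>m. y (Suc m) (q m)" "\<lambda>_. 1"] by blast
  have inv0: "(\<lambda>m. 1 / real (Suc (s m))) \<longlonglongrightarrow> 0"
    using LIMSEQ_subseq_LIMSEQ[OF LIMSEQ_inverse_real_of_nat s] by (simp add: inverse_eq_divide comp_def)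
  \<comment> \<open>The mesh tends to zero, so every choice of vertices of the cells has the same
    limit \<open>l\<close>.\<close>
  have near: "(\<lambda>m. y (Suc (s m)) (c m) k) \<longlonglongrightarrow> l k"
    if c: "\<And>m j. j < n \<Longrightarrow> q (s m) j \<le> c m j \<and> c m j \<le> q (s m) j + 1" for c k
  proof -
    have "(\<lambda>m. y (Suc (s m)) (c m) k - y (Suc (s m)) (q (s m)) k) \<longlonglongrightarrow> 0"
    proof (rule Lim_null_comparison[OF _ inv0], intro always_eventually allI)
      fix m
      have "\<bar>real (c m k) - real (q (s m) k)\<bar> \<le> 1" if "k < n" using c[OF that, of m] by auto
      then show "norm (y (Suc (s m)) (c m) k - y (Suc (s m)) (q (s m)) k) \<le> 1 / real (Suc (s m))"
        by (auto simp: y_def divide_right_mono simp flip: diff_divide_distrib)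
    qed
    from tendsto_add[OF this l[of k]] show ?thesis by simp
  qed
  have cube_q: "y (Suc (s m)) (q (s m)) \<in> fun_cube n" for m using q[of _ "s m"] by (intro y_cube) (auto intro: less_imp_le)
  have cube: "y (Suc (s m)) (c m) \<in> fun_cube n"
    if c: "\<And>m j. j < n \<Longrightarrow> q (s m) j \<le> c m j \<and> c m j \<le> q (s m) j + 1" for c m
  proof (rule y_cube)
    show "\<forall>i<n. c m i \<le> Suc (s m)" using c q[of _ "s m"] by (metis Suc_eq_plus1 Suc_leI order_trans)
  qed simp
  have lcube: "l \<in> fun_cube n"
    unfolding fun_cube_def
  proof (intro CollectI conjI allI impI)
    fix i assume "i < n"
    then have c: "0 \<le> y (Suc (s m)) (q (s m)) i" "y (Suc (s m)) (q (s m)) i \<le> 1" for m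
      using cube_q[of m] by (auto simp: fun_cube_def)
    show "0 \<le> l i" using c(1) by (intro LIMSEQ_le_const[OF l]) auto
    show "l i \<le> 1" using c(2) by (intro LIMSEQ_le_const2[OF l]) auto
  next
    fix i assume "n \<le> i"
    then have "(\<lambda>m. y (Suc (s m)) (q (s m)) i) = (\<lambda>m. 0)" by (auto simp: y_def)
    then show "l i = 0" using l[of i] LIMSEQ_const_iff by metis
  qed
  show thesis
  proof (rule that[OF lcube])
    fix i assume i: "i < n"
    have lim: "(\<lambda>m. f (y (Suc (s m)) (c m)) i) \<longlonglongrightarrow> f l i"
      if c: "\<And>m j. j < n \<Longrightarrow> q (s m) j \<le> c m j \<and> c m j \<le> q (s m) j + 1" for c
      using cube[OF c] near[OF c] i lcube by (intro cont) auto
    have "l i \<le> f l i"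
      using a[OF i] fa[OF i] by (intro LIMSEQ_le[OF near[of "\<lambda>m. a (s m) i"] lim[of "\<lambda>m. a (s m) i"]]) auto
    moreover have "f l i \<le> l i"
      using b[OF i] fb[OF i] by (intro LIMSEQ_le[OF lim[of "\<lambda>m. b (s m) i"] near[of "\<lambda>m. b (s m) i"]]) auto
    ultimately show "f l i = l i" by simp
  qed
qed

text \<open>\<open>\<nu>\<close> retracts the cube onto the simplex by adding missing mass to
  coordinate 0 and dividing by excess mass. A fixed point of \<open>f\<close> after
  \<open>\<nu>\<close> has sum 1, because \<open>f\<close> does, so \<open>\<nu>\<close> leaves it
  alone.\<close>

lemma brouwer_fun_simplex:
  fixes f :: "(nat \<Rightarrow> real) \<Rightarrow> nat \<Rightarrow> real"
  assumes n: "n > 0"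
    and nonneg: "\<And>x i. x \<in> fun_simplex n \<Longrightarrow> i < n \<Longrightarrow> 0 \<le> f x i"
    and sum1: "\<And>x. x \<in> fun_simplex n \<Longrightarrow> (\<Sum>i<n. f x i) = 1"
    and cont: "\<And>x l i. (\<And>m. x m \<in> fun_simplex n) \<Longrightarrow> l \<in> fun_simplex n \<Longrightarrow> (\<And>k. (\<lambda>m. x m k) \<longlonglongrightarrow> l k) \<Longrightarrow>
      i < n \<Longrightarrow> (\<lambda>m. f (x m) i) \<longlonglongrightarrow> f l i"
  obtains x where "x \<in> fun_simplex n" "\<And>i. i < n \<Longrightarrow> f x i = x i"
proof -
  define \<sigma> where "\<sigma> x = (\<Sum>i<n. x i)" for x :: "nat \<Rightarrow> real"
  define \<nu> where "\<nu> x i = (x i + (if i = 0 then max 0 (1 - \<sigma> x) else 0)) / max 1 (\<sigma> x)" for x and i :: nat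
  have \<nu>: "\<nu> x \<in> fun_simplex n" if x: "x \<in> fun_cube n" for x
  proof -
    have "(\<Sum>i<n. \<nu> x i) = (\<sigma> x + max 0 (1 - \<sigma> x)) / max 1 (\<sigma> x)"
      using n unfolding \<nu>_def by (simp add: sum.distrib \<sigma>_def flip: sum_divide_distrib)
    also have "\<dots> = 1" by (auto simp: max_def)
    finally show ?thesis using x n by (auto simp: fun_simplex_def fun_cube_def \<nu>_def)
  qed
  have f1: "f x i \<le> 1" if "x \<in> fun_simplex n" "i < n" for x i
    using member_le_sum[of i "{..<n}" "f x"] nonneg[OF that(1)] sum1[OF that(1)] that(2) by auto
  obtain x where x: "x \<in> fun_cube n" "\<And>i. i < n \<Longrightarrow> f (\<nu> x) i = x i"
  proof (rule brouwer_fun_cube[of n "\<lambda>x. f (\<nu> x)"])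
    show "0 \<le> f (\<nu> x) i \<and> f (\<nu> x) i \<le> 1" if "x \<in> fun_cube n" "i < n" for x i
      using nonneg[OF \<nu>] f1[OF \<nu>] that by auto
    fix x :: "nat \<Rightarrow> nat \<Rightarrow> real" and l i
    assume x: "\<And>m. x m \<in> fun_cube n" and l: "l \<in> fun_cube n" and lim: "\<And>k. (\<lambda>m. x m k) \<longlonglongrightarrow> l k" and i: "i < n"
    have "(\<lambda>m. \<sigma> (x m)) \<longlonglongrightarrow> \<sigma> l" unfolding \<sigma>_def by (intro tendsto_intros lim)
    then have "(\<lambda>m. \<nu> (x m) k) \<longlonglongrightarrow> \<nu> l k" for k
      unfolding \<nu>_def using lim by (cases "k = 0") (auto intro!: tendsto_intros)
    then show "(\<lambda>m. f (\<nu> (x m)) i) \<longlonglongrightarrow> f (\<nu> l) i" using \<nu> x l i by (intro cont) auto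
  qed blast
  have "\<sigma> x = 1" unfolding \<sigma>_def using sum1[OF \<nu>[OF x(1)]] x(2) by simp
  then have "\<nu> x = x" by (auto simp: \<nu>_def)
  then show thesis using \<nu>[OF x(1)] x(2) that[of x] by simp
qed

text \<open>Rounding the coordinates down to multiples of \<open>e\<close> produces finitely many
  patterns; one representative of each forms the net.\<close>

lemma finite_coordinate_net:
  fixes \<Lambda> :: "'z \<Rightarrow> nat \<Rightarrow> real"
  assumes bdd: "\<And>z j. z \<in> K \<Longrightarrow> j < m \<Longrightarrow> \<bar>\<Lambda> z j\<bar> \<le> B" and "e > 0"
  obtains N where "finite N" "N \<subseteq> K" "\<And>z. z \<in> K \<Longrightarrow> \<exists>w\<in>N. \<forall>j<m. \<bar>\<Lambda> z j - \<Lambda> w j\<bar> < e"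
proof -
  define \<phi> where "\<phi> z = (\<lambda>j\<in>{..<m}. \<lfloor>\<Lambda> z j / e\<rfloor>)" for z
  have "\<phi> ` K \<subseteq> PiE {..<m} (\<lambda>_. {\<lfloor>- B / e\<rfloor>..\<lfloor>B / e\<rfloor>})"
  proof (intro image_subsetI PiE_I)
    fix z j assume "z \<in> K" "j \<in> {..<m}"
    then have "- B \<le> \<Lambda> z j" "\<Lambda> z j \<le> B" using bdd[of z j] by auto
    then have "- B / e \<le> \<Lambda> z j / e" "\<Lambda> z j / e \<le> B / e" using \<open>e > 0\<close> by (auto simp only: divide_right_mono less_imp_le)
    then show "\<phi> z j \<in> {\<lfloor>- B / e\<rfloor>..\<lfloor>B / e\<rfloor>}"
      using \<open>j \<in> {..<m}\<close> unfolding \<phi>_def by (simp add: floor_mono)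
  qed (auto simp: \<phi>_def)
  then have "finite (\<phi> ` K)" by (rule finite_subset) (auto intro: finite_PiE)
  moreover have "inv_into K \<phi> ` \<phi> ` K \<subseteq> K" by (auto intro: inv_into_into)
  moreover have "\<exists>w\<in>inv_into K \<phi> ` \<phi> ` K. \<forall>j<m. \<bar>\<Lambda> z j - \<Lambda> w j\<bar> < e" if z: "z \<in> K" for z
  proof (intro bexI allI impI)
    fix j assume j: "j < m"
    have "\<phi> (inv_into K \<phi> (\<phi> z)) = \<phi> z" using z by (intro f_inv_into_f) blast
    then have "\<phi> (inv_into K \<phi> (\<phi> z)) j = \<phi> z j" by simp
    moreover have "\<phi> w j = \<lfloor>\<Lambda> w j / e\<rfloor>" for w using j by (simp add: \<phi>_def)
    ultimately have "\<lfloor>\<Lambda> (inv_into K \<phi> (\<phi> z)) j / e\<rfloor> = \<lfloor>\<Lambda> z j / e\<rfloor>" by simp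
    then have "\<bar>\<Lambda> z j / e - \<Lambda> (inv_into K \<phi> (\<phi> z)) j / e\<bar> < 1" by linarith
    then show "\<bar>\<Lambda> z j - \<Lambda> (inv_into K \<phi> (\<phi> z)) j\<bar> < e"
      using \<open>e > 0\<close> by (simp add: field_simps abs_if split: if_splits)
  qed (use z in blast)
  ultimately show thesis by (intro that[of "inv_into K \<phi> ` \<phi> ` K"]) auto
qed

text \<open>The Schauder projection, seen through finitely many scalar tests
  \<open>\<Lambda>\<close>. The weights of the net points near \<open>F z\<close> define a map of
  the simplex into itself. At a Brouwer fixed point the tests of \<open>z\<close> are averages over
  net points whose tests are within \<open>e\<close> of those of \<open>F z\<close>. Combinations
  enter as an abstract \<open>comb\<close>, so that \<open>'z\<close> needs no vector space
  structure.\<close>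

lemma approximate_fixed_point:
  fixes \<Lambda> :: "'z \<Rightarrow> nat \<Rightarrow> real" and F :: "'z \<Rightarrow> 'z" and comb :: "nat \<Rightarrow> (nat \<Rightarrow> 'z) \<Rightarrow> (nat \<Rightarrow> real) \<Rightarrow> 'z"
  assumes ne: "K \<noteq> {}" and FK: "\<And>z. z \<in> K \<Longrightarrow> F z \<in> K"
    and bdd: "\<And>z j. z \<in> K \<Longrightarrow> j < m \<Longrightarrow> \<bar>\<Lambda> z j\<bar> \<le> B"
    and comb: "\<And>n w t. (\<And>i. i < n \<Longrightarrow> w i \<in> K) \<Longrightarrow> t \<in> fun_simplex n \<Longrightarrow> comb n w t \<in> K"
    and \<Lambda>_comb: "\<And>n w t j. (\<And>i. i < n \<Longrightarrow> w i \<in> K) \<Longrightarrow> t \<in> fun_simplex n \<Longrightarrow> j < m \<Longrightarrow>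
      \<Lambda> (comb n w t) j = (\<Sum>i<n. t i * \<Lambda> (w i) j)"
    and cont: "\<And>n w t l j. (\<And>i. i < n \<Longrightarrow> w i \<in> K) \<Longrightarrow> (\<And>k. t k \<in> fun_simplex n) \<Longrightarrow> l \<in> fun_simplex n \<Longrightarrow>
      (\<And>i. (\<lambda>k. t k i) \<longlonglongrightarrow> l i) \<Longrightarrow> j < m \<Longrightarrow> (\<lambda>k. \<Lambda> (F (comb n w (t k))) j) \<longlonglongrightarrow> \<Lambda> (F (comb n w l)) j"
    and "e > 0"
  obtains z where "z \<in> K" "\<And>j. j < m \<Longrightarrow> \<bar>\<Lambda> z j - \<Lambda> (F z) j\<bar> \<le> e"
proof -
  obtain N where N: "finite N" "N \<subseteq> K" "\<And>z. z \<in> K \<Longrightarrow> \<exists>w\<in>N. \<forall>j<m. \<bar>\<Lambda> z j - \<Lambda> w j\<bar> < e"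
    using finite_coordinate_net[of K m \<Lambda> B e] bdd \<open>e > 0\<close> by blast
  obtain n and w :: "nat \<Rightarrow> 'z" where w: "N = w ` {..<n}" using N(1) by (auto simp: finite_conv_nat_seg_image lessThan_def)
  have wK: "w i \<in> K" if "i < n" for i using that w N(2) by auto
  have "n > 0" using N(3) ne w by fastforce
  \<comment> \<open>The product is positive exactly when all \<open>m\<close> tests are within
    \<open>e\<close>, so a net point with nonzero weight is close in every test.\<close>
  define P where "P i z = (\<Prod>j<m. max 0 (e - \<bar>\<Lambda> (F z) j - \<Lambda> (w i) j\<bar>))" for i z
  have P0: "0 \<le> P i z" for i z unfolding P_def by (intro prod_nonneg) auto
  have Pn: "\<bar>\<Lambda> (F z) j - \<Lambda> (w i) j\<bar> < e" if "P i z \<noteq> 0" "j < m" for i z j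
  proof (rule ccontr)
    assume "\<not> \<bar>\<Lambda> (F z) j - \<Lambda> (w i) j\<bar> < e"
    then have "max 0 (e - \<bar>\<Lambda> (F z) j - \<Lambda> (w i) j\<bar>) = 0" by simp
    then show False using that unfolding P_def by (metis finite_lessThan lessThan_iff prod_zero)
  qed
  have Ppos: "0 < (\<Sum>i<n. P i z)" if z: "z \<in> K" for z
  proof -
    obtain i where i: "i < n" "\<forall>j<m. \<bar>\<Lambda> (F z) j - \<Lambda> (w i) j\<bar> < e" using N(3)[OF FK[OF z]] w by auto
    then have "0 < P i z" unfolding P_def by (intro prod_pos) auto
    also have "\<dots> \<le> (\<Sum>i<n. P i z)" using i(1) P0 by (intro member_le_sum) auto
    finally show ?thesis .
  qed
  have combK: "comb n w t \<in> K" if "t \<in> fun_simplex n" for t using comb wK that by blast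
  obtain t where t: "t \<in> fun_simplex n" "\<And>i. i < n \<Longrightarrow> P i (comb n w t) / (\<Sum>i<n. P i (comb n w t)) = t i"
  proof (rule brouwer_fun_simplex[OF \<open>n > 0\<close>, of "\<lambda>t i. P i (comb n w t) / (\<Sum>i<n. P i (comb n w t))"])
    fix t assume t: "t \<in> fun_simplex n"
    show "0 \<le> P i (comb n w t) / (\<Sum>i<n. P i (comb n w t))" for i
      using P0 Ppos[OF combK[OF t]] by (intro divide_nonneg_pos)
    show "(\<Sum>i<n. P i (comb n w t) / (\<Sum>i<n. P i (comb n w t))) = 1"
      using Ppos[OF combK[OF t]] by (simp flip: sum_divide_distrib)
  next
    fix t l i assume t: "\<And>k. t k \<in> fun_simplex n" "l \<in> fun_simplex n" "\<And>i. (\<lambda>k. t k i) \<longlonglongrightarrow> l i"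
    have "(\<lambda>k. P i (comb n w (t k))) \<longlonglongrightarrow> P i (comb n w l)" for i
      unfolding P_def using cont[of n w t l] wK t by (intro tendsto_intros) auto
    then show "(\<lambda>k. P i (comb n w (t k)) / (\<Sum>i<n. P i (comb n w (t k)))) \<longlonglongrightarrow> P i (comb n w l) / (\<Sum>i<n. P i (comb n w l))"
      using Ppos[OF combK[OF t(2)]] by (intro tendsto_intros) auto
  qed blast
  define z where "z = comb n w t"
  have zK: "z \<in> K" unfolding z_def by (rule combK[OF t(1)])
  show thesis
  proof (rule that[OF zK])
    fix j assume j: "j < m"
    have t1: "(\<Sum>i<n. t i) = 1" "\<And>i. i < n \<Longrightarrow> 0 \<le> t i" using t(1) by (auto simp: fun_simplex_def)
    have "\<Lambda> z j - \<Lambda> (F z) j = (\<Sum>i<n. t i * \<Lambda> (w i) j) - (\<Sum>i<n. t i) * \<Lambda> (F z) j"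
      using \<Lambda>_comb[of n w t j] wK t(1) j t1(1) by (simp add: z_def)
    also have "\<dots> = (\<Sum>i<n. t i * (\<Lambda> (w i) j - \<Lambda> (F z) j))"
      by (simp add: sum_distrib_right right_diff_distrib sum_subtractf)
    finally have "\<bar>\<Lambda> z j - \<Lambda> (F z) j\<bar> \<le> (\<Sum>i<n. \<bar>t i * (\<Lambda> (w i) j - \<Lambda> (F z) j)\<bar>)" by simp
    also have "\<dots> \<le> (\<Sum>i<n. t i * e)"
    proof (rule sum_mono)
      fix i assume "i \<in> {..<n}"
      then have i: "i < n" by simp
      show "\<bar>t i * (\<Lambda> (w i) j - \<Lambda> (F z) j)\<bar> \<le> t i * e"
      proof (cases "t i = 0")
        case False
        then have "P i z \<noteq> 0" using t(2)[OF i] by (auto simp: z_def)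
        then have "\<bar>\<Lambda> (w i) j - \<Lambda> (F z) j\<bar> \<le> e" using Pn[OF _ j] by (auto simp: abs_minus_commute intro: less_imp_le)
        then show ?thesis using t1(2)[OF i] by (simp add: abs_mult mult_left_mono)
      qed simp
    qed
    also have "\<dots> = e" using t1(1) by (simp flip: sum_distrib_right)
    finally show "\<bar>\<Lambda> z j - \<Lambda> (F z) j\<bar> \<le> e" .
  qed
qed

section \<open>Oriented delta integrals\<close>

lemma sets_delta_measure [simp, measurable_cong]: "sets (delta_measure T) = sets borel"
  and space_delta_measure [simp]: "space (delta_measure T) = UNIV"
  by (simp_all add: delta_measure_def)

lemma fjump_mem:
  assumes "time_scale T" "t \<in> T"
  shows "fjump T t \<in> T"
proof (cases "\<exists>s\<in>T. t < s")
  case True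
  have "Inf {s\<in>T. t < s} \<in> closure {s\<in>T. t < s}"
    using True by (intro closure_contains_Inf bdd_belowI[of _ t]) auto
  also have "\<dots> \<subseteq> closure T" by (intro closure_mono) auto
  finally show ?thesis using True assms(1) by (simp add: fjump_def time_scale_def)
next
  case False
  then have "Sup T = t" using assms(2) by (intro cSup_eq_maximum) (auto simp: not_less)
  then show ?thesis using False assms(2) by (simp add: fjump_def)
qed

lemma fjump_ge:
  assumes "t \<in> T"
  shows "t \<le> fjump T t"
proof (cases "\<exists>s\<in>T. t < s")
  case True
  then show ?thesis using fjump_gt(1) by blast
next
  case False
  then have "Sup T = t" using assms by (intro cSup_eq_maximum) (auto simp: not_less)
  then show ?thesis using False by (simp add: fjump_def)
qed

lemma sigma_finite_delta_measure:
  "time_scale T \<Longrightarrow> sigma_finite_measure (delta_measure T)"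
  unfolding delta_measure_def time_scale_def
  by (intro sigma_finite_interval_measure fjump_mono fjump_right_cont) auto

text \<open>The complement is a countable union of rational intervals whose closures avoid
  \<open>T\<close>. The forward jump takes equal values at the ends of such an interval, so its
  distribution function gives it no mass.\<close>

lemma emeasure_delta_compl:
  assumes "time_scale T"
  shows "emeasure (delta_measure T) (- T) = 0"
proof -
  have T: "T \<noteq> {}" "closed T" using assms by (auto simp: time_scale_def)
  define P where "P = {p \<in> \<rat> \<times> \<rat>. {fst p..snd p} \<inter> T = {}}"
  have "countable P" unfolding P_def by (rule countable_subset[of _ "\<rat> \<times> \<rat>"]) (auto intro: countable_rat)
  have cover: "- T = (\<Union>p\<in>P. {fst p<..snd p})"
  proof (intro equalityI subsetI)
    fix x assume "x \<in> - T"
    then obtain e where e: "e > 0" "ball x e \<subseteq> - T" using T(2) open_contains_ball by blast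
    obtain a where a: "a \<in> \<rat>" "x - e < a" "a < x" using Rats_dense_in_real[of "x - e" x] e(1) by auto
    obtain b where b: "b \<in> \<rat>" "x < b" "b < x + e" using Rats_dense_in_real[of x "x + e"] e(1) by auto
    have "{a..b} \<subseteq> ball x e" using a b by (auto simp: dist_real_def)
    then have "(a, b) \<in> P" using e(2) a b unfolding P_def by auto
    then show "x \<in> (\<Union>p\<in>P. {fst p<..snd p})" using a b by force
  qed (auto simp: P_def disjoint_iff)
  have null: "{fst p<..snd p} \<in> null_sets (delta_measure T)" if p: "p \<in> P" for p
  proof (cases "fst p \<le> snd p")
    case True
    have iff: "fst p < s \<longleftrightarrow> snd p < s" if "s \<in> T" for s
    proof -
      have "s \<notin> {fst p..snd p}" using p that unfolding P_def by blast
      then show ?thesis using True by auto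
    qed
    then have "{s \<in> T. fst p < s} = {s \<in> T. snd p < s}" by blast
    moreover have "(\<exists>s\<in>T. fst p < s) \<longleftrightarrow> (\<exists>s\<in>T. snd p < s)" using iff by blast
    ultimately have "fjump T (fst p) = fjump T (snd p)" by (simp add: fjump_def)
    then have "emeasure (delta_measure T) {fst p<..snd p} = 0"
      unfolding delta_measure_def using True T
      by (subst emeasure_interval_measure_Ioc) (auto intro: fjump_mono fjump_right_cont)
    then show ?thesis by (auto simp: null_sets_def)
  qed auto
  have "(\<Union>p\<in>P. {fst p<..snd p}) \<in> null_sets (delta_measure T)"
    using \<open>countable P\<close> null by (intro null_sets_UN') auto
  then show ?thesis unfolding cover by auto
qed

lemma emeasure_delta_Int:
  assumes "time_scale T" "a \<in> T" "b \<in> T" "a \<le> b"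
  shows "emeasure (delta_measure T) ({a..<b} \<inter> T) = ennreal (b - a)"
proof -
  have "T \<in> sets borel" using assms(1) by (simp add: time_scale_def)
  moreover have "- T \<in> null_sets (delta_measure T)"
    using calculation emeasure_delta_compl[OF assms(1)] by (intro null_setsI) auto
  ultimately have "emeasure (delta_measure T) ({a..<b} - - T) = emeasure (delta_measure T) {a..<b}"
    by (intro emeasure_Diff_null_set) auto
  then show ?thesis using emeasure_delta_measure[OF assms(2-4)] by (simp add: Diff_eq)
qed

text \<open>The oriented indicator of the interval from \<open>a\<close> to \<open>b\<close>. As a
  difference of two indicators of rays it telescopes, which yields additivity of integrals without
  case distinctions on the order of endpoints.\<close>

definition ori :: "real \<Rightarrow> real \<Rightarrow> real \<Rightarrow> real" where
  "ori a b s = of_bool (s < b) - of_bool (s < a)"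

lemma ori_eq: "ori a b s = (if a \<le> b then 1 else - 1) * indicator {min a b..<max a b} s"
  by (auto simp: ori_def indicator_def)

lemma ori_add: "ori a b s + ori b c s = ori a c s"
  by (simp add: ori_def)

lemma abs_ori: "\<bar>ori a b s\<bar> = indicator {min a b..<max a b} s"
  by (auto simp: ori_eq)

lemma ori_measurable [measurable]: "ori a b \<in> borel_measurable borel"
  unfolding ori_def[abs_def] by measurable

text \<open>The measure does not charge the complement of \<open>T\<close>, but integrands are
  unspecified there; the indicator is kept for the sake of measurability.\<close>

definition delta_integral1 :: "real set \<Rightarrow> real \<Rightarrow> real \<Rightarrow> (real \<Rightarrow> real) \<Rightarrow> real" where
  "delta_integral1 T a b \<Phi> = (\<integral>s. indicator T s * ori a b s * \<Phi> s \<partial>delta_measure T)"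

lemma continuous_delta_integrable1:
  assumes T: "time_scale T" "a \<in> T" "b \<in> T" and \<Phi>: "continuous_on T \<Phi>"
  shows "integrable (delta_measure T) (\<lambda>s. indicator T s * ori a b s * \<Phi> s)"
proof -
  have clT: "closed T" using T(1) by (simp add: time_scale_def)
  have "compact (\<Phi> ` ({min a b..max a b} \<inter> T))"
    using clT by (intro compact_continuous_image continuous_on_subset[OF \<Phi>] compact_Int_closed) auto
  then obtain M where M: "\<And>s. s \<in> {min a b..max a b} \<inter> T \<Longrightarrow> \<bar>\<Phi> s\<bar> \<le> M"
    using compact_imp_bounded[of "\<Phi> ` ({min a b..max a b} \<inter> T)"] unfolding bounded_iff by fastforce
  have "(\<lambda>s. indicator T s *\<^sub>R \<Phi> s) \<in> borel_measurable borel"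
    using \<Phi> clT by (intro borel_measurable_continuous_on_indicator) auto
  then have "(\<lambda>s. ori a b s * (indicator T s *\<^sub>R \<Phi> s)) \<in> borel_measurable (delta_measure T)" by simp
  then have meas: "(\<lambda>s. indicator T s * ori a b s * \<Phi> s) \<in> borel_measurable (delta_measure T)"
    by (simp add: mult_ac)
  have "min a b \<in> T" "max a b \<in> T" using T by (auto simp: min_def max_def)
  then have "emeasure (delta_measure T) ({min a b..<max a b} \<inter> T) < \<infinity>"
    by (subst emeasure_delta_Int[OF T(1)]) auto
  then have "integrable (delta_measure T) (indicator ({min a b..<max a b} \<inter> T) :: real \<Rightarrow> real)"
    using clT by (intro integrable_real_indicator) auto
  then have "integrable (delta_measure T) (\<lambda>s. M * indicator ({min a b..<max a b} \<inter> T) s)"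
    by (intro integrable_mult_right)
  then show ?thesis
  proof (rule Bochner_Integration.integrable_bound[OF _ meas], intro AE_I2)
    fix s
    show "norm (indicator T s * ori a b s * \<Phi> s) \<le> norm (M * indicator ({min a b..<max a b} \<inter> T) s)"
      using M[of s] by (auto simp: abs_mult abs_ori indicator_def)
  qed
qed

lemma delta_integral1_diff:
  assumes "time_scale T" "a \<in> T" "b \<in> T" "c \<in> T" "continuous_on T \<Phi>"
  shows "delta_integral1 T a c \<Phi> - delta_integral1 T a b \<Phi> = delta_integral1 T b c \<Phi>"
proof -
  have "delta_integral1 T a c \<Phi> - delta_integral1 T a b \<Phi>
      = (\<integral>s. indicator T s * ori a c s * \<Phi> s - indicator T s * ori a b s * \<Phi> s \<partial>delta_measure T)"
    unfolding delta_integral1_def using assms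
    by (intro Bochner_Integration.integral_diff[symmetric] continuous_delta_integrable1)
  also have "\<dots> = delta_integral1 T b c \<Phi>"
    unfolding delta_integral1_def by (simp add: ori_add[of a b _ c, symmetric] algebra_simps)
  finally show ?thesis .
qed

lemma integral_ori:
  assumes "time_scale T" "a \<in> T" "b \<in> T"
  shows "delta_integral1 T a b (\<lambda>_. k) = k * (b - a)"
    and "(\<integral>s. indicator T s * \<bar>ori a b s\<bar> \<partial>delta_measure T) = \<bar>b - a\<bar>"
proof -
  have "min a b \<in> T" "max a b \<in> T" using assms by (auto simp: min_def max_def)
  then have m: "measure (delta_measure T) ({min a b..<max a b} \<inter> T) = \<bar>b - a\<bar>"
    unfolding measure_def by (subst emeasure_delta_Int[OF assms(1)]) auto
  have i: "indicator T s * indicator {min a b..<max a b} s = (indicator ({min a b..<max a b} \<inter> T) s :: real)" for s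
    by (auto simp: indicator_def)
  then show "(\<integral>s. indicator T s * \<bar>ori a b s\<bar> \<partial>delta_measure T) = \<bar>b - a\<bar>"
    by (simp add: abs_ori m)
  have "delta_integral1 T a b (\<lambda>_. k)
      = (\<integral>s. (k * (if a \<le> b then 1 else - 1)) * indicator ({min a b..<max a b} \<inter> T) s \<partial>delta_measure T)"
    unfolding delta_integral1_def ori_eq i[symmetric]
    by (intro Bochner_Integration.integral_cong) (auto simp: ac_simps)
  also have "\<dots> = k * (b - a)"
    by (subst integral_mult_right_zero) (auto simp: m)
  finally show "delta_integral1 T a b (\<lambda>_. k) = k * (b - a)" .
qed

text \<open>The increment from \<open>u\<close> to the jump \<open>?j\<close> is compared with the
  integral of the constant \<open>\<Phi> x\<close>. No point of \<open>T\<close> lies strictly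
  between \<open>x\<close> and \<open>?j\<close>, so only values of \<open>\<Phi>\<close> near
  \<open>x\<close> count even when \<open>x\<close> is right-scattered.\<close>

lemma delta_integral1_deriv:
  assumes T: "time_scale T" "a \<in> T" "x \<in> T" and \<Phi>: "continuous_on T \<Phi>"
  shows "has_delta_deriv T (\<lambda>x. delta_integral1 T a x \<Phi>) (\<Phi> x) x"
  unfolding has_delta_deriv_def
proof (intro allI impI)
  fix \<epsilon> :: real assume "\<epsilon> > 0"
  then obtain \<delta> where \<delta>: "\<delta> > 0" "\<And>s. s \<in> T \<Longrightarrow> \<bar>s - x\<bar> < \<delta> \<Longrightarrow> \<bar>\<Phi> s - \<Phi> x\<bar> < \<epsilon>"
    using \<Phi> T(3) unfolding continuous_on_iff dist_real_def by metis
  let ?j = "fjump T x"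
  have j: "?j \<in> T" "x \<le> ?j" using fjump_mem[OF T(1,3)] fjump_ge[OF T(3)] by auto
  have jmin: "?j \<le> s" if "s \<in> T" "x < s" for s using fjump_gt(2)[OF that] .
  have "\<bar>(delta_integral1 T a ?j \<Phi> - delta_integral1 T a u \<Phi>) - \<Phi> x * (?j - u)\<bar> \<le> \<epsilon> * \<bar>?j - u\<bar>"
    if u: "u \<in> T" "\<bar>u - x\<bar> < \<delta>" for u
  proof -
    note int = continuous_delta_integrable1[OF T(1) u(1) j(1)]
    have c: "continuous_on T (\<lambda>_. k :: real)" for k by simp
    have "(delta_integral1 T a ?j \<Phi> - delta_integral1 T a u \<Phi>) - \<Phi> x * (?j - u)
        = delta_integral1 T u ?j \<Phi> - delta_integral1 T u ?j (\<lambda>_. \<Phi> x)"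
      using T u j \<Phi> by (simp add: delta_integral1_diff integral_ori)
    also have "\<dots> = (\<integral>s. indicator T s * ori u ?j s * \<Phi> s - indicator T s * ori u ?j s * \<Phi> x \<partial>delta_measure T)"
      unfolding delta_integral1_def by (intro Bochner_Integration.integral_diff[symmetric] int \<Phi> c)
    finally have eq: "(delta_integral1 T a ?j \<Phi> - delta_integral1 T a u \<Phi>) - \<Phi> x * (?j - u) = \<dots>" .
    have "\<bar>(delta_integral1 T a ?j \<Phi> - delta_integral1 T a u \<Phi>) - \<Phi> x * (?j - u)\<bar>
        \<le> (\<integral>s. \<bar>indicator T s * ori u ?j s * \<Phi> s - indicator T s * ori u ?j s * \<Phi> x\<bar> \<partial>delta_measure T)"
      unfolding eq by (rule integral_abs_bound)
    also have "\<dots> \<le> (\<integral>s. \<epsilon> * (indicator T s * \<bar>ori u ?j s\<bar>) \<partial>delta_measure T)"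
    proof (rule integral_mono)
      show "integrable (delta_measure T) (\<lambda>s. \<bar>indicator T s * ori u ?j s * \<Phi> s - indicator T s * ori u ?j s * \<Phi> x\<bar>)"
        by (intro integrable_abs Bochner_Integration.integrable_diff int \<Phi> c)
      have "integrable (delta_measure T) (\<lambda>s. \<bar>indicator T s * ori u ?j s * 1\<bar>)"
        by (intro integrable_abs int c)
      then show "integrable (delta_measure T) (\<lambda>s. \<epsilon> * (indicator T s * \<bar>ori u ?j s\<bar>))"
        by (intro integrable_mult_right) (simp add: abs_mult)
      fix s
      show "\<bar>indicator T s * ori u ?j s * \<Phi> s - indicator T s * ori u ?j s * \<Phi> x\<bar> \<le> \<epsilon> * (indicator T s * \<bar>ori u ?j s\<bar>)"
      proof (cases "s \<in> T \<and> ori u ?j s \<noteq> 0")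
        case True
        then have "s \<in> T" "min u ?j \<le> s" "s < max u ?j" by (auto simp: ori_eq split: split_indicator_asm if_splits)
        \<comment> \<open>If \<open>u \<le> x\<close>, the half-open interval excludes
          \<open>?j\<close>, so \<open>s\<close> lies between \<open>u\<close> and \<open>x\<close>;
          if \<open>u > x\<close>, then \<open>?j \<le> u\<close> and \<open>s\<close> lies between
          \<open>x\<close> and \<open>u\<close>.\<close>
        then have "\<bar>s - x\<bar> < \<delta>" using u jmin[of s] jmin[of u] j by (cases "x < s"; cases "x < u") (auto simp: min_def max_def split: if_splits)
        then have "\<bar>\<Phi> s - \<Phi> x\<bar> \<le> \<epsilon>" using \<delta>(2)[of s] True by auto
        then have "\<bar>ori u ?j s\<bar> * \<bar>\<Phi> s - \<Phi> x\<bar> \<le> \<bar>ori u ?j s\<bar> * \<epsilon>" by (intro mult_left_mono) auto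
        then have "\<bar>ori u ?j s * (\<Phi> s - \<Phi> x)\<bar> \<le> \<epsilon> * \<bar>ori u ?j s\<bar>" by (simp add: abs_mult mult.commute)
        then show ?thesis using True by (simp add: right_diff_distrib)
      qed auto
    qed
    also have "\<dots> = \<epsilon> * \<bar>?j - u\<bar>" using integral_ori(2)[OF T(1) u(1) j(1)] by simp
    finally show ?thesis .
  qed
  then show "\<exists>\<delta>>0. \<forall>u\<in>{x - \<delta><..<x + \<delta>} \<inter> T.
      \<bar>(delta_integral1 T a ?j \<Phi> - delta_integral1 T a u \<Phi>) - \<Phi> x * (?j - u)\<bar> \<le> \<epsilon> * \<bar>?j - u\<bar>"
    using \<delta>(1) by (intro exI[of _ \<delta>]) (auto simp: abs_less_iff)
qed

section \<open>Double delta integrals over rectangles\<close>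

locale time_scales =
  fixes T1 T2 :: "real set"
  assumes ts: "time_scale T1" "time_scale T2"
begin

sublocale M1: sigma_finite_measure "delta_measure T1" by (rule sigma_finite_delta_measure[OF ts(1)])
sublocale M2: sigma_finite_measure "delta_measure T2" by (rule sigma_finite_delta_measure[OF ts(2)])
sublocale MP: pair_sigma_finite "delta_measure T1" "delta_measure T2" ..

abbreviation "MM \<equiv> delta_measure2 T1 T2"

lemma closed_ts: "closed T1" "closed T2" "closed (T1 \<times> T2)"
  using ts by (auto simp: time_scale_def closed_Times)

lemma sets_borel_MM: "A \<in> sets borel \<Longrightarrow> A \<in> sets MM"
proof -
  assume "A \<in> sets (borel :: (real \<times> real) measure)"
  also have "sets (borel :: (real \<times> real) measure) = sets (delta_measure T1 \<Otimes>\<^sub>M delta_measure T2)"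
    unfolding borel_prod[symmetric] by (intro sets_pair_measure_cong) auto
  finally show ?thesis unfolding delta_measure2_def by auto
qed

lemma space_MM [simp]: "space MM = UNIV"
  by (simp add: delta_measure2_def space_pair_measure)

lemma borel_measurable_MM: "\<phi> \<in> borel_measurable borel \<Longrightarrow> \<phi> \<in> borel_measurable MM"
  using sets_borel_MM by (auto simp: measurable_def)

lemma tsrect_borel: "tsrect T1 T2 a b c d \<in> sets borel"
  unfolding tsrect_def using closed_ts by (intro borel_Times) auto

lemma emeasure_tsrect:
  assumes "a \<in> T1" "b \<in> T1" "c \<in> T2" "d \<in> T2"
  shows "emeasure MM (tsrect T1 T2 a b c d) = ennreal (\<bar>b - a\<bar> * \<bar>d - c\<bar>)"
proof -
  have mm: "min a b \<in> T1" "max a b \<in> T1" "min c d \<in> T2" "max c d \<in> T2"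
    using assms by (auto simp: min_def max_def)
  have "emeasure MM (tsrect T1 T2 a b c d)
      = emeasure (delta_measure T1) ({min a b..<max a b} \<inter> T1) * emeasure (delta_measure T2) ({min c d..<max c d} \<inter> T2)"
    unfolding delta_measure2_def tsrect_def using closed_ts
    by (subst emeasure_completion) (auto intro!: M2.emeasure_pair_measure_Times)
  also have "\<dots> = ennreal (max a b - min a b) * ennreal (max c d - min c d)"
    using mm ts by (simp add: emeasure_delta_Int)
  also have "\<dots> = ennreal (\<bar>b - a\<bar> * \<bar>d - c\<bar>)"
    by (subst ennreal_mult[symmetric]) (auto simp: max_def min_def abs_if)
  finally show ?thesis .
qed

text \<open>The oriented weight of a rectangle. Integrals over rectangles become integrals of one
  function against different weights, and additivity becomes an identity between weights.\<close>

definition W :: "real \<Rightarrow> real \<Rightarrow> real \<Rightarrow> real \<Rightarrow> real \<times> real \<Rightarrow> real" where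
  "W a b c d p = (indicator T1 (fst p) * ori a b (fst p)) * (indicator T2 (snd p) * ori c d (snd p))"

lemma W_eq: "W a b c d p = (if a \<le> b then 1 else - 1) * (if c \<le> d then 1 else - 1) * indicator (tsrect T1 T2 a b c d) p"
  by (cases p) (auto simp: W_def ori_eq tsrect_def indicator_def)

lemma abs_W: "\<bar>W a b c d p\<bar> = indicator (tsrect T1 T2 a b c d) p"
  by (auto simp: W_eq)

lemma delta_integral2_W:
  "delta_integral2 T1 T2 a b c d \<phi> = (\<integral>p. W a b c d p * \<phi> (fst p) (snd p) \<partial>MM)"
  unfolding delta_integral2_def set_lebesgue_integral_def
  by (subst integral_mult_right_zero[symmetric]) (auto simp: W_eq case_prod_unfold intro!: Bochner_Integration.integral_cong)

lemma delta_integrable2_W: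
  "delta_integrable2 T1 T2 a b c d \<phi> \<longleftrightarrow> integrable MM (\<lambda>p. W a b c d p * \<phi> (fst p) (snd p))"
  unfolding delta_integrable2_def set_integrable_def W_eq
  by (auto simp: case_prod_unfold)

definition rect_integrable :: "(real \<Rightarrow> real \<Rightarrow> real) \<Rightarrow> bool" where
  "rect_integrable \<phi> \<longleftrightarrow> (\<forall>a\<in>T1. \<forall>b\<in>T1. \<forall>c\<in>T2. \<forall>d\<in>T2. delta_integrable2 T1 T2 a b c d \<phi>)"

lemma rect_integrableD:
  assumes "rect_integrable \<phi>" "a \<in> T1" "b \<in> T1" "c \<in> T2" "d \<in> T2"
  shows "integrable MM (\<lambda>p. W a b c d p * \<phi> (fst p) (snd p))"
  using assms unfolding rect_integrable_def delta_integrable2_W by blast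

lemma delta_integral2_add:
  assumes "rect_integrable \<phi>" "a \<in> T1" "b \<in> T1" "e \<in> T1" "c \<in> T2" "d \<in> T2" "k \<in> T2"
  shows "delta_integral2 T1 T2 a b c d \<phi> + delta_integral2 T1 T2 b e c d \<phi> = delta_integral2 T1 T2 a e c d \<phi>"
    and "delta_integral2 T1 T2 a b c d \<phi> + delta_integral2 T1 T2 a b d k \<phi> = delta_integral2 T1 T2 a b c k \<phi>"
proof -
  note I = rect_integrableD[OF assms(1)]
  have 1: "W a b c d p * x + W b e c d p * x = W a e c d p * x" for p x
    unfolding W_def ori_add[of a b "fst p" e, symmetric] by (simp add: algebra_simps)
  have 2: "W a b c d p * x + W a b d k p * x = W a b c k p * x" for p x
    unfolding W_def ori_add[of c d "snd p" k, symmetric] by (simp add: algebra_simps)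
  show "delta_integral2 T1 T2 a b c d \<phi> + delta_integral2 T1 T2 b e c d \<phi> = delta_integral2 T1 T2 a e c d \<phi>"
    unfolding delta_integral2_W using assms by (subst Bochner_Integration.integral_add[symmetric]) (auto intro!: I simp: 1)
  show "delta_integral2 T1 T2 a b c d \<phi> + delta_integral2 T1 T2 a b d k \<phi> = delta_integral2 T1 T2 a b c k \<phi>"
    unfolding delta_integral2_W using assms by (subst Bochner_Integration.integral_add[symmetric]) (auto intro!: I simp: 2)
qed

lemma delta_integral2_degenerate:
  "delta_integral2 T1 T2 a a c d \<phi> = 0" "delta_integral2 T1 T2 a b c c \<phi> = 0"
  by (simp_all add: delta_integral2_W W_def ori_def)

lemma abs_delta_integral2:
  assumes "\<And>s t. s \<in> T1 \<Longrightarrow> t \<in> T2 \<Longrightarrow> 0 \<le> \<phi> s t"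
  shows "\<bar>delta_integral2 T1 T2 a b c d \<phi>\<bar> = (LINT p:tsrect T1 T2 a b c d|MM. \<phi> (fst p) (snd p))"
proof -
  have "0 \<le> (LINT p:tsrect T1 T2 a b c d|MM. \<phi> (fst p) (snd p))"
    unfolding set_lebesgue_integral_def
    by (intro Bochner_Integration.integral_nonneg) (auto simp: indicator_def tsrect_def assms)
  then show ?thesis unfolding delta_integral2_def by (simp add: abs_mult case_prod_unfold)
qed

lemma abs_delta_integral2_mono:
  assumes "rect_integrable \<phi>" "rect_integrable \<psi>" "a \<in> T1" "b \<in> T1" "c \<in> T2" "d \<in> T2"
    and le: "\<And>s t. s \<in> T1 \<Longrightarrow> t \<in> T2 \<Longrightarrow> \<bar>\<phi> s t\<bar> \<le> \<psi> s t"
  shows "\<bar>delta_integral2 T1 T2 a b c d \<phi>\<bar> \<le> \<bar>delta_integral2 T1 T2 a b c d \<psi>\<bar>"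
proof -
  have \<psi>: "0 \<le> \<psi> s t" if "s \<in> T1" "t \<in> T2" for s t using le[OF that] by linarith
  have "\<bar>delta_integral2 T1 T2 a b c d \<phi>\<bar> \<le> (\<integral>p. \<bar>W a b c d p * \<phi> (fst p) (snd p)\<bar> \<partial>MM)"
    unfolding delta_integral2_W by (rule integral_abs_bound)
  also have "\<dots> \<le> (\<integral>p. \<bar>W a b c d p * \<psi> (fst p) (snd p)\<bar> \<partial>MM)"
  proof (intro integral_mono integrable_abs rect_integrableD assms(1-6))
    fix p
    show "\<bar>W a b c d p * \<phi> (fst p) (snd p)\<bar> \<le> \<bar>W a b c d p * \<psi> (fst p) (snd p)\<bar>"
      using le[of "fst p" "snd p"] by (auto simp: abs_mult abs_W indicator_def tsrect_def)
  qed
  also have "\<dots> = (LINT p:tsrect T1 T2 a b c d|MM. \<psi> (fst p) (snd p))"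
    unfolding set_lebesgue_integral_def
    by (intro Bochner_Integration.integral_cong) (auto simp: abs_mult abs_W indicator_def tsrect_def \<psi>)
  finally show ?thesis using \<psi> by (simp add: abs_delta_integral2)
qed

lemma abs_delta_integral2_le:
  assumes "rect_integrable \<phi>" "a \<in> T1" "b \<in> T1" "c \<in> T2" "d \<in> T2"
    and le: "\<And>s t. (s, t) \<in> tsrect T1 T2 a b c d \<Longrightarrow> \<bar>\<phi> s t\<bar> \<le> M"
  shows "\<bar>delta_integral2 T1 T2 a b c d \<phi>\<bar> \<le> M * (\<bar>b - a\<bar> * \<bar>d - c\<bar>)"
proof -
  let ?R = "tsrect T1 T2 a b c d"
  have fin: "integrable MM (indicator ?R :: _ \<Rightarrow> real)"
    using sets_borel_MM[OF tsrect_borel] emeasure_tsrect[OF assms(2-5)] by (intro integrable_real_indicator) auto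
  have "\<bar>delta_integral2 T1 T2 a b c d \<phi>\<bar> \<le> (\<integral>p. \<bar>W a b c d p * \<phi> (fst p) (snd p)\<bar> \<partial>MM)"
    unfolding delta_integral2_W by (rule integral_abs_bound)
  also have "\<dots> \<le> (\<integral>p. M * indicator ?R p \<partial>MM)"
  proof (intro integral_mono integrable_abs rect_integrableD assms(1-5) integrable_mult_right fin)
    fix p
    show "\<bar>W a b c d p * \<phi> (fst p) (snd p)\<bar> \<le> M * indicator ?R p"
      using le[of "fst p" "snd p"] by (auto simp: abs_mult abs_W indicator_def)
  qed
  also have "\<dots> = M * (\<bar>b - a\<bar> * \<bar>d - c\<bar>)"
    using emeasure_tsrect[OF assms(2-5)] by (simp add: measure_def)
  finally show ?thesis .
qed

text \<open>\<open>\<phi>\<close> is unspecified off the closed set \<open>T1 \<times> T2\<close>;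
  cutting it off there gives a Borel function on the plane.\<close>

lemma indicator_times_measurable:
  assumes "continuous_on (T1 \<times> T2) (\<lambda>(x, y). \<phi> x y :: real)"
  shows "(\<lambda>p. indicator (T1 \<times> T2) p * \<phi> (fst p) (snd p)) \<in> borel_measurable borel"
  using borel_measurable_continuous_on_indicator[OF borel_closed[OF closed_ts(3)] assms]
  unfolding case_prod_unfold real_scaleR_def .

lemma compact_rect: "compact (({a..b} \<inter> T1) \<times> ({c..d} \<inter> T2))"
  using closed_ts by (intro compact_Times compact_Int_closed) auto

lemma continuous_bounded_on_rect:
  assumes "continuous_on (T1 \<times> T2) (\<lambda>(x, y). \<phi> x y :: real)"
  obtains M where "\<And>s t. s \<in> {a..b} \<inter> T1 \<Longrightarrow> t \<in> {c..d} \<inter> T2 \<Longrightarrow> \<bar>\<phi> s t\<bar> \<le> M"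
proof -
  have "compact ((\<lambda>(x, y). \<phi> x y) ` (({a..b} \<inter> T1) \<times> ({c..d} \<inter> T2)))"
    by (intro compact_continuous_image compact_rect continuous_on_subset[OF assms]) auto
  from compact_imp_bounded[OF this] show thesis unfolding bounded_iff by (force intro: that)
qed

lemma W_measurable: "W a b c d \<in> borel_measurable borel"
proof -
  have eq: "W a b c d = (\<lambda>p. (if a \<le> b then 1 else - 1) * (if c \<le> d then 1 else - 1) * indicator (tsrect T1 T2 a b c d) p)"
    by (rule ext) (rule W_eq)
  show ?thesis
    unfolding eq using tsrect_borel by (intro borel_measurable_times borel_measurable_const borel_measurable_indicator)
qed

lemma W_times_indicator: "W a b c d p * indicator (T1 \<times> T2) p = W a b c d p"
  by (cases p) (auto simp: W_def indicator_def)

lemma continuous_W_measurable: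
  assumes "continuous_on (T1 \<times> T2) (\<lambda>(x, y). \<phi> x y)"
  shows "(\<lambda>p. W a b c d p * \<phi> (fst p) (snd p)) \<in> borel_measurable borel"
proof -
  have "(\<lambda>p. W a b c d p * (indicator (T1 \<times> T2) p * \<phi> (fst p) (snd p))) \<in> borel_measurable borel"
    by (intro borel_measurable_times W_measurable indicator_times_measurable assms)
  then show ?thesis unfolding mult.assoc[symmetric] W_times_indicator .
qed

lemma continuous_rect_integrable:
  assumes \<phi>: "continuous_on (T1 \<times> T2) (\<lambda>(x, y). \<phi> x y)"
  shows "rect_integrable \<phi>"
  unfolding rect_integrable_def delta_integrable2_W
proof (intro ballI)
  fix a b c d assume abcd: "a \<in> T1" "b \<in> T1" "c \<in> T2" "d \<in> T2"
  let ?R = "tsrect T1 T2 a b c d"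
  obtain M where M: "\<And>s t. s \<in> {min a b..max a b} \<inter> T1 \<Longrightarrow> t \<in> {min c d..max c d} \<inter> T2 \<Longrightarrow> \<bar>\<phi> s t\<bar> \<le> M"
    using continuous_bounded_on_rect[OF \<phi>, of "min a b" "max a b" "min c d" "max c d"] by blast
  have fin: "integrable MM (\<lambda>p. M * indicator ?R p)"
    using sets_borel_MM[OF tsrect_borel] emeasure_tsrect[OF abcd] by (intro integrable_mult_right integrable_real_indicator) auto
  show "integrable MM (\<lambda>p. W a b c d p * \<phi> (fst p) (snd p))"
  proof (rule Bochner_Integration.integrable_bound[OF fin])
    show "(\<lambda>p. W a b c d p * \<phi> (fst p) (snd p)) \<in> borel_measurable MM"
      by (intro borel_measurable_MM continuous_W_measurable \<phi>)
    show "AE p in MM. norm (W a b c d p * \<phi> (fst p) (snd p)) \<le> norm (M * indicator ?R p)"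
      using M by (intro AE_I2) (force simp: abs_mult abs_W indicator_def tsrect_def)
  qed
qed

lemma continuous_section:
  assumes "continuous_on (T1 \<times> T2) (\<lambda>(x, y). \<phi> x y :: 'b::topological_space)" "x \<in> T1"
  shows "continuous_on T2 (\<phi> x)"
proof -
  have "continuous_on T2 (\<lambda>y. (x, y))" by (intro continuous_intros)
  from continuous_on_compose2[OF assms(1) this] show ?thesis using assms(2) by auto
qed

lemma delta_integral2_Fubini:
  assumes \<phi>: "continuous_on (T1 \<times> T2) (\<lambda>(x, y). \<phi> x y)" and abcd: "a \<in> T1" "b \<in> T1" "c \<in> T2" "d \<in> T2"
  shows "delta_integral2 T1 T2 a b c d \<phi> = delta_integral1 T1 a b (\<lambda>s. delta_integral1 T2 c d (\<phi> s))"
proof -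
  let ?P = "delta_measure T1 \<Otimes>\<^sub>M delta_measure T2"
  let ?F = "\<lambda>p. W a b c d p * \<phi> (fst p) (snd p)"
  have "sets ?P = sets borel" unfolding borel_prod[symmetric] by (intro sets_pair_measure_cong) auto
  then have m: "?F \<in> borel_measurable ?P" using continuous_W_measurable[OF \<phi>] measurable_cong_sets by blast
  have "integrable MM ?F" by (rule rect_integrableD[OF continuous_rect_integrable[OF \<phi>] abcd])
  then have int: "integrable ?P ?F" unfolding delta_measure2_def integrable_completion[OF m] .
  have "delta_integral2 T1 T2 a b c d \<phi> = (\<integral>p. ?F p \<partial>?P)"
    unfolding delta_integral2_W delta_measure2_def by (rule integral_completion[OF m])
  also have "\<dots> = (\<integral>s. (\<integral>t. ?F (s, t) \<partial>delta_measure T2) \<partial>delta_measure T1)"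
    by (rule MP.integral_fst'[OF int, symmetric])
  also have "\<dots> = delta_integral1 T1 a b (\<lambda>s. delta_integral1 T2 c d (\<phi> s))"
    unfolding delta_integral1_def W_def
    by (intro Bochner_Integration.integral_cong refl, subst integral_mult_right_zero[symmetric]) (simp add: mult.assoc)
  finally show ?thesis .
qed

text \<open>Dominated convergence; a convergent sequence of parameters is bounded, so the integrands
  stay over one compact rectangle. This continuity is what the outer differentiation
  requires.\<close>

lemma continuous_delta_integral1:
  assumes \<phi>: "continuous_on (T1 \<times> T2) (\<lambda>(x, y). \<phi> x y)" and cd: "c \<in> T2" "d \<in> T2"
  shows "continuous_on T1 (\<lambda>s. delta_integral1 T2 c d (\<phi> s))"
proof (rule continuous_on_sequentiallyI)
  fix u a assume u: "\<forall>n. u n \<in> T1" "a \<in> T1" "u \<longlonglongrightarrow> a"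
  have "bounded (range u)" using u(3) by (rule convergent_imp_bounded)
  then obtain k where k: "\<And>n. \<bar>u n\<bar> \<le> k" by (auto simp: bounded_iff)
  obtain M where M: "\<And>s t. s \<in> {- k..k} \<inter> T1 \<Longrightarrow> t \<in> {min c d..max c d} \<inter> T2 \<Longrightarrow> \<bar>\<phi> s t\<bar> \<le> M"
    using continuous_bounded_on_rect[OF \<phi>, of "- k" k "min c d" "max c d"] by blast
  show "(\<lambda>n. delta_integral1 T2 c d (\<phi> (u n))) \<longlonglongrightarrow> delta_integral1 T2 c d (\<phi> a)"
    unfolding delta_integral1_def
  proof (rule integral_dominated_convergence[where w = "\<lambda>t. \<bar>indicator T2 t * ori c d t * M\<bar>"])
    show "integrable (delta_measure T2) (\<lambda>t. \<bar>indicator T2 t * ori c d t * M\<bar>)"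
      using cd ts(2) by (intro integrable_abs continuous_delta_integrable1) auto
    show "(\<lambda>t. indicator T2 t * ori c d t * \<phi> a t) \<in> borel_measurable (delta_measure T2)"
      using continuous_delta_integrable1[OF ts(2) cd continuous_section[OF \<phi> u(2)]] by (rule borel_measurable_integrable)
    show "(\<lambda>t. indicator T2 t * ori c d t * \<phi> (u n) t) \<in> borel_measurable (delta_measure T2)" for n
      using continuous_delta_integrable1[OF ts(2) cd continuous_section[OF \<phi>]] u(1) by (intro borel_measurable_integrable) auto
    show "AE t in delta_measure T2. (\<lambda>n. indicator T2 t * ori c d t * \<phi> (u n) t) \<longlonglongrightarrow> indicator T2 t * ori c d t * \<phi> a t"
    proof (intro AE_I2)
      fix t
      show "(\<lambda>n. indicator T2 t * ori c d t * \<phi> (u n) t) \<longlonglongrightarrow> indicator T2 t * ori c d t * \<phi> a t"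
      proof (cases "t \<in> T2")
        case True
        have "(\<lambda>n. (u n, t)) \<longlonglongrightarrow> (a, t)" using u(3) by (intro tendsto_Pair tendsto_const)
        then have "(\<lambda>n. \<phi> (u n) t) \<longlonglongrightarrow> \<phi> a t"
          using continuous_on_tendsto_compose[OF \<phi>, of "\<lambda>n. (u n, t)" "(a, t)" sequentially] True u(1,2) by simp
        then show ?thesis by (intro tendsto_intros)
      qed simp
    qed
    show "AE t in delta_measure T2. norm (indicator T2 t * ori c d t * \<phi> (u n) t) \<le> \<bar>indicator T2 t * ori c d t * M\<bar>" for n
    proof (intro AE_I2)
      fix t
      show "norm (indicator T2 t * ori c d t * \<phi> (u n) t) \<le> \<bar>indicator T2 t * ori c d t * M\<bar>"
        using M[of "u n" t] k[of n] u(1) by (auto simp: abs_mult abs_ori indicator_def abs_le_iff)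
    qed
  qed
qed

end

section \<open>The integral operator\<close>

locale weak_problem = time_scales T1 T2 for T1 T2 :: "real set" +
  fixes G h :: "real \<Rightarrow> real \<Rightarrow> real \<Rightarrow> real"
    and g0 :: "real \<Rightarrow> real \<Rightarrow> real"
    and f :: "real \<Rightarrow> real \<Rightarrow> 'a::banach \<Rightarrow> 'a"
  assumes zero: "0 \<in> T1" "0 \<in> T2"
    and G_nonneg: "\<And>x y r. x \<in> T1 \<Longrightarrow> y \<in> T2 \<Longrightarrow> r \<ge> 0 \<Longrightarrow> G x y r \<ge> 0"
    and G_cont: "continuous_on (T1 \<times> T2 \<times> {0..}) (\<lambda>(x, y, r). G x y r)"
    and G_mono: "\<And>x y. x \<in> T1 \<Longrightarrow> y \<in> T2 \<Longrightarrow> mono_on {0..} (G x y)"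
    and g0_nonneg: "\<And>x y. x \<in> T1 \<Longrightarrow> y \<in> T2 \<Longrightarrow> g0 x y \<ge> 0"
    and g0_bdd: "locally_bounded2 T1 T2 g0"
    and g0_sol: "majorant_solution T1 T2 G g0"
    and h_nonneg: "\<And>x y r. x \<in> T1 \<Longrightarrow> y \<in> T2 \<Longrightarrow> r \<ge> 0 \<Longrightarrow> h x y r \<ge> 0"
    and h_cont: "continuous_on (T1 \<times> T2 \<times> {0..}) (\<lambda>(x, y, r). h x y r)"
    and h_unique: "\<And>u. continuous_on (T1 \<times> T2) (\<lambda>(x, y). u x y) \<Longrightarrow>
          (\<forall>x\<in>T1. \<forall>y\<in>T2. u x y \<ge> 0) \<Longrightarrow> minorant_solution T1 T2 h u \<Longrightarrow> u 0 0 = 0 \<Longrightarrow>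
          (\<forall>x\<in>T1. \<forall>y\<in>T2. u x y = 0)"
    and C1: "\<And>x y u l. x \<in> T1 \<Longrightarrow> y \<in> T2 \<Longrightarrow> weakly_tendsto u l \<Longrightarrow>
          weakly_tendsto (\<lambda>n. f x y (u n)) (f x y l)"
    and C2: "\<And>z. strongly_AC2 T1 T2 z \<Longrightarrow> weakly_continuous_on2 T1 T2 (\<lambda>x y. f x y (z x y))"
    and C3: "\<And>x y u. x \<in> T1 \<Longrightarrow> y \<in> T2 \<Longrightarrow> norm (f x y u) \<le> G x y (norm u)"
    and C4: "\<And>W Ix Iy x y. W \<subseteq> B_set T1 T2 G g0 \<Longrightarrow> Ix \<subseteq> T1 \<Longrightarrow> Iy \<subseteq> T2 \<Longrightarrow>
          value_set W Ix Iy \<noteq> {} \<Longrightarrow> bounded (value_set W Ix Iy) \<Longrightarrow>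
          bounded {f s t u | s t u. s \<in> Ix \<and> t \<in> Iy \<and> u \<in> value_set W Ix Iy} \<Longrightarrow>
          x \<in> Ix \<Longrightarrow> y \<in> Iy \<Longrightarrow>
          deblasi {f s t u | s t u. s \<in> Ix \<and> t \<in> Iy \<and> u \<in> value_set W Ix Iy}
            \<le> h x y (deblasi (value_set W Ix Iy))"
begin

abbreviation g :: "real \<Rightarrow> real \<Rightarrow> real" where
  "g \<equiv> \<lambda>s t. G s t (g0 s t)"

abbreviation D :: "real \<Rightarrow> real \<Rightarrow> real \<Rightarrow> real \<Rightarrow> (real \<Rightarrow> real \<Rightarrow> real) \<Rightarrow> real" where
  "D \<equiv> delta_integral2 T1 T2"

section \<open>Bounds on compact rectangles supplied by the majorant\<close>

lemma g0_bounded_on_rect: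
  obtains M where "M \<ge> 0" "\<And>s t. s \<in> {a..b} \<inter> T1 \<Longrightarrow> t \<in> {c..d} \<inter> T2 \<Longrightarrow> g0 s t \<le> M"
proof -
  let ?Q = "({a..b} \<inter> T1) \<times> ({c..d} \<inter> T2)"
  have "\<forall>p\<in>?Q. \<exists>\<delta>>0. \<exists>M. \<forall>q\<in>ball p \<delta> \<inter> T1 \<times> T2. g0 (fst q) (snd q) \<le> M"
  proof
    fix p assume "p \<in> ?Q"
    then have "p \<in> T1 \<times> T2" by auto
    then obtain \<delta> where "\<delta> > 0" "bounded ((\<lambda>(s, t). g0 s t) ` (ball p \<delta> \<inter> T1 \<times> T2))"
      using g0_bdd unfolding locally_bounded2_def by blast
    then obtain M where M: "\<forall>x\<in>(\<lambda>(s, t). g0 s t) ` (ball p \<delta> \<inter> T1 \<times> T2). norm x \<le> M" unfolding bounded_iff by blast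
    have "g0 (fst q) (snd q) \<le> M" if "q \<in> ball p \<delta> \<inter> T1 \<times> T2" for q
      using M that by (force simp: case_prod_unfold)
    then show "\<exists>\<delta>>0. \<exists>M. \<forall>q\<in>ball p \<delta> \<inter> T1 \<times> T2. g0 (fst q) (snd q) \<le> M" using \<open>\<delta> > 0\<close> by blast
  qed
  from bchoice[OF this] obtain \<delta> where
    \<delta>: "\<forall>p\<in>?Q. \<delta> p > 0 \<and> (\<exists>M. \<forall>q\<in>ball p (\<delta> p) \<inter> T1 \<times> T2. g0 (fst q) (snd q) \<le> M)" by (rule exE)
  then have "\<forall>p\<in>?Q. \<exists>M. \<forall>q\<in>ball p (\<delta> p) \<inter> T1 \<times> T2. g0 (fst q) (snd q) \<le> M" by blast
  from bchoice[OF this] obtain M where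
    M: "\<forall>p\<in>?Q. \<forall>q\<in>ball p (\<delta> p) \<inter> T1 \<times> T2. g0 (fst q) (snd q) \<le> M p" by (rule exE)
  have cov: "?Q \<subseteq> (\<Union>p\<in>?Q. ball p (\<delta> p))" using \<delta> by force
  obtain P where P: "P \<subseteq> ?Q" "finite P" "?Q \<subseteq> (\<Union>p\<in>P. ball p (\<delta> p))"
    by (rule compactE_image[OF compact_rect _ cov]) auto
  show thesis
  proof (rule that[of "\<Sum>p\<in>P. \<bar>M p\<bar>"])
    fix s t assume st: "s \<in> {a..b} \<inter> T1" "t \<in> {c..d} \<inter> T2"
    then obtain p where p: "p \<in> P" "(s, t) \<in> ball p (\<delta> p)" using P(3) by blast
    have "p \<in> ?Q" "(s, t) \<in> ball p (\<delta> p) \<inter> T1 \<times> T2" using p P(1) st by auto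
    from M[rule_format, OF this] have "g0 s t \<le> M p" by simp
    also have "\<dots> \<le> \<bar>M p\<bar>" by simp
    also have "\<dots> \<le> (\<Sum>p\<in>P. \<bar>M p\<bar>)" using P(2) p(1) by (intro member_le_sum) auto
    finally show "g0 s t \<le> (\<Sum>p\<in>P. \<bar>M p\<bar>)" .
  qed (simp add: sum_nonneg)
qed

lemma G_bounded_on_rect:
  obtains M where "M \<ge> 0" "\<And>s t r. s \<in> {a..b} \<inter> T1 \<Longrightarrow> t \<in> {c..d} \<inter> T2 \<Longrightarrow> 0 \<le> r \<Longrightarrow> r \<le> R \<Longrightarrow> G s t r \<le> M"
proof -
  have "compact (({a..b} \<inter> T1) \<times> ({c..d} \<inter> T2) \<times> {0..R})"
    using closed_ts by (intro compact_Times compact_Int_closed) auto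
  then have "compact ((\<lambda>(x, y, r). G x y r) ` (({a..b} \<inter> T1) \<times> ({c..d} \<inter> T2) \<times> {0..R}))"
    by (intro compact_continuous_image continuous_on_subset[OF G_cont]) auto
  from compact_imp_bounded[OF this] obtain M where M: "\<And>y. y \<in> (\<lambda>(x, y, r). G x y r) ` (({a..b} \<inter> T1) \<times> ({c..d} \<inter> T2) \<times> {0..R}) \<Longrightarrow> norm y \<le> M"
    unfolding bounded_iff by blast
  have "G s t r \<le> \<bar>M\<bar>" if "s \<in> {a..b} \<inter> T1" "t \<in> {c..d} \<inter> T2" "0 \<le> r" "r \<le> R" for s t r
  proof -
    have "G s t r \<in> (\<lambda>(x, y, r). G x y r) ` (({a..b} \<inter> T1) \<times> ({c..d} \<inter> T2) \<times> {0..R})"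
      using that by force
    from M[OF this] show ?thesis by simp
  qed
  then show thesis using that[of "\<bar>M\<bar>"] by simp
qed

lemma g_nonneg: "s \<in> T1 \<Longrightarrow> t \<in> T2 \<Longrightarrow> 0 \<le> g s t"
  by (intro G_nonneg g0_nonneg)

lemma g_bounded_on_rect:
  obtains M where "M \<ge> 0" "\<And>s t. s \<in> {a..b} \<inter> T1 \<Longrightarrow> t \<in> {c..d} \<inter> T2 \<Longrightarrow> \<bar>g s t\<bar> \<le> M"
proof -
  obtain R where R: "R \<ge> 0" "\<And>s t. s \<in> {a..b} \<inter> T1 \<Longrightarrow> t \<in> {c..d} \<inter> T2 \<Longrightarrow> g0 s t \<le> R"
    using g0_bounded_on_rect[of a b c d] by blast
  obtain M where "M \<ge> 0" "\<And>s t r. s \<in> {a..b} \<inter> T1 \<Longrightarrow> t \<in> {c..d} \<inter> T2 \<Longrightarrow> 0 \<le> r \<Longrightarrow> r \<le> R \<Longrightarrow> G s t r \<le> M"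
    using G_bounded_on_rect[of a b c d R] by blast
  then show thesis using R g0_nonneg g_nonneg by (intro that[of M]) auto
qed

text \<open>Measurability of \<open>g0\<close> is not assumed; integrability comes from
  \<open>majorant_solution\<close>, which covers only rectangles with a corner at the origin. The
  weight of a general rectangle is an alternating sum of four such weights.\<close>

lemma g_rect_integrable: "rect_integrable g"
  unfolding rect_integrable_def delta_integrable2_W
proof (intro ballI)
  fix a b c d assume abcd: "a \<in> T1" "b \<in> T1" "c \<in> T2" "d \<in> T2"
  have I: "integrable MM (\<lambda>p. W 0 x 0 y p * g (fst p) (snd p))" if "x \<in> T1" "y \<in> T2" for x y
    using g0_sol that unfolding majorant_solution_def delta_integrable2_W by blast
  have "W a b c d p * k = W 0 b 0 d p * k - W 0 a 0 d p * k - W 0 b 0 c p * k + W 0 a 0 c p * k" for p k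
    unfolding W_def ori_def by (simp add: algebra_simps)
  then show "integrable MM (\<lambda>p. W a b c d p * g (fst p) (snd p))"
    using I abcd by simp
qed

lemma g0_majorant: "x \<in> T1 \<Longrightarrow> y \<in> T2 \<Longrightarrow> \<bar>D 0 x 0 y g\<bar> \<le> g0 x y"
  using g0_sol unfolding majorant_solution_def by blast

text \<open>\<open>g\<close> is bounded on the square, and the delta measure of a rectangle with
  corners in the time scales is its ordinary area.\<close>

lemma g_rect_Lipschitz:
  obtains L where "L \<ge> 0" "\<And>x1 x2 y1 y2. x1 \<in> {- k..k} \<inter> T1 \<Longrightarrow> x2 \<in> {- k..k} \<inter> T1 \<Longrightarrow>
      y1 \<in> {- k..k} \<inter> T2 \<Longrightarrow> y2 \<in> {- k..k} \<inter> T2 \<Longrightarrow> \<bar>D x1 x2 y1 y2 g\<bar> \<le> L * (\<bar>x2 - x1\<bar> * \<bar>y2 - y1\<bar>)"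
proof -
  obtain M where M: "M \<ge> 0" "\<And>s t. s \<in> {- k..k} \<inter> T1 \<Longrightarrow> t \<in> {- k..k} \<inter> T2 \<Longrightarrow> \<bar>g s t\<bar> \<le> M"
    using g_bounded_on_rect[of "- k" k "- k" k] by blast
  show thesis
    by (rule that[OF M(1)], intro abs_delta_integral2_le g_rect_integrable)
       (auto simp: tsrect_def min_def max_def intro!: M(2) split: if_splits)
qed

lemma constant_strongly_AC2: "strongly_AC2 T1 T2 (\<lambda>x y. c :: 'a)"
proof -
  have "(0::real) < 1" by simp
  then show ?thesis unfolding strongly_AC2_def strongly_AC_rect_def strongly_AC_on_def
    by (auto simp: case_prod_unfold)
qed

text \<open>\<open>S\<close> is closed under \<open>f\<close> at countably many dense points of
  \<open>T1 \<times> T2\<close>. Weak continuity in the point, from \<open>C2\<close> for constant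
  functions, reaches the other points, and \<open>C1\<close> reaches the closure of
  \<open>S\<close>; closed subspaces contain the weak limits that arise.\<close>

lemma separable_invariant_subspace:
  obtains S :: "'a set" where "countable S" "subspace (closure S)"
    "\<And>s t u. s \<in> T1 \<Longrightarrow> t \<in> T2 \<Longrightarrow> u \<in> closure S \<Longrightarrow> f s t u \<in> closure S"
proof -
  have "closure (\<rat> \<times> \<rat>) = (UNIV :: (real \<times> real) set)" by (simp add: closure_Times Rats_closure_real)
  then have dense: "T1 \<times> T2 \<subseteq> closure (\<rat> \<times> \<rat>)" by simp
  have cnt: "countable (\<rat> \<times> \<rat> :: (real \<times> real) set)" by (intro countable_SIGMA countable_rat)
  obtain Q where Q: "countable Q" "Q \<subseteq> T1 \<times> T2" "T1 \<times> T2 \<subseteq> closure Q"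
    by (rule separable_subset[OF cnt dense])
  have "Q \<noteq> {}" using Q(3) zero by auto
  then have Q_rng: "range (from_nat_into Q) = Q" using Q(1) by (rule range_from_nat_into)
  obtain S :: "'a set" where S: "countable S" "subspace (closure S)"
    and fS: "\<And>n a. a \<in> S \<Longrightarrow> f (fst (from_nat_into Q n)) (snd (from_nat_into Q n)) a \<in> S"
    by (rule countable_subspace_hull[of "{}" "\<lambda>n. f (fst (from_nat_into Q n)) (snd (from_nat_into Q n))"]) auto
  have f1: "f s t u \<in> closure S" if st: "s \<in> T1" "t \<in> T2" and u: "u \<in> S" for s t u
  proof -
    have "(s, t) \<in> closure Q" using Q(3) st by auto
    then obtain q where q: "\<And>n. q n \<in> Q" "q \<longlonglongrightarrow> (s, t)" unfolding closure_sequential by blast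
    have "f (fst (q n)) (snd (q n)) u \<in> S" for n using q(1)[of n] Q_rng fS[OF u] by (metis imageE)
    then have mem: "f (fst (q n)) (snd (q n)) u \<in> closure S" for n using closure_subset by blast
    have "weakly_tendsto (\<lambda>n. f (fst (q n)) (snd (q n)) u) (f s t u)"
      unfolding weakly_tendsto_def
    proof
      fix \<xi> :: "'a \<Rightarrow>\<^sub>L real"
      have "continuous_on (T1 \<times> T2) (\<lambda>(x, y). \<xi> (f x y u))"
        using C2[OF constant_strongly_AC2[of u]] unfolding weakly_continuous_on2_def by blast
      moreover have "q n \<in> T1 \<times> T2" for n using q(1) Q(2) by blast
      ultimately show "(\<lambda>n. \<xi> (f (fst (q n)) (snd (q n)) u)) \<longlonglongrightarrow> \<xi> (f s t u)"
        using continuous_on_tendsto_compose[of "T1 \<times> T2" "\<lambda>(x, y). \<xi> (f x y u)", OF _ q(2)] st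
        by (simp add: case_prod_unfold)
    qed
    from closed_subspace_weakly_closed[OF S(2) closed_closure this mem] show ?thesis .
  qed
  show thesis
  proof (rule that[OF S])
    fix s t u assume st: "s \<in> T1" "t \<in> T2" and "u \<in> closure S"
    then obtain v where v: "\<And>n. v n \<in> S" "v \<longlonglongrightarrow> u" unfolding closure_sequential by blast
    have "weakly_tendsto (\<lambda>n. f s t (v n)) (f s t u)" by (intro C1 st tendsto_imp_weakly_tendsto v)
    from closed_subspace_weakly_closed[OF S(2) closed_closure this f1[OF st v(1)]] show "f s t u \<in> closure S" .
  qed
qed

end

locale weak_problem_separable = weak_problem T1 T2 G h g0 f
  for T1 T2 G h g0 and f :: "real \<Rightarrow> real \<Rightarrow> 'a::banach \<Rightarrow> 'a" +
  fixes S :: "'a set"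
  assumes S: "countable S" "subspace (closure S)"
    and f_closure: "\<And>s t u. s \<in> T1 \<Longrightarrow> t \<in> T2 \<Longrightarrow> u \<in> closure S \<Longrightarrow> f s t u \<in> closure S"
begin

text \<open>
  The bound on rectangular increments is what makes these functions strongly absolutely
  continuous; all three bounds survive convex combinations and pointwise weak limits.
\<close>

definition admissible :: "(real \<Rightarrow> real \<Rightarrow> 'a) \<Rightarrow> bool" where
  "admissible z \<longleftrightarrow>
     (\<forall>x\<in>T1. \<forall>y\<in>T2. z x y \<in> closure S \<and> norm (z x y) \<le> g0 x y) \<and>
     (\<forall>x1\<in>T1. \<forall>x2\<in>T1. \<forall>y1\<in>T2. \<forall>y2\<in>T2.
        norm (z x1 y1 - z x2 y2) \<le> \<bar>D 0 x2 y1 y2 g\<bar> + \<bar>D x1 x2 0 y1 g\<bar> \<and>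
        norm (z x2 y2 - z x2 y1 - z x1 y2 + z x1 y1) \<le> \<bar>D x1 x2 y1 y2 g\<bar>)"

lemma admissibleD:
  assumes "admissible z" "x1 \<in> T1" "x2 \<in> T1" "y1 \<in> T2" "y2 \<in> T2"
  shows "z x1 y1 \<in> closure S" "norm (z x1 y1) \<le> g0 x1 y1"
    "norm (z x1 y1 - z x2 y2) \<le> \<bar>D 0 x2 y1 y2 g\<bar> + \<bar>D x1 x2 0 y1 g\<bar>"
    "norm (z x2 y2 - z x2 y1 - z x1 y2 + z x1 y1) \<le> \<bar>D x1 x2 y1 y2 g\<bar>"
  using assms unfolding admissible_def by blast+

text \<open>One constant serves all admissible functions on the square. This uniformity gives
  continuity of \<open>v\<close>, fineness of the cells independent of the function, and convergence
  off a dense set.\<close>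

lemma admissible_Lipschitz:
  obtains L where "L \<ge> 0"
    "\<And>z x1 x2 y1 y2. admissible z \<Longrightarrow> x1 \<in> {- k..k} \<inter> T1 \<Longrightarrow> x2 \<in> {- k..k} \<inter> T1 \<Longrightarrow>
      y1 \<in> {- k..k} \<inter> T2 \<Longrightarrow> y2 \<in> {- k..k} \<inter> T2 \<Longrightarrow> norm (z x1 y1 - z x2 y2) \<le> L * (\<bar>x2 - x1\<bar> + \<bar>y2 - y1\<bar>)"
    "\<And>z x1 x2 y1 y2. admissible z \<Longrightarrow> x1 \<in> {- k..k} \<inter> T1 \<Longrightarrow> x2 \<in> {- k..k} \<inter> T1 \<Longrightarrow>
      y1 \<in> {- k..k} \<inter> T2 \<Longrightarrow> y2 \<in> {- k..k} \<inter> T2 \<Longrightarrow>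
      norm (z x2 y2 - z x2 y1 - z x1 y2 + z x1 y1) \<le> L * (\<bar>x2 - x1\<bar> * \<bar>y2 - y1\<bar>)"
proof -
  obtain L where L: "L \<ge> 0" "\<And>x1 x2 y1 y2. x1 \<in> {- k..k} \<inter> T1 \<Longrightarrow> x2 \<in> {- k..k} \<inter> T1 \<Longrightarrow>
      y1 \<in> {- k..k} \<inter> T2 \<Longrightarrow> y2 \<in> {- k..k} \<inter> T2 \<Longrightarrow> \<bar>D x1 x2 y1 y2 g\<bar> \<le> L * (\<bar>x2 - x1\<bar> * \<bar>y2 - y1\<bar>)"
    using g_rect_Lipschitz[of k] by blast
  show thesis
  proof (rule that[of "L * (\<bar>k\<bar> + 1)"])
    show "L * (\<bar>k\<bar> + 1) \<ge> 0" using L(1) by simp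
    fix z x1 x2 y1 y2
    assume z: "admissible z" and xy: "x1 \<in> {- k..k} \<inter> T1" "x2 \<in> {- k..k} \<inter> T1" "y1 \<in> {- k..k} \<inter> T2" "y2 \<in> {- k..k} \<inter> T2"
    have 0: "0 \<in> {- k..k} \<inter> T1" "0 \<in> {- k..k} \<inter> T2" using zero xy by auto
    \<comment> \<open>The strips in the increment bound reach to the axes, so one side of each is
      \<open>\<bar>x2\<bar>\<close> or \<open>\<bar>y1\<bar>\<close>.\<close>
    have k: "\<bar>x2\<bar> \<le> \<bar>k\<bar> + 1" "\<bar>y1\<bar> \<le> \<bar>k\<bar> + 1" using xy by auto
    have "norm (z x1 y1 - z x2 y2) \<le> \<bar>D 0 x2 y1 y2 g\<bar> + \<bar>D x1 x2 0 y1 g\<bar>"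
      using xy by (intro admissibleD[OF z]) auto
    also have "\<dots> \<le> L * (\<bar>x2\<bar> * \<bar>y2 - y1\<bar>) + L * (\<bar>x2 - x1\<bar> * \<bar>y1\<bar>)"
      using L(2)[OF 0(1) xy(2-4)] L(2)[OF xy(1,2) 0(2) xy(3)] by simp
    also have "\<dots> \<le> L * ((\<bar>k\<bar> + 1) * \<bar>y2 - y1\<bar>) + L * (\<bar>x2 - x1\<bar> * (\<bar>k\<bar> + 1))"
      using L(1) k by (intro add_mono mult_left_mono mult_right_mono) auto
    finally show "norm (z x1 y1 - z x2 y2) \<le> L * (\<bar>k\<bar> + 1) * (\<bar>x2 - x1\<bar> + \<bar>y2 - y1\<bar>)"
      by (simp add: algebra_simps)
    have "norm (z x2 y2 - z x2 y1 - z x1 y2 + z x1 y1) \<le> \<bar>D x1 x2 y1 y2 g\<bar>"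
      using xy by (intro admissibleD[OF z]) auto
    also have "\<dots> \<le> L * (\<bar>x2 - x1\<bar> * \<bar>y2 - y1\<bar>)" by (rule L(2)[OF xy])
    also have "\<dots> \<le> L * (\<bar>k\<bar> + 1) * (\<bar>x2 - x1\<bar> * \<bar>y2 - y1\<bar>)"
      using L(1) by (intro mult_right_mono) (auto simp: algebra_simps)
    finally show "norm (z x2 y2 - z x2 y1 - z x1 y2 + z x1 y1) \<le> L * (\<bar>k\<bar> + 1) * (\<bar>x2 - x1\<bar> * \<bar>y2 - y1\<bar>)" .
  qed
qed

lemma admissible_continuous:
  assumes z: "admissible z"
  shows "continuous_on (T1 \<times> T2) (\<lambda>(x, y). z x y)"
proof (rule continuous_on_sequentiallyI)
  fix u a assume u: "\<forall>n. u n \<in> T1 \<times> T2" "a \<in> T1 \<times> T2" "u \<longlonglongrightarrow> a"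
  have "bounded (insert a (range u))" using u(3) convergent_imp_bounded bounded_insert by blast
  then obtain k where k: "\<And>p. p \<in> insert a (range u) \<Longrightarrow> norm p \<le> k" unfolding bounded_iff by blast
  have coord: "\<bar>fst p\<bar> \<le> k" "\<bar>snd p\<bar> \<le> k" if "p \<in> insert a (range u)" for p
    using k[OF that] norm_fst_le[of "fst p" "snd p"] norm_snd_le[of "snd p" "fst p"] by auto
  obtain L where L: "\<And>x1 x2 y1 y2. x1 \<in> {- k..k} \<inter> T1 \<Longrightarrow> x2 \<in> {- k..k} \<inter> T1 \<Longrightarrow>
      y1 \<in> {- k..k} \<inter> T2 \<Longrightarrow> y2 \<in> {- k..k} \<inter> T2 \<Longrightarrow> norm (z x1 y1 - z x2 y2) \<le> L * (\<bar>x2 - x1\<bar> + \<bar>y2 - y1\<bar>)"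
  proof (rule admissible_Lipschitz[of k])
    fix L :: real
    assume "\<And>z x1 x2 y1 y2. admissible z \<Longrightarrow> x1 \<in> {- k..k} \<inter> T1 \<Longrightarrow> x2 \<in> {- k..k} \<inter> T1 \<Longrightarrow>
      y1 \<in> {- k..k} \<inter> T2 \<Longrightarrow> y2 \<in> {- k..k} \<inter> T2 \<Longrightarrow> norm (z x1 y1 - z x2 y2) \<le> L * (\<bar>x2 - x1\<bar> + \<bar>y2 - y1\<bar>)"
    then show thesis by (rule that[OF _]) (rule z)
  qed
  have "(\<lambda>n. z (fst (u n)) (snd (u n)) - z (fst a) (snd a)) \<longlonglongrightarrow> 0"
  proof (rule Lim_null_comparison[OF always_eventually], rule allI)
    fix n
    have "u n \<in> insert a (range u)" "a \<in> insert a (range u)" by auto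
    from coord[OF this(1)] coord[OF this(2)]
    have "\<bar>fst (u n)\<bar> \<le> k" "\<bar>snd (u n)\<bar> \<le> k" "\<bar>fst a\<bar> \<le> k" "\<bar>snd a\<bar> \<le> k" by auto
    then have "fst (u n) \<in> {- k..k} \<inter> T1" "fst a \<in> {- k..k} \<inter> T1" "snd (u n) \<in> {- k..k} \<inter> T2" "snd a \<in> {- k..k} \<inter> T2"
      using u(1,2) by (auto simp: mem_Times_iff)
    then show "norm (z (fst (u n)) (snd (u n)) - z (fst a) (snd a))
        \<le> L * (\<bar>fst a - fst (u n)\<bar> + \<bar>snd a - snd (u n)\<bar>)" by (rule L)
  next
    have "(\<lambda>n. L * (\<bar>fst a - fst (u n)\<bar> + \<bar>snd a - snd (u n)\<bar>)) \<longlonglongrightarrow> L * (\<bar>fst a - fst a\<bar> + \<bar>snd a - snd a\<bar>)"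
      using u(3) by (intro tendsto_intros)
    then show "(\<lambda>n. L * (\<bar>fst a - fst (u n)\<bar> + \<bar>snd a - snd (u n)\<bar>)) \<longlonglongrightarrow> 0" by simp
  qed
  then show "(\<lambda>n. case u n of (x, y) \<Rightarrow> z x y) \<longlonglongrightarrow> (case a of (x, y) \<Rightarrow> z x y)"
    by (simp add: case_prod_unfold LIM_zero_iff)
qed

lemma admissible_B_set: "admissible z \<Longrightarrow> z \<in> B_set T1 T2 G g0"
  unfolding B_set_def using admissible_continuous by (auto dest: admissibleD)

lemma strongly_AC_on_Lipschitz:
  fixes v :: "real \<Rightarrow> 'a"
  assumes "L \<ge> 0" "\<And>s s'. s \<in> X \<Longrightarrow> s' \<in> X \<Longrightarrow> norm (v s' - v s) \<le> L * \<bar>s' - s\<bar>"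
  shows "strongly_AC_on X v"
  unfolding strongly_AC_on_def
proof (intro allI impI)
  fix \<epsilon> :: real assume "\<epsilon> > 0"
  have "(\<Sum>(s, s')\<in>P. norm (v s' - v s)) < \<epsilon>"
    if P: "\<forall>(s, s')\<in>P. s \<in> X \<and> s' \<in> X \<and> s < s'" and sum: "(\<Sum>(s, s')\<in>P. s' - s) < \<epsilon> / (L + 1)" for P
  proof -
    have "(\<Sum>(s, s')\<in>P. norm (v s' - v s)) \<le> (\<Sum>(s, s')\<in>P. L * (s' - s))"
      using P assms(2) by (intro sum_mono) (fastforce simp: abs_of_pos)
    also have "\<dots> = L * (\<Sum>(s, s')\<in>P. s' - s)" by (simp add: sum_distrib_left case_prod_unfold)
    also have "\<dots> \<le> L * (\<epsilon> / (L + 1))" using sum assms(1) by (intro mult_left_mono) auto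
    also have "\<dots> < \<epsilon>" using \<open>\<epsilon> > 0\<close> assms(1) by (simp add: field_simps)
    finally show ?thesis .
  qed
  then show "\<exists>\<delta>>0. \<forall>P. finite P \<longrightarrow> (\<forall>(s, s')\<in>P. s \<in> X \<and> s' \<in> X \<and> s < s') \<longrightarrow>
      disjoint_family_on (\<lambda>(s, s'). {s..<s'}) P \<longrightarrow> (\<Sum>(s, s')\<in>P. s' - s) < \<delta> \<longrightarrow> (\<Sum>(s, s')\<in>P. norm (v s' - v s)) < \<epsilon>"
    using \<open>\<epsilon> > 0\<close> assms(1) by (intro exI[of _ "\<epsilon> / (L + 1)"]) auto
qed

lemma strongly_AC_rect_Lipschitz:
  fixes z :: "real \<Rightarrow> real \<Rightarrow> 'a"
  assumes L: "L \<ge> 0"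
    and rect: "\<And>s s' t t'. s \<in> X \<Longrightarrow> s' \<in> X \<Longrightarrow> t \<in> Y \<Longrightarrow> t' \<in> Y \<Longrightarrow>
      norm (z s' t' - z s' t - z s t' + z s t) \<le> L * (\<bar>s' - s\<bar> * \<bar>t' - t\<bar>)"
    and sections: "\<forall>t\<in>Y. strongly_AC_on X (\<lambda>s. z s t)" "\<forall>s\<in>X. strongly_AC_on Y (z s)"
  shows "strongly_AC_rect X Y z"
  unfolding strongly_AC_rect_def
proof (rule conjI[OF _ conjI[OF sections]], intro allI impI)
  fix \<epsilon> :: real assume "\<epsilon> > 0"
  show "\<exists>\<delta>>0. \<forall>P. finite P \<longrightarrow>
      (\<forall>(s, s', t, t')\<in>P. s \<in> X \<and> s' \<in> X \<and> s < s' \<and> t \<in> Y \<and> t' \<in> Y \<and> t < t') \<longrightarrow>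
      disjoint_family_on (\<lambda>(s, s', t, t'). {s..<s'} \<times> {t..<t'}) P \<longrightarrow>
      (\<Sum>(s, s', t, t')\<in>P. (s' - s) * (t' - t)) < \<delta> \<longrightarrow>
      (\<Sum>(s, s', t, t')\<in>P. norm (z s' t' - z s' t - z s t' + z s t)) < \<epsilon>"
  proof (intro exI[of _ "\<epsilon> / (L + 1)"] conjI allI impI)
    show "\<epsilon> / (L + 1) > 0" using \<open>\<epsilon> > 0\<close> L by simp
    fix P :: "(real \<times> real \<times> real \<times> real) set"
    assume P: "\<forall>(s, s', t, t')\<in>P. s \<in> X \<and> s' \<in> X \<and> s < s' \<and> t \<in> Y \<and> t' \<in> Y \<and> t < t'"
      and sum: "(\<Sum>(s, s', t, t')\<in>P. (s' - s) * (t' - t)) < \<epsilon> / (L + 1)"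
    have "(\<Sum>(s, s', t, t')\<in>P. norm (z s' t' - z s' t - z s t' + z s t)) \<le> (\<Sum>(s, s', t, t')\<in>P. L * ((s' - s) * (t' - t)))"
    proof (rule sum_mono, clarify)
      fix s s' t t' assume "(s, s', t, t') \<in> P"
      with P have "s \<in> X" "s' \<in> X" "t \<in> Y" "t' \<in> Y" "s < s'" "t < t'" by blast+
      then show "norm (z s' t' - z s' t - z s t' + z s t) \<le> L * ((s' - s) * (t' - t))"
        using rect[of s s' t t'] by simp
    qed
    also have "\<dots> = L * (\<Sum>(s, s', t, t')\<in>P. (s' - s) * (t' - t))" by (simp add: sum_distrib_left case_prod_unfold)
    also have "\<dots> \<le> L * (\<epsilon> / (L + 1))" using sum L by (intro mult_left_mono) auto
    also have "\<dots> < \<epsilon>" using \<open>\<epsilon> > 0\<close> L by (simp add: field_simps)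
    finally show "(\<Sum>(s, s', t, t')\<in>P. norm (z s' t' - z s' t - z s t' + z s t)) < \<epsilon>" .
  qed
qed

text \<open>The point where \<open>C2\<close> becomes applicable: for rectangles a Lipschitz bound
  by area does what a Lipschitz bound does for intervals.\<close>

lemma admissible_strongly_AC2:
  assumes z: "admissible z"
  shows "strongly_AC2 T1 T2 z"
  unfolding strongly_AC2_def
proof (intro ballI)
  fix a b c d :: real
  define k where "k = \<bar>a\<bar> + \<bar>b\<bar> + \<bar>c\<bar> + \<bar>d\<bar>"
  have k: "{a..b} \<inter> T1 \<subseteq> {- k..k} \<inter> T1" "{c..d} \<inter> T2 \<subseteq> {- k..k} \<inter> T2" by (auto simp: k_def)
  obtain L where L: "L \<ge> 0"
    and lip: "\<And>x1 x2 y1 y2. x1 \<in> {- k..k} \<inter> T1 \<Longrightarrow> x2 \<in> {- k..k} \<inter> T1 \<Longrightarrow>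
      y1 \<in> {- k..k} \<inter> T2 \<Longrightarrow> y2 \<in> {- k..k} \<inter> T2 \<Longrightarrow> norm (z x1 y1 - z x2 y2) \<le> L * (\<bar>x2 - x1\<bar> + \<bar>y2 - y1\<bar>)"
    and rect: "\<And>x1 x2 y1 y2. x1 \<in> {- k..k} \<inter> T1 \<Longrightarrow> x2 \<in> {- k..k} \<inter> T1 \<Longrightarrow>
      y1 \<in> {- k..k} \<inter> T2 \<Longrightarrow> y2 \<in> {- k..k} \<inter> T2 \<Longrightarrow>
      norm (z x2 y2 - z x2 y1 - z x1 y2 + z x1 y1) \<le> L * (\<bar>x2 - x1\<bar> * \<bar>y2 - y1\<bar>)"
  proof (rule admissible_Lipschitz[of k])
    fix L :: real
    assume L: "L \<ge> 0" "\<And>z x1 x2 y1 y2. admissible z \<Longrightarrow> x1 \<in> {- k..k} \<inter> T1 \<Longrightarrow> x2 \<in> {- k..k} \<inter> T1 \<Longrightarrow>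
      y1 \<in> {- k..k} \<inter> T2 \<Longrightarrow> y2 \<in> {- k..k} \<inter> T2 \<Longrightarrow> norm (z x1 y1 - z x2 y2) \<le> L * (\<bar>x2 - x1\<bar> + \<bar>y2 - y1\<bar>)"
    "\<And>z x1 x2 y1 y2. admissible z \<Longrightarrow> x1 \<in> {- k..k} \<inter> T1 \<Longrightarrow> x2 \<in> {- k..k} \<inter> T1 \<Longrightarrow>
      y1 \<in> {- k..k} \<inter> T2 \<Longrightarrow> y2 \<in> {- k..k} \<inter> T2 \<Longrightarrow>
      norm (z x2 y2 - z x2 y1 - z x1 y2 + z x1 y1) \<le> L * (\<bar>x2 - x1\<bar> * \<bar>y2 - y1\<bar>)"
    show thesis by (rule that[OF L(1) L(2)[OF z] L(3)[OF z]])
  qed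
  show "strongly_AC_rect ({a..b} \<inter> T1) ({c..d} \<inter> T2) z"
  proof (rule strongly_AC_rect_Lipschitz[OF L])
    fix s s' t t' assume "s \<in> {a..b} \<inter> T1" "s' \<in> {a..b} \<inter> T1" "t \<in> {c..d} \<inter> T2" "t' \<in> {c..d} \<inter> T2"
    with k have "s \<in> {- k..k} \<inter> T1" "s' \<in> {- k..k} \<inter> T1" "t \<in> {- k..k} \<inter> T2" "t' \<in> {- k..k} \<inter> T2" by blast+
    then show "norm (z s' t' - z s' t - z s t' + z s t) \<le> L * (\<bar>s' - s\<bar> * \<bar>t' - t\<bar>)" by (rule rect)
  next
    show "\<forall>t\<in>{c..d} \<inter> T2. strongly_AC_on ({a..b} \<inter> T1) (\<lambda>s. z s t)"
    proof (intro ballI strongly_AC_on_Lipschitz[OF L])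
      fix t s s' assume "t \<in> {c..d} \<inter> T2" "s \<in> {a..b} \<inter> T1" "s' \<in> {a..b} \<inter> T1"
      with k have "s \<in> {- k..k} \<inter> T1" "s' \<in> {- k..k} \<inter> T1" "t \<in> {- k..k} \<inter> T2" by blast+
      from lip[OF this(2,1,3,3)] show "norm (z s' t - z s t) \<le> L * \<bar>s' - s\<bar>" by (simp add: abs_minus_commute)
    qed
    show "\<forall>s\<in>{a..b} \<inter> T1. strongly_AC_on ({c..d} \<inter> T2) (z s)"
    proof (intro ballI strongly_AC_on_Lipschitz[OF L])
      fix s t t' assume "s \<in> {a..b} \<inter> T1" "t \<in> {c..d} \<inter> T2" "t' \<in> {c..d} \<inter> T2"
      with k have "t \<in> {- k..k} \<inter> T2" "t' \<in> {- k..k} \<inter> T2" "s \<in> {- k..k} \<inter> T1" by blast+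
      from lip[OF this(3,3,2,1)] show "norm (z s t' - z s t) \<le> L * \<bar>t' - t\<bar>" by (simp add: abs_minus_commute)
    qed
  qed
qed

lemma admissible_weakly_continuous:
  fixes \<xi> :: "'a \<Rightarrow>\<^sub>L real"
  assumes "admissible z"
  shows "continuous_on (T1 \<times> T2) (\<lambda>(s, t). \<xi> (f s t (z s t)))"
  using C2[OF admissible_strongly_AC2[OF assms]] unfolding weakly_continuous_on2_def by blast

lemma admissible_f_bound:
  assumes "admissible z" "s \<in> T1" "t \<in> T2"
  shows "norm (f s t (z s t)) \<le> g s t"
proof -
  have "G s t (norm (z s t)) \<le> g s t"
    using mono_onD[OF G_mono[OF assms(2,3)], of "norm (z s t)" "g0 s t"] admissibleD(2)[OF assms(1)] assms g0_nonneg by auto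
  then show ?thesis using C3[OF assms(2,3), of "z s t"] by simp
qed

text \<open>Stated for Borel subsets of a rectangle, so that it serves both the whole domain of
  integration and the grid cells.\<close>

lemma pettis_f:
  assumes z: "admissible z" and R: "R \<in> sets borel" "R \<subseteq> tsrect T1 T2 a b c d" "R \<noteq> {}"
    and abcd: "a \<in> T1" "b \<in> T1" "c \<in> T2" "d \<in> T2"
  obtains e where "\<And>\<xi> :: 'a \<Rightarrow>\<^sub>L real. blinfun_apply \<xi> e = (LINT p:R|MM. \<xi> (f (fst p) (snd p) (z (fst p) (snd p))))"
    "\<And>\<epsilon>. \<epsilon> > 0 \<Longrightarrow> \<exists>w \<in> convex hull ((\<lambda>p. f (fst p) (snd p) (z (fst p) (snd p))) ` R). norm (e - measure MM R *\<^sub>R w) \<le> \<epsilon>"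
proof -
  have RT: "R \<subseteq> T1 \<times> T2" using R(2) by (auto simp: tsrect_def)
  obtain M where M: "\<And>s t. s \<in> {min a b..max a b} \<inter> T1 \<Longrightarrow> t \<in> {min c d..max c d} \<inter> T2 \<Longrightarrow> \<bar>g s t\<bar> \<le> M"
    by (rule g_bounded_on_rect[of "min a b" "max a b" "min c d" "max c d"]) (rule that)
  let ?g = "\<lambda>p. f (fst p) (snd p) (z (fst p) (snd p))"
  have Rm: "R \<in> sets MM" by (rule sets_borel_MM[OF R(1)])
  have fin: "emeasure MM R < \<infinity>"
    using emeasure_mono[OF R(2) sets_borel_MM[OF tsrect_borel]] emeasure_tsrect[OF abcd]
    by (metis ennreal_less_top infinity_ennreal_def le_less_trans)
  have im: "?g ` R \<subseteq> closure S" using RT f_closure admissibleD(1)[OF z] by fastforce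
  have meas: "(\<lambda>p. indicator R p *\<^sub>R \<xi> (?g p)) \<in> borel_measurable MM" for \<xi> :: "'a \<Rightarrow>\<^sub>L real"
  proof -
    have m: "(\<lambda>p. indicator R p * (indicator (T1 \<times> T2) p * \<xi> (?g p))) \<in> borel_measurable borel"
      by (intro borel_measurable_times borel_measurable_indicator R(1) indicator_times_measurable admissible_weakly_continuous z)
    have eq: "(\<lambda>p. indicator R p * (indicator (T1 \<times> T2) p * \<xi> (?g p))) = (\<lambda>p. indicator R p *\<^sub>R \<xi> (?g p))"
      using RT by (auto simp: indicator_def fun_eq_iff)
    show ?thesis by (rule borel_measurable_MM[OF m[unfolded eq]])
  qed
  have bdd: "norm (?g p) \<le> M" if "p \<in> R" for p
  proof -
    have "fst p \<in> {min a b..max a b} \<inter> T1" "snd p \<in> {min c d..max c d} \<inter> T2"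
      using that R(2) by (auto simp: tsrect_def)
    then show ?thesis using M[of "fst p" "snd p"] admissible_f_bound[OF z, of "fst p" "snd p"] by auto
  qed
  show thesis by (rule pettis_set_integral[OF Rm fin R(3) S(1) im meas bdd], assumption, rule that)
qed

text \<open>The oriented Pettis integral. For admissible \<open>z\<close> a vector with these scalar
  integrals exists, and since functionals separate points the choice is unique.\<close>

definition F :: "(real \<Rightarrow> real \<Rightarrow> 'a) \<Rightarrow> real \<Rightarrow> real \<Rightarrow> 'a" where
  "F z x y = (SOME e. \<forall>\<xi> :: 'a \<Rightarrow>\<^sub>L real. blinfun_apply \<xi> e = D 0 x 0 y (\<lambda>s t. \<xi> (f s t (z s t))))"

lemma F_eq:
  fixes \<xi> :: "'a \<Rightarrow>\<^sub>L real"
  assumes z: "admissible z" and xy: "x \<in> T1" "y \<in> T2"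
  shows "\<xi> (F z x y) = D 0 x 0 y (\<lambda>s t. \<xi> (f s t (z s t)))"
proof -
  let ?R = "tsrect T1 T2 0 x 0 y"
  have "\<exists>e. \<forall>\<xi> :: 'a \<Rightarrow>\<^sub>L real. blinfun_apply \<xi> e = D 0 x 0 y (\<lambda>s t. \<xi> (f s t (z s t)))"
  \<comment> \<open>An empty domain is split off because the mean value property is available for
    nonempty sets only.\<close>
  proof (cases "?R = {}")
    case True
    then show ?thesis by (intro exI[of _ 0]) (simp add: delta_integral2_def set_lebesgue_integral_def)
  next
    case False
    obtain e where "\<And>\<xi> :: 'a \<Rightarrow>\<^sub>L real. blinfun_apply \<xi> e = (LINT p:?R|MM. \<xi> (f (fst p) (snd p) (z (fst p) (snd p))))"
      by (rule pettis_f[OF z tsrect_borel order_refl False zero(1) xy(1) zero(2) xy(2)], rule that)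
    then show ?thesis
      by (intro exI[of _ "((if 0 \<le> x then 1 else - 1) * (if 0 \<le> y then 1 else - 1)) *\<^sub>R e"])
         (simp add: delta_integral2_def case_prod_unfold blinfun.scaleR_right)
  qed
  then show ?thesis unfolding F_def by (rule someI2_ex) blast
qed

lemma rect_integrable_f:
  "admissible z \<Longrightarrow> rect_integrable (\<lambda>s t. blinfun_apply \<xi> (f s t (z s t)))"
  by (intro continuous_rect_integrable admissible_weakly_continuous)

lemma D_f_bound:
  fixes \<xi> :: "'a \<Rightarrow>\<^sub>L real"
  assumes z: "admissible z" and "norm \<xi> \<le> 1" and "a \<in> T1" "b \<in> T1" "c \<in> T2" "d \<in> T2"
  shows "\<bar>D a b c d (\<lambda>s t. \<xi> (f s t (z s t)))\<bar> \<le> \<bar>D a b c d g\<bar>"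
proof (rule abs_delta_integral2_mono[OF rect_integrable_f[OF z] g_rect_integrable assms(3-6)])
  fix s t assume "s \<in> T1" "t \<in> T2"
  then show "\<bar>\<xi> (f s t (z s t))\<bar> \<le> g s t"
    using blinfun_le_norm[OF assms(2), of "f s t (z s t)"] admissible_f_bound[OF z] by (meson order_trans)
qed

text \<open>The three bounds reproduce themselves: differences of \<open>F z\<close> are integrals
  over two strips, rectangular increments are integrals over the rectangle, and the integrand is
  dominated by \<open>g\<close>. The majorant inequality closes the circle for the bound by
  \<open>g0\<close>.\<close>

lemma F_admissible:
  assumes z: "admissible z"
  shows "admissible (F z)"
  unfolding admissible_def
proof (intro conjI ballI)
  fix x y assume xy: "x \<in> T1" "y \<in> T2"
  \<comment> \<open>A functional vanishing on \<open>closure S\<close> annihilates the integrand, so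
    the distance of the integral from the subspace is zero.\<close>
  obtain \<xi> :: "'a \<Rightarrow>\<^sub>L real" where \<xi>: "\<xi> (F z x y) = infdist (F z x y) (closure S)" "\<And>w. w \<in> closure S \<Longrightarrow> \<xi> w = 0"
    using Hahn_Banach_infdist[OF S(2)] by metis
  have "\<bar>D 0 x 0 y (\<lambda>s t. \<xi> (f s t (z s t)))\<bar> \<le> 0 * (\<bar>x - 0\<bar> * \<bar>y - 0\<bar>)"
  proof (rule abs_delta_integral2_le[OF rect_integrable_f[OF z]])
    fix s t assume "(s, t) \<in> tsrect T1 T2 0 x 0 y"
    then have "s \<in> T1" "t \<in> T2" by (auto simp: tsrect_def)
    then show "\<bar>\<xi> (f s t (z s t))\<bar> \<le> 0" using \<xi>(2) f_closure admissibleD(1)[OF z] by simp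
  qed (use xy zero in auto)
  then have "infdist (F z x y) (closure S) = 0" using \<xi>(1) F_eq[OF z xy, of \<xi>] by simp
  then show "F z x y \<in> closure S"
    using in_closed_iff_infdist_zero[of "closure S"] subspace_0[OF S(2)] by (metis closed_closure empty_iff)
  have "norm (F z x y) \<le> \<bar>D 0 x 0 y g\<bar>"
  proof (rule norm_le_of_functionals)
    fix \<xi> :: "'a \<Rightarrow>\<^sub>L real" assume "norm \<xi> \<le> 1"
    then show "\<xi> (F z x y) \<le> \<bar>D 0 x 0 y g\<bar>"
      using D_f_bound[OF z, of \<xi> 0 x 0 y] xy zero by (simp add: F_eq[OF z xy] abs_le_iff)
  qed
  then show "norm (F z x y) \<le> g0 x y" using g0_majorant[OF xy] by simp
next
  fix x1 x2 y1 y2 assume xy: "x1 \<in> T1" "x2 \<in> T1" "y1 \<in> T2" "y2 \<in> T2"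
  note add = delta_integral2_add[OF rect_integrable_f[OF z]]
  show "norm (F z x1 y1 - F z x2 y2) \<le> \<bar>D 0 x2 y1 y2 g\<bar> + \<bar>D x1 x2 0 y1 g\<bar>"
  proof (rule norm_le_of_functionals)
    fix \<xi> :: "'a \<Rightarrow>\<^sub>L real" assume \<xi>: "norm \<xi> \<le> 1"
    let ?\<phi> = "\<lambda>s t. \<xi> (f s t (z s t))"
    have "\<xi> (F z x1 y1 - F z x2 y2) = - D x1 x2 0 y1 ?\<phi> - D 0 x2 y1 y2 ?\<phi>"
      using add(1)[OF zero(1) xy(1,2) zero(2) xy(3) zero(2), of \<xi>] add(2)[OF zero(1) xy(2) zero(1) zero(2) xy(3,4), of \<xi>] xy
      by (simp add: blinfun.diff_right F_eq[OF z])
    then show "\<xi> (F z x1 y1 - F z x2 y2) \<le> \<bar>D 0 x2 y1 y2 g\<bar> + \<bar>D x1 x2 0 y1 g\<bar>"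
      using D_f_bound[OF z \<xi> xy(1,2) zero(2) xy(3)] D_f_bound[OF z \<xi> zero(1) xy(2-4)] by linarith
  qed
  show "norm (F z x2 y2 - F z x2 y1 - F z x1 y2 + F z x1 y1) \<le> \<bar>D x1 x2 y1 y2 g\<bar>"
  proof (rule norm_le_of_functionals)
    fix \<xi> :: "'a \<Rightarrow>\<^sub>L real" assume \<xi>: "norm \<xi> \<le> 1"
    let ?\<phi> = "\<lambda>s t. \<xi> (f s t (z s t))"
    have "\<xi> (F z x2 y2 - F z x2 y1 - F z x1 y2 + F z x1 y1) = D x1 x2 y1 y2 ?\<phi>"
      using add(2)[OF zero(1) xy(2) zero(1) zero(2) xy(3,4), of \<xi>] add(2)[OF zero(1) xy(1) zero(1) zero(2) xy(3,4), of \<xi>]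
        add(1)[OF zero(1) xy(1,2) xy(3,4) zero(2), of \<xi>] xy
      by (simp add: blinfun.diff_right blinfun.add_right F_eq[OF z])
    then show "\<xi> (F z x2 y2 - F z x2 y1 - F z x1 y2 + F z x1 y1) \<le> \<bar>D x1 x2 y1 y2 g\<bar>"
      using D_f_bound[OF z \<xi> xy] by linarith
  qed
qed

lemma F_axis: "admissible z \<Longrightarrow> x \<in> T1 \<Longrightarrow> F z x 0 = 0" "admissible z \<Longrightarrow> y \<in> T2 \<Longrightarrow> F z 0 y = 0"
  by (rule functionals_eqI, simp add: F_eq zero delta_integral2_degenerate)+

text \<open>\<open>C1\<close> gives convergence of the integrands at each point, and a multiple of
  \<open>g\<close> dominates them. Dominated convergence is why only sequences can be
  handled.\<close>

lemma F_weakly_tendsto: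
  assumes u: "\<And>n. admissible (u n)" and z: "admissible z"
    and lim: "\<And>s t. s \<in> T1 \<Longrightarrow> t \<in> T2 \<Longrightarrow> weakly_tendsto (\<lambda>n. u n s t) (z s t)"
    and xy: "x \<in> T1" "y \<in> T2"
  shows "weakly_tendsto (\<lambda>n. F (u n) x y) (F z x y)"
  unfolding weakly_tendsto_def F_eq[OF u xy] F_eq[OF z xy]
proof
  fix \<xi> :: "'a \<Rightarrow>\<^sub>L real"
  show "(\<lambda>n. D 0 x 0 y (\<lambda>s t. \<xi> (f s t (u n s t)))) \<longlonglongrightarrow> D 0 x 0 y (\<lambda>s t. \<xi> (f s t (z s t)))"
    unfolding delta_integral2_W
  proof (rule integral_dominated_convergence[where w = "\<lambda>p. \<bar>norm \<xi> * (W 0 x 0 y p * g (fst p) (snd p))\<bar>"])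
    show "integrable MM (\<lambda>p. \<bar>norm \<xi> * (W 0 x 0 y p * g (fst p) (snd p))\<bar>)"
      using xy zero by (intro integrable_abs integrable_mult_right rect_integrableD[OF g_rect_integrable])
    show "(\<lambda>p. W 0 x 0 y p * \<xi> (f (fst p) (snd p) (z (fst p) (snd p)))) \<in> borel_measurable MM"
      using rect_integrableD[OF rect_integrable_f[OF z] zero(1) xy(1) zero(2) xy(2)] by (rule borel_measurable_integrable)
    show "(\<lambda>p. W 0 x 0 y p * \<xi> (f (fst p) (snd p) (u n (fst p) (snd p)))) \<in> borel_measurable MM" for n
      using rect_integrableD[OF rect_integrable_f[OF u] zero(1) xy(1) zero(2) xy(2)] by (rule borel_measurable_integrable)
    have W0: "W 0 x 0 y p = 0" if "\<not> (fst p \<in> T1 \<and> snd p \<in> T2)" for p using that by (auto simp: W_def)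
    show "AE p in MM. (\<lambda>n. W 0 x 0 y p * \<xi> (f (fst p) (snd p) (u n (fst p) (snd p))))
        \<longlonglongrightarrow> W 0 x 0 y p * \<xi> (f (fst p) (snd p) (z (fst p) (snd p)))"
    proof (rule AE_I2)
      fix p
      show "(\<lambda>n. W 0 x 0 y p * \<xi> (f (fst p) (snd p) (u n (fst p) (snd p)))) \<longlonglongrightarrow> W 0 x 0 y p * \<xi> (f (fst p) (snd p) (z (fst p) (snd p)))"
      proof (cases "fst p \<in> T1 \<and> snd p \<in> T2")
        case True
        then have "(\<lambda>n. \<xi> (f (fst p) (snd p) (u n (fst p) (snd p)))) \<longlonglongrightarrow> \<xi> (f (fst p) (snd p) (z (fst p) (snd p)))"
          using C1[OF _ _ lim] by (simp add: weakly_tendsto_def)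
        then show ?thesis by (rule tendsto_mult_left)
      qed (simp add: W0)
    qed
    show "AE p in MM. norm (W 0 x 0 y p * \<xi> (f (fst p) (snd p) (u n (fst p) (snd p)))) \<le> \<bar>norm \<xi> * (W 0 x 0 y p * g (fst p) (snd p))\<bar>" for n
    proof (rule AE_I2)
      fix p
      show "norm (W 0 x 0 y p * \<xi> (f (fst p) (snd p) (u n (fst p) (snd p)))) \<le> \<bar>norm \<xi> * (W 0 x 0 y p * g (fst p) (snd p))\<bar>"
      proof (cases "fst p \<in> T1 \<and> snd p \<in> T2")
        case True
        have "\<bar>\<xi> (f (fst p) (snd p) (u n (fst p) (snd p)))\<bar> \<le> norm \<xi> * norm (f (fst p) (snd p) (u n (fst p) (snd p)))"
          using norm_blinfun[of \<xi>] by simp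
        also have "\<dots> \<le> norm \<xi> * \<bar>g (fst p) (snd p)\<bar>"
          using admissible_f_bound[OF u, of "fst p" "snd p" n] True by (intro mult_left_mono) auto
        finally have "\<bar>W 0 x 0 y p\<bar> * \<bar>\<xi> (f (fst p) (snd p) (u n (fst p) (snd p)))\<bar> \<le> \<bar>W 0 x 0 y p\<bar> * (norm \<xi> * \<bar>g (fst p) (snd p)\<bar>)"
          by (intro mult_left_mono) auto
        then show ?thesis by (simp add: abs_mult mult.left_commute)
      qed (simp add: W0)
    qed
  qed
qed

end

section \<open>A weakly compact invariant convex set\<close>

text \<open>The points within \<open>t\<close> of a convex set form a convex set, so it suffices to
  look at \<open>A\<close>.\<close>

lemma convex_hull_near:
  fixes A C :: "'a::real_normed_vector set"
  assumes "\<And>a. a \<in> A \<Longrightarrow> \<exists>c\<in>C. norm (a - c) \<le> t" and a: "a \<in> convex hull A"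
  shows "\<exists>c\<in>convex hull C. norm (a - c) \<le> t"
proof -
  have "convex hull A \<subseteq> {a. \<exists>c\<in>convex hull C. norm (a - c) \<le> t}"
  proof (rule hull_minimal)
    show "A \<subseteq> {a. \<exists>c\<in>convex hull C. norm (a - c) \<le> t}"
      using assms(1) hull_subset[of C convex] by blast
    show "convex {a. \<exists>c\<in>convex hull C. norm (a - c) \<le> t}"
    proof (rule convexI, clarify)
      fix x y c d and u v :: real
      assume c: "c \<in> convex hull C" "norm (x - c) \<le> t" and d: "d \<in> convex hull C" "norm (y - d) \<le> t"
        and uv: "0 \<le> u" "0 \<le> v" "u + v = 1"
      have "norm ((u *\<^sub>R x + v *\<^sub>R y) - (u *\<^sub>R c + v *\<^sub>R d)) \<le> norm (u *\<^sub>R (x - c)) + norm (v *\<^sub>R (y - d))"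
        using norm_triangle_ineq[of "u *\<^sub>R (x - c)" "v *\<^sub>R (y - d)"] by (simp add: algebra_simps)
      also have "\<dots> \<le> u * t + v * t" using c(2) d(2) uv by (intro add_mono) (auto intro: mult_left_mono)
      also have "\<dots> = t" using uv(3) by (simp flip: distrib_right)
      finally have "norm ((u *\<^sub>R x + v *\<^sub>R y) - (u *\<^sub>R c + v *\<^sub>R d)) \<le> t" .
      moreover have "u *\<^sub>R c + v *\<^sub>R d \<in> convex hull C"
        using convexD[OF convex_convex_hull c(1) d(1) uv] .
      ultimately show "\<exists>c\<in>convex hull C. norm ((u *\<^sub>R x + v *\<^sub>R y) - c) \<le> t" by blast
    qed
  qed
  with a show ?thesis by blast
qed

text \<open>All Riemann sums with fixed masses \<open>m j\<close> and values ranging over the sets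
  \<open>E j\<close> lie in a single compact set.\<close>

lemma weakly_seq_compact_finite_sum:
  fixes E :: "'i \<Rightarrow> 'a::real_normed_vector set"
  assumes "finite J" "\<And>j. j \<in> J \<Longrightarrow> weakly_seq_compact (E j)" "\<And>j. j \<in> J \<Longrightarrow> bounded (E j)"
  shows "\<exists>D. weakly_seq_compact D \<and> bounded D \<and> (\<forall>c. (\<forall>j\<in>J. c j \<in> E j) \<longrightarrow> (\<Sum>j\<in>J. m j *\<^sub>R c j) \<in> D)"
  using assms
proof (induction J rule: finite_induct)
  case empty
  then show ?case using weakly_seq_compact_singleton[of 0] by (intro exI[of _ "{0}"]) auto
next
  case (insert i J)
  then obtain D where D: "weakly_seq_compact D" "bounded D" "\<And>c. (\<forall>j\<in>J. c j \<in> E j) \<Longrightarrow> (\<Sum>j\<in>J. m j *\<^sub>R c j) \<in> D"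
    by auto
  have E: "weakly_seq_compact (E i)" "bounded (E i)" using insert.prems by auto
  let ?D = "{a + b | a b. a \<in> (\<lambda>a. m i *\<^sub>R a) ` E i \<and> b \<in> D}"
  have "weakly_seq_compact ?D" by (intro weakly_seq_compact_plus weakly_seq_compact_scaleR E D)
  moreover have "bounded ?D"
    using bounded_plus[OF bounded_scaling[OF E(2), of "m i"] D(2)]
    by (rule bounded_subset) auto
  moreover have "(\<Sum>j\<in>insert i J. m j *\<^sub>R c j) \<in> ?D" if c: "\<forall>j\<in>insert i J. c j \<in> E j" for c
    using insert.hyps D(3)[of c] c by auto
  ultimately show ?case by blast
qed

context weak_problem_separable
begin

text \<open>
  This is the smallest convex set of functions that contains zero and is invariant under \<open>F\<close>, so it
  equals the convex hull of zero and its own image under \<open>F\<close>.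
\<close>

inductive reach :: "(real \<Rightarrow> real \<Rightarrow> 'a) \<Rightarrow> bool" where
  reach_zero: "reach (\<lambda>x y. 0)"
| reach_F: "reach z \<Longrightarrow> reach (F z)"
| reach_convex: "reach z \<Longrightarrow> reach w \<Longrightarrow> 0 \<le> a \<Longrightarrow> 0 \<le> b \<Longrightarrow> a + b = 1 \<Longrightarrow> reach (\<lambda>x y. a *\<^sub>R z x y + b *\<^sub>R w x y)"

lemma norm_convex_le:
  fixes u v :: 'a
  assumes "norm u \<le> c" "norm v \<le> c" "0 \<le> a" "0 \<le> b" "a + b = 1"
  shows "norm (a *\<^sub>R u + b *\<^sub>R v) \<le> c"
proof -
  have "norm (a *\<^sub>R u + b *\<^sub>R v) \<le> a * norm u + b * norm v"
    using norm_triangle_ineq[of "a *\<^sub>R u" "b *\<^sub>R v"] assms by simp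
  also have "\<dots> \<le> a * c + b * c" using assms by (intro add_mono mult_left_mono) auto
  finally show ?thesis using assms(5) by (simp flip: distrib_right)
qed

lemma reach_admissible: "reach z \<Longrightarrow> admissible z"
proof (induction rule: reach.induct)
  case reach_zero
  then show ?case using g0_nonneg subspace_0[OF S(2)] by (simp add: admissible_def)
next
  case (reach_F z)
  then show ?case by (intro F_admissible)
next
  case (reach_convex z w a b)
  note z = admissibleD[OF reach_convex.IH(1)] and w = admissibleD[OF reach_convex.IH(2)]
  note ab = reach_convex.hyps(3-5)
  show ?case
    unfolding admissible_def
  proof (intro conjI ballI)
    fix x y assume xy: "x \<in> T1" "y \<in> T2"
    show "a *\<^sub>R z x y + b *\<^sub>R w x y \<in> closure S"
      using z(1)[OF xy(1,1) xy(2,2)] w(1)[OF xy(1,1) xy(2,2)] by (intro subspace_add subspace_scale S(2))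
    show "norm (a *\<^sub>R z x y + b *\<^sub>R w x y) \<le> g0 x y"
      using z(2)[OF xy(1,1) xy(2,2)] w(2)[OF xy(1,1) xy(2,2)] ab by (rule norm_convex_le)
  next
    fix x1 x2 y1 y2 assume xy: "x1 \<in> T1" "x2 \<in> T1" "y1 \<in> T2" "y2 \<in> T2"
    show "norm ((a *\<^sub>R z x1 y1 + b *\<^sub>R w x1 y1) - (a *\<^sub>R z x2 y2 + b *\<^sub>R w x2 y2)) \<le> \<bar>D 0 x2 y1 y2 g\<bar> + \<bar>D x1 x2 0 y1 g\<bar>"
      using norm_convex_le[OF z(3)[OF xy] w(3)[OF xy] ab] by (simp add: algebra_simps)
    show "norm ((a *\<^sub>R z x2 y2 + b *\<^sub>R w x2 y2) - (a *\<^sub>R z x2 y1 + b *\<^sub>R w x2 y1)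
        - (a *\<^sub>R z x1 y2 + b *\<^sub>R w x1 y2) + (a *\<^sub>R z x1 y1 + b *\<^sub>R w x1 y1)) \<le> \<bar>D x1 x2 y1 y2 g\<bar>"
      using norm_convex_le[OF z(4)[OF xy] w(4)[OF xy] ab] by (simp add: algebra_simps)
  qed
qed

text \<open>Each of the three ways of generating a function keeps its value in the hull. Measuring
  values of \<open>F\<close> therefore measures all values of the set.\<close>

lemma reach_hull: "reach z \<Longrightarrow> z x y \<in> convex hull (insert 0 {F w x y | w. reach w})"
proof (induction rule: reach.induct)
  case reach_zero
  then show ?case by (intro hull_inc) simp
next
  case (reach_F z)
  then show ?case by (intro hull_inc) blast
next
  case (reach_convex z w a b)
  then show ?case by (intro convexD[OF convex_convex_hull])
qed

lemma reach_axis: "reach z \<Longrightarrow> z 0 0 = 0"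
  by (induction rule: reach.induct) (auto simp: F_axis(1)[OF reach_admissible zero(1)])

abbreviation "VS \<equiv> value_set (Collect reach)"

definition v :: "real \<Rightarrow> real \<Rightarrow> real" where
  "v x y = deblasi (VS {x} {y})"

lemma VS_nonempty: "X \<noteq> {} \<Longrightarrow> Y \<noteq> {} \<Longrightarrow> VS X Y \<noteq> {}"
  using reach_zero by (force simp: value_set_def)

lemma bounded_VS: "bounded (VS ({a..b} \<inter> T1) ({c..d} \<inter> T2))"
proof -
  obtain M where M: "\<And>s t. s \<in> {a..b} \<inter> T1 \<Longrightarrow> t \<in> {c..d} \<inter> T2 \<Longrightarrow> g0 s t \<le> M"
    by (rule g0_bounded_on_rect[of a b c d]) (rule that)
  have "norm (z s t) \<le> M" if "reach z" "s \<in> {a..b} \<inter> T1" "t \<in> {c..d} \<inter> T2" for z s t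
    using M[OF that(2,3)] admissibleD(2)[OF reach_admissible[OF that(1)], of s s t t] that by auto
  then show ?thesis unfolding bounded_iff value_set_def by blast
qed

lemma bounded_VS_subset: "X \<subseteq> {a..b} \<inter> T1 \<Longrightarrow> Y \<subseteq> {c..d} \<inter> T2 \<Longrightarrow> bounded (VS X Y)"
  by (rule bounded_subset[OF bounded_VS[of a b c d]], unfold value_set_def, blast)

lemma bounded_VS_point: "x \<in> T1 \<Longrightarrow> y \<in> T2 \<Longrightarrow> bounded (VS {x} {y})"
  by (rule bounded_VS_subset[of _ x x _ y y]) auto

lemma v_nonneg: "x \<in> T1 \<Longrightarrow> y \<in> T2 \<Longrightarrow> 0 \<le> v x y"
  unfolding v_def by (intro deblasi_nonneg bounded_VS_point)

text \<open>A common Lipschitz constant moves the whole set of values at one point close to the set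
  at another, and \<open>deblasi\<close> moves by no more.\<close>

lemma v_continuous: "continuous_on (T1 \<times> T2) (\<lambda>(x, y). v x y)"
proof (rule continuous_on_sequentiallyI)
  fix u a assume u: "\<forall>n. u n \<in> T1 \<times> T2" "a \<in> T1 \<times> T2" "u \<longlonglongrightarrow> a"
  have "bounded (insert a (range u))" using u(3) convergent_imp_bounded bounded_insert by blast
  then obtain k where k: "\<And>p. p \<in> insert a (range u) \<Longrightarrow> norm p \<le> k" unfolding bounded_iff by blast
  have coord: "\<bar>fst p\<bar> \<le> k" "\<bar>snd p\<bar> \<le> k" if "p \<in> insert a (range u)" for p
    using k[OF that] norm_fst_le[of "fst p" "snd p"] norm_snd_le[of "snd p" "fst p"] by auto
  obtain L where L: "L \<ge> 0" "\<And>z x1 x2 y1 y2. admissible z \<Longrightarrow> x1 \<in> {- k..k} \<inter> T1 \<Longrightarrow> x2 \<in> {- k..k} \<inter> T1 \<Longrightarrow>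
      y1 \<in> {- k..k} \<inter> T2 \<Longrightarrow> y2 \<in> {- k..k} \<inter> T2 \<Longrightarrow> norm (z x1 y1 - z x2 y2) \<le> L * (\<bar>x2 - x1\<bar> + \<bar>y2 - y1\<bar>)"
    by (rule admissible_Lipschitz[of k], rule that)
  have le: "v x1 y1 \<le> v x2 y2 + L * (\<bar>x2 - x1\<bar> + \<bar>y2 - y1\<bar>)"
    if xy: "x1 \<in> {- k..k} \<inter> T1" "x2 \<in> {- k..k} \<inter> T1" "y1 \<in> {- k..k} \<inter> T2" "y2 \<in> {- k..k} \<inter> T2" for x1 x2 y1 y2
    unfolding v_def
  proof (rule deblasi_perturb)
    show "bounded (VS {x2} {y2})" using xy by (intro bounded_VS_point) auto
    show "0 \<le> L * (\<bar>x2 - x1\<bar> + \<bar>y2 - y1\<bar>)" using L(1) by simp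
    fix e assume "e \<in> VS {x1} {y1}"
    then obtain z where z: "reach z" "e = z x1 y1" by (auto simp: value_set_def)
    have "z x2 y2 \<in> VS {x2} {y2}" using z(1) by (auto simp: value_set_def)
    moreover have "norm (e - z x2 y2) \<le> L * (\<bar>x2 - x1\<bar> + \<bar>y2 - y1\<bar>)"
      unfolding z(2) by (rule L(2)[OF reach_admissible[OF z(1)] xy])
    ultimately show "\<exists>e'\<in>VS {x2} {y2}. norm (e - e') \<le> L * (\<bar>x2 - x1\<bar> + \<bar>y2 - y1\<bar>)" by blast
  qed
  have "(\<lambda>n. v (fst (u n)) (snd (u n)) - v (fst a) (snd a)) \<longlonglongrightarrow> 0"
  proof (rule Lim_null_comparison[OF always_eventually], rule allI)
    fix n
    have "u n \<in> insert a (range u)" "a \<in> insert a (range u)" by auto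
    from coord[OF this(1)] coord[OF this(2)]
    have "\<bar>fst (u n)\<bar> \<le> k" "\<bar>snd (u n)\<bar> \<le> k" "\<bar>fst a\<bar> \<le> k" "\<bar>snd a\<bar> \<le> k" by auto
    then have xy: "fst (u n) \<in> {- k..k} \<inter> T1" "fst a \<in> {- k..k} \<inter> T1" "snd (u n) \<in> {- k..k} \<inter> T2" "snd a \<in> {- k..k} \<inter> T2"
      using u(1,2) by (auto simp: mem_Times_iff)
    show "norm (v (fst (u n)) (snd (u n)) - v (fst a) (snd a)) \<le> L * (\<bar>fst a - fst (u n)\<bar> + \<bar>snd a - snd (u n)\<bar>)"
      using le[OF xy] le[OF xy(2,1,4,3)] by (simp add: abs_le_iff abs_minus_commute)
  next
    have "(\<lambda>n. L * (\<bar>fst a - fst (u n)\<bar> + \<bar>snd a - snd (u n)\<bar>)) \<longlonglongrightarrow> L * (\<bar>fst a - fst a\<bar> + \<bar>snd a - snd a\<bar>)"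
      using u(3) by (intro tendsto_intros)
    then show "(\<lambda>n. L * (\<bar>fst a - fst (u n)\<bar> + \<bar>snd a - snd (u n)\<bar>)) \<longlonglongrightarrow> 0" by simp
  qed
  then show "(\<lambda>n. case u n of (x, y) \<Rightarrow> v x y) \<longlonglongrightarrow> (case a of (x, y) \<Rightarrow> v x y)"
    by (simp add: case_prod_unfold LIM_zero_iff)
qed

lemma v_origin: "v 0 0 = 0"
proof -
  have "VS {0} {0} \<subseteq> {0}" using reach_axis by (auto simp: value_set_def)
  then have "v 0 0 \<le> 0"
    unfolding v_def by (intro deblasi_le_of_seq_compact[of "{0}" _ "{0}"] weakly_seq_compact_singleton) auto
  then show ?thesis using v_nonneg[OF zero] by simp
qed

lemma H_continuous: "continuous_on (T1 \<times> T2) (\<lambda>(s, t). h s t (v s t))"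
proof -
  have v: "continuous_on (T1 \<times> T2) (\<lambda>p. v (fst p) (snd p))" using v_continuous by (simp add: case_prod_unfold)
  have "continuous_on (T1 \<times> T2) (\<lambda>p. (fst p, snd p, v (fst p) (snd p)))"
    by (intro continuous_on_Pair continuous_on_fst continuous_on_snd continuous_on_id v)
  from continuous_on_compose2[OF h_cont this] show ?thesis
    using v_nonneg by (force simp: case_prod_unfold)
qed

text \<open>\<open>C4\<close> holds for every point of the cell, with the measure of all values over
  the cell as argument of \<open>h\<close>. Small oscillation makes that argument nearly
  \<open>v s t\<close>. The result is one covering radius for \<open>f\<close> on the cell that lies
  below the integrand everywhere on it, as a lower Riemann sum requires, up to an error.\<close>

lemma cell_estimate:
  assumes X: "X \<subseteq> {- k..k} \<inter> T1" "X \<noteq> {}" and Y: "Y \<subseteq> {- k..k} \<inter> T2" "Y \<noteq> {}" and "\<epsilon> > 0" "\<eta> \<ge> 0"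
    and osc: "\<And>z s t s' t'. reach z \<Longrightarrow> s \<in> X \<Longrightarrow> s' \<in> X \<Longrightarrow> t \<in> Y \<Longrightarrow> t' \<in> Y \<Longrightarrow> norm (z s t - z s' t') \<le> \<eta>"
    and unif: "\<And>s t r. s \<in> X \<Longrightarrow> t \<in> Y \<Longrightarrow> v s t \<le> r \<Longrightarrow> r \<le> v s t + \<eta> \<Longrightarrow> h s t r \<le> h s t (v s t) + \<epsilon>"
  obtains C \<tau> where "weakly_seq_compact C" "bounded C" "0 \<le> \<tau>"
    "\<And>s t. s \<in> X \<Longrightarrow> t \<in> Y \<Longrightarrow> \<tau> \<le> h s t (v s t) + 2 * \<epsilon>"
    "\<And>w s t. reach w \<Longrightarrow> s \<in> X \<Longrightarrow> t \<in> Y \<Longrightarrow> \<exists>c\<in>C. norm (f s t (w s t) - c) \<le> \<tau>"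
proof -
  define A where "A = {f s t u | s t u. s \<in> X \<and> t \<in> Y \<and> u \<in> VS X Y}"
  have bV: "bounded (VS X Y)" by (rule bounded_VS_subset[OF X(1) Y(1)])
  then obtain B where B: "\<And>u. u \<in> VS X Y \<Longrightarrow> norm u \<le> B" unfolding bounded_iff by blast
  obtain M where M: "\<And>s t r. s \<in> {- k..k} \<inter> T1 \<Longrightarrow> t \<in> {- k..k} \<inter> T2 \<Longrightarrow> 0 \<le> r \<Longrightarrow> r \<le> B \<Longrightarrow> G s t r \<le> M"
    by (rule G_bounded_on_rect[of "- k" k "- k" k B]) (rule that)
  have "norm (f s t u) \<le> M" if "s \<in> X" "t \<in> Y" "u \<in> VS X Y" for s t u
  proof -
    have "s \<in> {- k..k} \<inter> T1" "t \<in> {- k..k} \<inter> T2" using that X Y by auto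
    then show ?thesis using M[of s t "norm u"] B[OF that(3)] C3[of s t u] by auto
  qed
  then have bA: "bounded A" unfolding A_def bounded_iff by blast
  have W: "Collect reach \<subseteq> B_set T1 T2 G g0" using reach_admissible admissible_B_set by blast
  have XT: "X \<subseteq> T1" "Y \<subseteq> T2" using X Y by auto
  \<comment> \<open>An infimum need not be attained; adding \<epsilon> gives a radius for which a
    covering exists. This is the second \<epsilon> in the bound.\<close>
  define \<tau> where "\<tau> = deblasi A + \<epsilon>"
  have "deblasi A < \<tau>" using \<open>\<epsilon> > 0\<close> by (simp add: \<tau>_def)
  then have "weakly_covered A \<tau>" by (rule deblasi_less[OF bA])
  then obtain C where C: "weakly_seq_compact C" "bounded C" "\<And>a. a \<in> A \<Longrightarrow> \<exists>c\<in>C. norm (a - c) \<le> \<tau>"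
    using weakly_coveredE[OF _ bA] by blast
  show thesis
  proof (rule that[OF C(1,2)])
    show "0 \<le> \<tau>" using deblasi_nonneg[OF bA] \<open>\<epsilon> > 0\<close> by (simp add: \<tau>_def)
    fix s t assume st: "s \<in> X" "t \<in> Y"
    have "bounded (VS {s} {t})" using st XT by (intro bounded_VS_point) auto
    then have "deblasi (VS X Y) \<le> v s t + \<eta>"
      unfolding v_def
    proof (rule deblasi_perturb)
      fix e assume "e \<in> VS X Y"
      then obtain z s' t' where z: "reach z" "s' \<in> X" "t' \<in> Y" "e = z s' t'" by (auto simp: value_set_def)
      have "z s t \<in> VS {s} {t}" using z(1) by (auto simp: value_set_def)
      moreover have "norm (e - z s t) \<le> \<eta>" unfolding z(4) using z st by (intro osc)
      ultimately show "\<exists>e'\<in>VS {s} {t}. norm (e - e') \<le> \<eta>" by blast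
    qed fact
    \<comment> \<open>The argument of \<open>h\<close> is bounded from below as well, because
      \<open>h\<close> is not assumed monotone and \<open>unif\<close> compares values only just
      above \<open>v s t\<close>.\<close>
    moreover have "v s t \<le> deblasi (VS X Y) + 0"
      unfolding v_def
    proof (rule deblasi_perturb[OF bV])
      fix e assume "e \<in> VS {s} {t}"
      then have "e \<in> VS X Y" using st by (auto simp: value_set_def)
      then show "\<exists>e'\<in>VS X Y. norm (e - e') \<le> 0" by (intro bexI[of _ e]) auto
    qed simp
    ultimately have "h s t (deblasi (VS X Y)) \<le> h s t (v s t) + \<epsilon>" using st by (intro unif) auto
    moreover have "deblasi A \<le> h s t (deblasi (VS X Y))"
      unfolding A_def by (rule C4[OF W XT VS_nonempty[OF X(2) Y(2)] bV bA[unfolded A_def] st])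
    ultimately show "\<tau> \<le> h s t (v s t) + 2 * \<epsilon>" by (simp add: \<tau>_def)
  next
    fix w s t assume w: "reach w" "s \<in> X" "t \<in> Y"
    then have "w s t \<in> VS X Y" by (auto simp: value_set_def)
    then have "f s t (w s t) \<in> A" using w unfolding A_def by blast
    then show "\<exists>c\<in>C. norm (f s t (w s t) - c) \<le> \<tau>" by (rule C(3))
  qed
qed

text \<open>A grid of mesh \<open>\<delta>\<close>, indexed by integer parts, cuts the half-open
  rectangle into disjoint Borel products, matching the half-open domains of delta integrals.\<close>

lemma cells:
  assumes "\<delta> > 0"
  obtains J :: "(int \<times> int) set" and X Y where "finite J"
    "\<And>j. X j \<in> sets borel" "\<And>j. Y j \<in> sets borel" "\<And>j s s'. s \<in> X j \<Longrightarrow> s' \<in> X j \<Longrightarrow> \<bar>s - s'\<bar> \<le> \<delta>"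
    "\<And>j t t'. t \<in> Y j \<Longrightarrow> t' \<in> Y j \<Longrightarrow> \<bar>t - t'\<bar> \<le> \<delta>"
    "disjoint_family_on (\<lambda>j. X j \<times> Y j) J" "(\<Union>j\<in>J. X j \<times> Y j) = tsrect T1 T2 a b c d"
proof -
  define X where "X j = {s \<in> {min a b..<max a b} \<inter> T1. \<lfloor>s / \<delta>\<rfloor> = fst j}" for j :: "int \<times> int"
  define Y where "Y j = {t \<in> {min c d..<max c d} \<inter> T2. \<lfloor>t / \<delta>\<rfloor> = snd j}" for j :: "int \<times> int"
  define J where "J = {\<lfloor>min a b / \<delta>\<rfloor>..\<lfloor>max a b / \<delta>\<rfloor>} \<times> {\<lfloor>min c d / \<delta>\<rfloor>..\<lfloor>max c d / \<delta>\<rfloor>}"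
  have diam: "\<bar>s - s'\<bar> \<le> \<delta>" if "\<lfloor>s / \<delta>\<rfloor> = i" "\<lfloor>s' / \<delta>\<rfloor> = i" for s s' and i :: int
  proof -
    have "\<bar>s / \<delta> - s' / \<delta>\<bar> \<le> 1" using that by linarith
    then have "\<bar>s - s'\<bar> / \<delta> \<le> 1" using assms by (simp add: abs_divide flip: diff_divide_distrib)
    then show ?thesis using assms by (simp add: field_simps)
  qed
  have fl: "\<lfloor>s / \<delta>\<rfloor> \<in> {\<lfloor>p / \<delta>\<rfloor>..\<lfloor>q / \<delta>\<rfloor>}" if "p \<le> s" "s < q" for p q s
    using that assms by (auto intro!: floor_mono divide_right_mono)
  show thesis
  proof (rule that[of J X Y])
    show "X j \<in> sets borel" for j
    proof -
      have "X j = {min a b..<max a b} \<inter> T1 \<inter> {s. \<lfloor>s / \<delta>\<rfloor> = fst j}" by (auto simp: X_def)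
      moreover have "{s. \<lfloor>s / \<delta>\<rfloor> = fst j} \<in> sets borel" by measurable
      ultimately show ?thesis using closed_ts by auto
    qed
    show "Y j \<in> sets borel" for j
    proof -
      have "Y j = {min c d..<max c d} \<inter> T2 \<inter> {s. \<lfloor>s / \<delta>\<rfloor> = snd j}" by (auto simp: Y_def)
      moreover have "{s. \<lfloor>s / \<delta>\<rfloor> = snd j} \<in> sets borel" by measurable
      ultimately show ?thesis using closed_ts by auto
    qed
    show "disjoint_family_on (\<lambda>j. X j \<times> Y j) J"
      unfolding disjoint_family_on_def by (auto simp: X_def Y_def)
    show "(\<Union>j\<in>J. X j \<times> Y j) = tsrect T1 T2 a b c d"
    proof (intro equalityI subsetI)
      fix p assume "p \<in> tsrect T1 T2 a b c d"
      then have p: "fst p \<in> {min a b..<max a b} \<inter> T1" "snd p \<in> {min c d..<max c d} \<inter> T2" by (auto simp: tsrect_def)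
      then have "(\<lfloor>fst p / \<delta>\<rfloor>, \<lfloor>snd p / \<delta>\<rfloor>) \<in> J" unfolding J_def using fl by auto
      moreover have "p \<in> X (\<lfloor>fst p / \<delta>\<rfloor>, \<lfloor>snd p / \<delta>\<rfloor>) \<times> Y (\<lfloor>fst p / \<delta>\<rfloor>, \<lfloor>snd p / \<delta>\<rfloor>)"
        using p by (cases p) (auto simp: X_def Y_def)
      ultimately show "p \<in> (\<Union>j\<in>J. X j \<times> Y j)" by blast
    qed (auto simp: X_def Y_def tsrect_def)
  qed (use diam in \<open>auto simp: X_def Y_def J_def\<close>)
qed

text \<open>Values of the whole set are convex combinations of 0 and values of \<open>F\<close>, so
  they stay near the hull of \<open>0\<close> and \<open>D0\<close>, which the Krein-Smulian theorem
  keeps relatively compact.\<close>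

lemma v_le_of_F:
  assumes xy: "x \<in> T1" "y \<in> T2" and D0: "weakly_seq_compact D0" "bounded D0" and "0 \<le> t"
    and near: "\<And>w. reach w \<Longrightarrow> \<exists>d\<in>D0. norm (F w x y - d) \<le> t"
  shows "v x y \<le> t"
  unfolding v_def
proof (rule deblasi_le_of_seq_compact[OF S(1)])
  let ?D = "convex hull (insert 0 D0)"
  have bD: "bounded (insert 0 D0)" using D0(2) by simp
  then obtain B where B: "\<And>a. a \<in> insert 0 D0 \<Longrightarrow> norm a \<le> B" unfolding bounded_iff by blast
  show "weakly_seq_compact ?D"
    by (rule weakly_seq_compact_convex_hull[OF weakly_seq_compact_insert[OF D0(1)] B])
  show "bounded ?D" by (rule bounded_convex_hull[OF bD])
  show "VS {x} {y} \<subseteq> closure S"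
    using admissibleD(1)[OF reach_admissible] xy by (auto simp: value_set_def)
  fix e assume "e \<in> VS {x} {y}"
  then have "e \<in> convex hull (insert 0 {F w x y | w. reach w})" using reach_hull by (auto simp: value_set_def)
  moreover have "\<exists>d\<in>insert 0 D0. norm (a - d) \<le> t" if "a \<in> insert 0 {F w x y | w. reach w}" for a
    using that near \<open>0 \<le> t\<close> by (elim insertE) auto
  ultimately show "\<exists>d\<in>?D. norm (e - d) \<le> t" by (rule convex_hull_near[rotated])
qed fact

end

section \<open>The minorant inequality and its consequence\<close>

context weak_problem_separable
begin

text \<open>On each cell the values of \<open>f\<close> are covered with radius
  \<open>\<tau> j\<close>; by the mean value property the integral over the cell is covered with
  radius about \<open>\<mu> j * \<tau> j\<close>. Summing covers \<open>F w x y\<close> with a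
  radius at most a Riemann sum of \<open>H\<close>, up to errors.\<close>

lemma v_minorant: "minorant_solution T1 T2 h v"
  unfolding minorant_solution_def
proof (intro ballI)
  fix x y assume xy: "x \<in> T1" "y \<in> T2"
  define H where "H s t = h s t (v s t)" for s t
  define R where "R = tsrect T1 T2 0 x 0 y"
  define m where "m = measure MM R"
  define k where "k = \<bar>x\<bar> + \<bar>y\<bar>"
  define sg :: real where "sg = (if 0 \<le> x then 1 else - 1) * (if 0 \<le> y then 1 else - 1)"
  have Rm: "R \<in> sets MM" unfolding R_def by (intro sets_borel_MM tsrect_borel)
  have Rfin: "emeasure MM R \<noteq> \<infinity>" unfolding R_def using emeasure_tsrect[OF zero(1) xy(1) zero(2) xy(2)] by simp
  have Hcont: "continuous_on (T1 \<times> T2) (\<lambda>(s, t). H s t)" unfolding H_def by (rule H_continuous)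
  have I: "\<bar>D 0 x 0 y H\<bar> = (LINT p:R|MM. H (fst p) (snd p))"
    unfolding R_def by (rule abs_delta_integral2) (simp add: H_def h_nonneg v_nonneg)
  have int_R: "set_integrable MM R (\<lambda>p. \<phi> (fst p) (snd p))"
    if "continuous_on (T1 \<times> T2) (\<lambda>(s, t). \<phi> s t)" for \<phi> :: "real \<Rightarrow> real \<Rightarrow> real"
    using continuous_rect_integrable[OF that] zero xy
    unfolding rect_integrable_def delta_integrable2_def R_def by (auto simp: case_prod_unfold)
  have "v x y \<le> \<bar>D 0 x 0 y H\<bar>"
  proof (rule field_le_epsilon)
    fix e :: real assume "e > 0"
    \<comment> \<open>The total error is one \<epsilon> from the mean value approximation and
      \<open>2 * \<epsilon>\<close> per unit of measure from the cells, together
      \<open>\<epsilon> * (1 + 2 * m) = e\<close>.\<close>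
    define \<epsilon> where "\<epsilon> = e / (1 + 2 * m)"
    have m: "m \<ge> 0" by (simp add: m_def)
    have "\<epsilon> * (1 + 2 * m) = e" using m by (simp add: \<epsilon>_def add_nonneg_eq_0_iff)
    then have \<epsilon>: "\<epsilon> + 2 * \<epsilon> * m = e" by (simp add: algebra_simps)
    have "\<epsilon> > 0" using \<open>e > 0\<close> m by (simp add: \<epsilon>_def)
    note \<epsilon> = this \<epsilon>
    obtain L where L: "L \<ge> 0" "\<And>z x1 x2 y1 y2. admissible z \<Longrightarrow> x1 \<in> {- k..k} \<inter> T1 \<Longrightarrow> x2 \<in> {- k..k} \<inter> T1 \<Longrightarrow>
        y1 \<in> {- k..k} \<inter> T2 \<Longrightarrow> y2 \<in> {- k..k} \<inter> T2 \<Longrightarrow> norm (z x1 y1 - z x2 y2) \<le> L * (\<bar>x2 - x1\<bar> + \<bar>y2 - y1\<bar>)"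
      by (rule admissible_Lipschitz[of k], rule that)
    obtain V where V: "\<And>s t. s \<in> {- k..k} \<inter> T1 \<Longrightarrow> t \<in> {- k..k} \<inter> T2 \<Longrightarrow> \<bar>v s t\<bar> \<le> V"
      by (rule continuous_bounded_on_rect[OF v_continuous, of "- k" k "- k" k]) (rule that)
    let ?Q = "({- k..k} \<inter> T1) \<times> ({- k..k} \<inter> T2) \<times> {0..V + 1}"
    have "compact ?Q" using closed_ts by (intro compact_Times compact_Int_closed) auto
    moreover have "continuous_on ?Q (\<lambda>(s, t, r). h s t r)" by (rule continuous_on_subset[OF h_cont]) auto
    ultimately have "uniformly_continuous_on ?Q (\<lambda>(s, t, r). h s t r)" by (intro compact_uniformly_continuous)
    then obtain \<eta>0 where \<eta>0: "\<eta>0 > 0" "\<And>p q. p \<in> ?Q \<Longrightarrow> q \<in> ?Q \<Longrightarrow> dist q p < \<eta>0 \<Longrightarrow>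
        dist (case q of (s, t, r) \<Rightarrow> h s t r) (case p of (s, t, r) \<Rightarrow> h s t r) < \<epsilon>"
      using \<epsilon>(1) unfolding uniformly_continuous_on_def by meson
    \<comment> \<open>The bound 1 keeps \<open>v s t + \<eta>\<close> inside the compact set on
      which \<open>h\<close> is uniformly continuous.\<close>
    define \<eta> where "\<eta> = min 1 (\<eta>0 / 2)"
    have \<eta>: "\<eta> > 0" "\<eta> \<le> 1" "\<eta> < \<eta>0" using \<eta>0(1) by (auto simp: \<eta>_def)
    have unif: "h s t r \<le> h s t (v s t) + \<epsilon>"
      if "s \<in> {- k..k} \<inter> T1" "t \<in> {- k..k} \<inter> T2" "v s t \<le> r" "r \<le> v s t + \<eta>" for s t r
    proof -
      have v: "0 \<le> v s t" "v s t \<le> V" using v_nonneg[of s t] V[OF that(1,2)] that by auto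
      then have "(s, t, v s t) \<in> ?Q" "(s, t, r) \<in> ?Q" using that \<eta>(2) by auto
      moreover have "dist (s, t, r) (s, t, v s t) < \<eta>0" using that \<eta>(3) by (simp add: dist_Pair_Pair dist_real_def)
      ultimately have "dist (h s t r) (h s t (v s t)) < \<epsilon>" using \<eta>0(2) by fastforce
      then show ?thesis by (simp add: dist_real_def abs_less_iff)
    qed
    \<comment> \<open>Over a cell of side \<open>\<delta>\<close> reachable functions vary by at
      most \<open>L * (\<delta> + \<delta>)\<close>; the added 1 allows
      \<open>L = 0\<close>.\<close>
    define \<delta> where "\<delta> = \<eta> / (2 * L + 1)"
    have "\<delta> > 0" using \<eta>(1) L(1) by (simp add: \<delta>_def)
    moreover have "(2 * L + 1) * \<delta> = \<eta>" using L(1) by (simp add: \<delta>_def)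
    ultimately have \<delta>: "\<delta> > 0" "L * (\<delta> + \<delta>) \<le> \<eta>" by (auto simp: algebra_simps)
    obtain J :: "(int \<times> int) set" and X Y where J: "finite J"
      and XY: "\<And>j. X j \<in> sets borel" "\<And>j. Y j \<in> sets borel" "\<And>j s s'. s \<in> X j \<Longrightarrow> s' \<in> X j \<Longrightarrow> \<bar>s - s'\<bar> \<le> \<delta>"
        "\<And>j t t'. t \<in> Y j \<Longrightarrow> t' \<in> Y j \<Longrightarrow> \<bar>t - t'\<bar> \<le> \<delta>"
      and disj: "disjoint_family_on (\<lambda>j. X j \<times> Y j) J" and UN: "(\<Union>j\<in>J. X j \<times> Y j) = R"
    proof (rule cells[OF \<delta>(1), of 0 x 0 y])
      fix J :: "(int \<times> int) set" and X Y :: "int \<times> int \<Rightarrow> real set"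
      assume *: "finite J" "\<And>j. X j \<in> sets borel" "\<And>j. Y j \<in> sets borel"
        "\<And>j s s'. s \<in> X j \<Longrightarrow> s' \<in> X j \<Longrightarrow> \<bar>s - s'\<bar> \<le> \<delta>" "\<And>j t t'. t \<in> Y j \<Longrightarrow> t' \<in> Y j \<Longrightarrow> \<bar>t - t'\<bar> \<le> \<delta>"
        "disjoint_family_on (\<lambda>j. X j \<times> Y j) J" "(\<Union>j\<in>J. X j \<times> Y j) = tsrect T1 T2 0 x 0 y"
      show thesis by (rule that[OF *(1-6) *(7)[folded R_def]])
    qed
    define \<mu> where "\<mu> j = measure MM (X j \<times> Y j)" for j
    have cell_b: "X j \<times> Y j \<in> sets borel" for j using XY(1,2) by (intro borel_Times)
    have cell_m: "X j \<times> Y j \<in> sets MM" for j using cell_b by (rule sets_borel_MM)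
    have cell_R: "X j \<times> Y j \<subseteq> R" if "j \<in> J" for j using UN that by blast
    have R_k: "R \<subseteq> ({- k..k} \<inter> T1) \<times> ({- k..k} \<inter> T2)"
      unfolding R_def tsrect_def k_def by (auto simp: min_def max_def split: if_splits)
    have fin_cell: "emeasure MM (X j \<times> Y j) \<noteq> \<infinity>" if "j \<in> J" for j
      using emeasure_mono[OF cell_R[OF that] Rm] Rfin by (metis infinity_ennreal_def neq_top_trans)
    have "\<forall>j\<in>J. \<exists>C\<tau>. weakly_seq_compact (fst C\<tau>) \<and> bounded (fst C\<tau>) \<and> fst C\<tau> \<noteq> {} \<and> (0 :: real) \<le> snd C\<tau> \<and>
        (\<forall>s\<in>X j. \<forall>t\<in>Y j. snd C\<tau> \<le> H s t + 2 * \<epsilon>) \<and>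
        (\<forall>w. reach w \<longrightarrow> (\<forall>s\<in>X j. \<forall>t\<in>Y j. \<exists>c\<in>fst C\<tau>. norm (f s t (w s t) - c) \<le> snd C\<tau>))"
    proof
      fix j assume j: "j \<in> J"
      show "\<exists>C\<tau>. weakly_seq_compact (fst C\<tau>) \<and> bounded (fst C\<tau>) \<and> fst C\<tau> \<noteq> {} \<and> (0 :: real) \<le> snd C\<tau> \<and>
        (\<forall>s\<in>X j. \<forall>t\<in>Y j. snd C\<tau> \<le> H s t + 2 * \<epsilon>) \<and>
        (\<forall>w. reach w \<longrightarrow> (\<forall>s\<in>X j. \<forall>t\<in>Y j. \<exists>c\<in>fst C\<tau>. norm (f s t (w s t) - c) \<le> snd C\<tau>))"
      proof (cases "X j = {} \<or> Y j = {}")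
        case True
        then show ?thesis using weakly_seq_compact_singleton[of 0] by (intro exI[of _ "({0}, 0)"]) auto
      next
        case False
        have "X j \<times> Y j \<subseteq> ({- k..k} \<inter> T1) \<times> ({- k..k} \<inter> T2)" using cell_R[OF j] R_k by (rule order_trans)
        then have XYk: "X j \<subseteq> {- k..k} \<inter> T1" "Y j \<subseteq> {- k..k} \<inter> T2" using False by blast+
        have ne: "X j \<noteq> {}" "Y j \<noteq> {}" using False by auto
        have osc: "norm (z s t - z s' t') \<le> \<eta>" if "reach z" "s \<in> X j" "s' \<in> X j" "t \<in> Y j" "t' \<in> Y j" for z s t s' t'
        proof -
          have "norm (z s t - z s' t') \<le> L * (\<bar>s' - s\<bar> + \<bar>t' - t\<bar>)"
            using that XYk by (intro L(2) reach_admissible) auto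
          also have "\<dots> \<le> L * (\<delta> + \<delta>)" using that XY(3,4) L(1) by (intro mult_left_mono add_mono) auto
          finally show ?thesis using \<delta>(2) by simp
        qed
        have un: "h s t r \<le> h s t (v s t) + \<epsilon>" if "s \<in> X j" "t \<in> Y j" "v s t \<le> r" "r \<le> v s t + \<eta>" for s t r
          using that XYk by (intro unif) auto
        obtain C \<tau> where C: "weakly_seq_compact C" "bounded C" "0 \<le> \<tau>"
          "\<And>s t. s \<in> X j \<Longrightarrow> t \<in> Y j \<Longrightarrow> \<tau> \<le> h s t (v s t) + 2 * \<epsilon>"
          "\<And>w s t. reach w \<Longrightarrow> s \<in> X j \<Longrightarrow> t \<in> Y j \<Longrightarrow> \<exists>c\<in>C. norm (f s t (w s t) - c) \<le> \<tau>"
        proof (rule cell_estimate[OF XYk(1) ne(1) XYk(2) ne(2) \<epsilon>(1) less_imp_le[OF \<eta>(1)]])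
          show "norm (z s t - z s' t') \<le> \<eta>" if "reach z" "s \<in> X j" "s' \<in> X j" "t \<in> Y j" "t' \<in> Y j" for z s t s' t'
            by (rule osc[OF that])
          show "h s t r \<le> h s t (v s t) + \<epsilon>" if "s \<in> X j" "t \<in> Y j" "v s t \<le> r" "r \<le> v s t + \<eta>" for s t r
            by (rule un[OF that])
        qed (rule that)
        \<comment> \<open>Nonemptiness matters later, when an empty or trivial cell still has to
          supply a point of the hull.\<close>
        have "C \<noteq> {}" using C(5)[OF reach_zero] ne by blast
        then show ?thesis using C by (intro exI[of _ "(C, \<tau>)"]) (auto simp: H_def)
      qed
    qed
    from bchoice[OF this] obtain C\<tau> where C\<tau>: "\<forall>j\<in>J. weakly_seq_compact (fst (C\<tau> j)) \<and> bounded (fst (C\<tau> j)) \<and> fst (C\<tau> j) \<noteq> {} \<and> (0 :: real) \<le> snd (C\<tau> j) \<and>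
        (\<forall>s\<in>X j. \<forall>t\<in>Y j. snd (C\<tau> j) \<le> H s t + 2 * \<epsilon>) \<and>
        (\<forall>w. reach w \<longrightarrow> (\<forall>s\<in>X j. \<forall>t\<in>Y j. \<exists>c\<in>fst (C\<tau> j). norm (f s t (w s t) - c) \<le> snd (C\<tau> j)))" by (rule exE)
    define C where "C j = fst (C\<tau> j)" for j
    define \<tau> where "\<tau> j = snd (C\<tau> j)" for j
    have C: "weakly_seq_compact (C j)" "bounded (C j)" "C j \<noteq> {}" "0 \<le> \<tau> j" if "j \<in> J" for j
      using C\<tau> that by (auto simp: C_def \<tau>_def)
    have \<tau>H: "\<tau> j \<le> H s t + 2 * \<epsilon>" if "j \<in> J" "s \<in> X j" "t \<in> Y j" for j s t using C\<tau> that by (auto simp: \<tau>_def)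
    have near: "\<exists>c\<in>C j. norm (f s t (w s t) - c) \<le> \<tau> j" if "j \<in> J" "s \<in> X j" "t \<in> Y j" "reach w" for j s t w
      using C\<tau> that by (auto simp: C_def \<tau>_def)
    have hull: "weakly_seq_compact (convex hull (C j))" "bounded (convex hull (C j))" if j: "j \<in> J" for j
    proof -
      obtain B where "\<And>a. a \<in> C j \<Longrightarrow> norm a \<le> B" using C(2)[OF j] unfolding bounded_iff by blast
      then show "weakly_seq_compact (convex hull (C j))" by (rule weakly_seq_compact_convex_hull[OF C(1)[OF j]])
      show "bounded (convex hull (C j))" by (rule bounded_convex_hull[OF C(2)[OF j]])
    qed
    \<comment> \<open>The masses and the orientation sign are fixed in advance, so \<open>D0\<close>
      does not depend on the function \<open>w\<close> whose image is approximated.\<close>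
    obtain D0 where D0: "weakly_seq_compact D0" "bounded D0"
      "\<And>c. (\<forall>j\<in>J. c j \<in> convex hull (C j)) \<Longrightarrow> (\<Sum>j\<in>J. (sg * \<mu> j) *\<^sub>R c j) \<in> D0"
      using weakly_seq_compact_finite_sum[OF J hull, of "\<lambda>j. j" "\<lambda>j. sg * \<mu> j"] by blast
    have sum_\<tau>: "(\<Sum>j\<in>J. \<mu> j * \<tau> j) \<le> \<bar>D 0 x 0 y H\<bar> + 2 * \<epsilon> * m"
    proof -
      have iH: "set_integrable MM R (\<lambda>p. H (fst p) (snd p))" by (rule int_R[OF Hcont])
      have ic: "set_integrable MM R (\<lambda>p. c :: real)" for c using int_R[of "\<lambda>_ _. c"] by simp
      have iHc: "set_integrable MM R (\<lambda>p. H (fst p) (snd p) + 2 * \<epsilon>)" by (rule set_integral_add(1)[OF iH ic])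
      have "\<mu> j * \<tau> j \<le> (LINT p:X j \<times> Y j|MM. H (fst p) (snd p) + 2 * \<epsilon>)" if j: "j \<in> J" for j
      proof -
        have "\<mu> j * \<tau> j = (LINT p:X j \<times> Y j|MM. \<tau> j)"
          using set_integral_const[OF cell_m fin_cell[OF j], of "\<tau> j"] by (simp add: \<mu>_def)
        also have "\<dots> \<le> (LINT p:X j \<times> Y j|MM. H (fst p) (snd p) + 2 * \<epsilon>)"
          using \<tau>H[OF j]
          by (intro set_integral_mono set_integrable_subset[OF ic cell_m cell_R[OF j]] set_integrable_subset[OF iHc cell_m cell_R[OF j]]) auto
        finally show ?thesis .
      qed
      then have "(\<Sum>j\<in>J. \<mu> j * \<tau> j) \<le> (\<Sum>j\<in>J. LINT p:X j \<times> Y j|MM. H (fst p) (snd p) + 2 * \<epsilon>)" by (rule sum_mono)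
      also have "\<dots> = (LINT p:R|MM. H (fst p) (snd p) + 2 * \<epsilon>)"
        unfolding UN[symmetric]
        by (rule set_integral_finite_Union[symmetric, OF J disj set_integrable_subset[OF iHc cell_m cell_R] cell_m])
      also have "\<dots> = (LINT p:R|MM. H (fst p) (snd p)) + (LINT p:R|MM. 2 * \<epsilon>)" by (rule set_integral_add(2)[OF iH ic])
      also have "(LINT p:R|MM. 2 * \<epsilon>) = 2 * \<epsilon> * m" using set_integral_const[OF Rm Rfin, of "2 * \<epsilon>"] by (simp add: m_def mult.commute)
      finally show ?thesis unfolding I .
    qed
    have "v x y \<le> (\<Sum>j\<in>J. \<mu> j * \<tau> j) + \<epsilon>"
    proof (rule v_le_of_F[OF xy D0(1,2)])
      show "0 \<le> (\<Sum>j\<in>J. \<mu> j * \<tau> j) + \<epsilon>"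
        using C(4) \<epsilon>(1) by (intro add_nonneg_nonneg sum_nonneg) (auto simp: \<mu>_def)
      fix w assume w: "reach w"
      note aw = reach_admissible[OF w]
      \<comment> \<open>The single \<epsilon> is shared among the cells; the added 1 covers an empty
        index set.\<close>
      define \<epsilon>1 where "\<epsilon>1 = \<epsilon> / (real (card J) + 1)"
      have \<epsilon>1: "\<epsilon>1 > 0" "real (card J) * \<epsilon>1 \<le> \<epsilon>" using \<epsilon>(1) by (auto simp: \<epsilon>1_def field_simps)
      let ?f = "\<lambda>p. f (fst p) (snd p) (w (fst p) (snd p))"
      have "\<forall>j\<in>J. \<exists>ec. (\<forall>\<xi> :: 'a \<Rightarrow>\<^sub>L real. blinfun_apply \<xi> (fst ec) = (LINT p:X j \<times> Y j|MM. \<xi> (?f p))) \<and>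
          snd ec \<in> convex hull (C j) \<and> norm (fst ec - \<mu> j *\<^sub>R snd ec) \<le> \<mu> j * \<tau> j + \<epsilon>1"
      proof
        fix j assume j: "j \<in> J"
        show "\<exists>ec. (\<forall>\<xi> :: 'a \<Rightarrow>\<^sub>L real. blinfun_apply \<xi> (fst ec) = (LINT p:X j \<times> Y j|MM. \<xi> (?f p))) \<and>
          snd ec \<in> convex hull (C j) \<and> norm (fst ec - \<mu> j *\<^sub>R snd ec) \<le> \<mu> j * \<tau> j + \<epsilon>1"
        proof (cases "X j \<times> Y j = {}")
          case True
          obtain c where "c \<in> C j" using C(3)[OF j] by blast
          then have "c \<in> convex hull (C j)" by (rule hull_inc)
          moreover have "\<mu> j = 0" unfolding \<mu>_def True by simp
          ultimately show ?thesis unfolding True using \<epsilon>1(1) by (intro exI[of _ "(0, c)"]) (simp add: set_lebesgue_integral_def)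
        next
          case False
          obtain e' where e': "\<And>\<xi> :: 'a \<Rightarrow>\<^sub>L real. blinfun_apply \<xi> e' = (LINT p:X j \<times> Y j|MM. \<xi> (?f p))"
            and ap: "\<And>\<epsilon>. \<epsilon> > 0 \<Longrightarrow> \<exists>d \<in> convex hull (?f ` (X j \<times> Y j)). norm (e' - measure MM (X j \<times> Y j) *\<^sub>R d) \<le> \<epsilon>"
            by (rule pettis_f[OF aw cell_b cell_R[OF j, unfolded R_def] False zero(1) xy(1) zero(2) xy(2)], rule that)
          obtain d where d: "d \<in> convex hull (?f ` (X j \<times> Y j))" "norm (e' - \<mu> j *\<^sub>R d) \<le> \<epsilon>1"
            using ap[OF \<epsilon>1(1)] unfolding \<mu>_def by blast
          \<comment> \<open>The mean value \<open>d\<close> is a combination of values of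
            \<open>f\<close> on the cell, each within \<open>\<tau> j\<close> of \<open>C j\<close>,
            so \<open>d\<close> is that close to the hull of \<open>C j\<close>.\<close>
          have "\<exists>c\<in>convex hull (C j). norm (d - c) \<le> \<tau> j"
            by (rule convex_hull_near[OF _ d(1)]) (use near[OF j _ _ w] in auto)
          then obtain c where c: "c \<in> convex hull (C j)" "norm (d - c) \<le> \<tau> j" by blast
          have "norm (e' - \<mu> j *\<^sub>R c) \<le> norm (e' - \<mu> j *\<^sub>R d) + norm (\<mu> j *\<^sub>R (d - c))"
            using norm_triangle_ineq[of "e' - \<mu> j *\<^sub>R d" "\<mu> j *\<^sub>R (d - c)"] by (simp add: scaleR_diff_right)
          also have "\<dots> \<le> \<epsilon>1 + \<mu> j * \<tau> j"
            using d(2) c(2) by (intro add_mono) (auto simp: \<mu>_def intro: mult_left_mono)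
          finally show ?thesis using c(1) e' by (intro exI[of _ "(e', c)"]) simp
        qed
      qed
      from bchoice[OF this] obtain ec where ec: "\<forall>j\<in>J. (\<forall>\<xi> :: 'a \<Rightarrow>\<^sub>L real. blinfun_apply \<xi> (fst (ec j)) = (LINT p:X j \<times> Y j|MM. \<xi> (?f p))) \<and>
          snd (ec j) \<in> convex hull (C j) \<and> norm (fst (ec j) - \<mu> j *\<^sub>R snd (ec j)) \<le> \<mu> j * \<tau> j + \<epsilon>1" by (rule exE)
      have "F w x y = sg *\<^sub>R (\<Sum>j\<in>J. fst (ec j))"
      proof (rule functionals_eqI)
        fix \<xi> :: "'a \<Rightarrow>\<^sub>L real"
        have i\<xi>: "set_integrable MM R (\<lambda>p. \<xi> (?f p))" by (rule int_R[OF admissible_weakly_continuous[OF aw]])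
        have "\<xi> (F w x y) = sg * (LINT p:R|MM. \<xi> (?f p))"
          unfolding F_eq[OF aw xy] delta_integral2_def sg_def R_def by (simp add: case_prod_unfold)
        also have "(LINT p:R|MM. \<xi> (?f p)) = (\<Sum>j\<in>J. LINT p:X j \<times> Y j|MM. \<xi> (?f p))"
          unfolding UN[symmetric]
          by (rule set_integral_finite_Union[OF J disj set_integrable_subset[OF i\<xi> cell_m cell_R] cell_m])
        also have "\<dots> = (\<Sum>j\<in>J. \<xi> (fst (ec j)))" using ec by simp
        finally show "\<xi> (F w x y) = \<xi> (sg *\<^sub>R (\<Sum>j\<in>J. fst (ec j)))"
          by (simp add: blinfun.scaleR_right blinfun.sum_right)
      qed
      then have "F w x y - (\<Sum>j\<in>J. (sg * \<mu> j) *\<^sub>R snd (ec j)) = sg *\<^sub>R (\<Sum>j\<in>J. fst (ec j) - \<mu> j *\<^sub>R snd (ec j))"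
        by (simp add: scaleR_sum_right scaleR_diff_right sum_subtractf)
      moreover have "\<bar>sg\<bar> = 1" by (simp add: sg_def)
      ultimately have "norm (F w x y - (\<Sum>j\<in>J. (sg * \<mu> j) *\<^sub>R snd (ec j))) = norm (\<Sum>j\<in>J. fst (ec j) - \<mu> j *\<^sub>R snd (ec j))"
        by simp
      also have "\<dots> \<le> (\<Sum>j\<in>J. \<mu> j * \<tau> j + \<epsilon>1)" using ec by (intro sum_norm_le) auto
      also have "\<dots> \<le> (\<Sum>j\<in>J. \<mu> j * \<tau> j) + \<epsilon>" using \<epsilon>1(2) by (simp add: sum.distrib)
      finally show "\<exists>d\<in>D0. norm (F w x y - d) \<le> (\<Sum>j\<in>J. \<mu> j * \<tau> j) + \<epsilon>"
        using D0(3)[of "\<lambda>j. snd (ec j)"] ec by blast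
    qed
    then show "v x y \<le> \<bar>D 0 x 0 y H\<bar> + e" using sum_\<tau> \<epsilon>(2) by linarith
  qed
  then show "v x y \<le> \<bar>D 0 x 0 y (\<lambda>s t. h s t (v s t))\<bar>" by (simp add: H_def[abs_def])
qed

text \<open>Here the uniqueness hypothesis acts: \<open>v\<close> is a continuous nonnegative
  solution of the inequality that vanishes at the origin, hence zero everywhere.\<close>

lemma reach_weakly_seq_compact:
  assumes "x \<in> T1" "y \<in> T2"
  shows "weakly_seq_compact (VS {x} {y})"
proof -
  have "v x y = 0" using h_unique[of v] v_continuous v_nonneg v_minorant v_origin assms by blast
  then show ?thesis using bounded_VS_point[OF assms] unfolding v_def by (intro deblasi_zero_imp_seq_compact)
qed

end

section \<open>Existence of a weak solution\<close>

text \<open>The derivative reads values on \<open>T\<close> and at the jump, and the jump lies in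
  \<open>T\<close> because \<open>T\<close> is closed.\<close>

lemma has_delta_deriv_cong:
  assumes "time_scale T" "t \<in> T" "\<And>x. x \<in> T \<Longrightarrow> \<psi> x = \<psi>' x"
  shows "has_delta_deriv T \<psi> d t \<longleftrightarrow> has_delta_deriv T \<psi>' d t"
proof -
  have "\<psi> (fjump T t) = \<psi>' (fjump T t)" using assms(3) fjump_mem[OF assms(1,2)] by simp
  then show ?thesis
    unfolding has_delta_deriv_def
    by (intro arg_cong[where f = All] arg_cong[where f = Ex] ext imp_cong conj_cong ball_cong refl)
       (use assms(3) in auto)
qed

context weak_problem_separable
begin

text \<open>\<open>reach\<close> offers only combinations of two functions, so the last one is split
  off and the other weights are rescaled; a last weight of 1 is separate because the rescaling would
  divide by 0.\<close>

lemma reach_comb: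
  assumes "\<And>i. i < n \<Longrightarrow> reach (w i)" "t \<in> fun_simplex n"
  shows "reach (\<lambda>x y. \<Sum>i<n. t i *\<^sub>R w i x y)"
  using assms
proof (induction n arbitrary: t)
  case 0
  then show ?case by (simp add: fun_simplex_def)
next
  case (Suc n)
  have t: "\<And>i. i \<le> n \<Longrightarrow> 0 \<le> t i" "(\<Sum>i<n. t i) = 1 - t n" using Suc.prems(2) by (auto simp: fun_simplex_def)
  then have sum0: "0 \<le> 1 - t n" using sum_nonneg[of "{..<n}" t] by auto
  show ?case
  proof (cases "1 - t n = 0")
    case True
    then have "\<forall>i\<in>{..<n}. t i = 0" using t by (subst sum_nonneg_eq_0_iff[symmetric]) auto
    then have "(\<lambda>x y. \<Sum>i<Suc n. t i *\<^sub>R w i x y) = w n" using True by (intro ext) simp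
    then show ?thesis using Suc.prems(1)[of n] by simp
  next
    case False
    define a where "a = 1 - t n"
    have a: "a > 0" using False sum0 by (simp add: a_def)
    define t' where "t' i = (if i < n then t i / a else 0)" for i
    have "(\<Sum>i<n. t' i) = (\<Sum>i<n. t i) / a" by (simp add: t'_def sum_divide_distrib)
    then have "t' \<in> fun_simplex n" using a t by (auto simp: fun_simplex_def t'_def a_def)
    then have "reach (\<lambda>x y. \<Sum>i<n. t' i *\<^sub>R w i x y)" using Suc.prems(1) by (intro Suc.IH) auto
    then have "reach (\<lambda>x y. a *\<^sub>R (\<Sum>i<n. t' i *\<^sub>R w i x y) + t n *\<^sub>R w n x y)"
      using Suc.prems(1)[of n] a t(1)[of n] by (intro reach_convex) (auto simp: a_def)
    moreover have "a *\<^sub>R (\<Sum>i<n. t' i *\<^sub>R w i x y) = (\<Sum>i<n. t i *\<^sub>R w i x y)" for x y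
      using a by (simp add: t'_def scaleR_sum_right)
    ultimately show ?thesis by simp
  qed
qed

text \<open>The pairing function lists all tests, a norming functional at a dense point, in one
  sequence. The \<open>m\<close>-th approximation satisfies the first \<open>m\<close> of them, so
  each test is met by all later approximations.\<close>

lemma approximate_solution:
  fixes \<xi> :: "nat \<Rightarrow> 'a \<Rightarrow>\<^sub>L real" and q :: "nat \<Rightarrow> real \<times> real"
  assumes \<xi>: "\<And>k. norm (\<xi> k) \<le> 1" and q: "\<And>i. q i \<in> T1 \<times> T2"
  obtains z where "reach z"
    "\<And>k i. prod_encode (k, i) < m \<Longrightarrow> \<bar>\<xi> k (z (fst (q i)) (snd (q i))) - \<xi> k (F z (fst (q i)) (snd (q i)))\<bar> \<le> 1 / real (Suc m)"
proof -
  define p where "p j = q (snd (prod_decode j))" for j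
  define \<Lambda> where "\<Lambda> z j = \<xi> (fst (prod_decode j)) (z (fst (p j)) (snd (p j)))" for z :: "real \<Rightarrow> real \<Rightarrow> 'a" and j
  have p: "fst (p j) \<in> T1" "snd (p j) \<in> T2" for j using q[of "snd (prod_decode j)"] by (auto simp: p_def mem_Times_iff)
  have bdd: "\<bar>\<Lambda> z j\<bar> \<le> (\<Sum>j<m. g0 (fst (p j)) (snd (p j)))" if "z \<in> Collect reach" "j < m" for z j
  proof -
    have "\<bar>\<Lambda> z j\<bar> \<le> norm (z (fst (p j)) (snd (p j)))" unfolding \<Lambda>_def by (rule blinfun_le_norm[OF \<xi>])
    also have "\<dots> \<le> g0 (fst (p j)) (snd (p j))"
      using that(1) p by (intro admissibleD(2)[OF reach_admissible]) auto
    also have "\<dots> \<le> (\<Sum>j<m. g0 (fst (p j)) (snd (p j)))"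
      using that(2) g0_nonneg[OF p] by (intro member_le_sum) auto
    finally show ?thesis .
  qed
  \<comment> \<open>With finitely many \<open>w i\<close> fixed, convergent weights give norm
    convergence at each point, so weak sequential continuity of \<open>F\<close> is enough for
    Brouwer's theorem.\<close>
  have cont: "(\<lambda>k. \<Lambda> (F (\<lambda>x y. \<Sum>i<n. t k i *\<^sub>R w i x y)) j) \<longlonglongrightarrow> \<Lambda> (F (\<lambda>x y. \<Sum>i<n. l i *\<^sub>R w i x y)) j"
    if w: "\<And>i. i < n \<Longrightarrow> w i \<in> Collect reach" and t: "\<And>k. t k \<in> fun_simplex n" "l \<in> fun_simplex n" "\<And>i. (\<lambda>k. t k i) \<longlonglongrightarrow> l i"
    for n w t l j
  proof -
    have "weakly_tendsto (\<lambda>k. F (\<lambda>x y. \<Sum>i<n. t k i *\<^sub>R w i x y) (fst (p j)) (snd (p j))) (F (\<lambda>x y. \<Sum>i<n. l i *\<^sub>R w i x y) (fst (p j)) (snd (p j)))"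
      using w t p
      by (intro F_weakly_tendsto reach_admissible reach_comb tendsto_imp_weakly_tendsto tendsto_sum tendsto_scaleR tendsto_const) auto
    then show ?thesis by (simp add: weakly_tendsto_def \<Lambda>_def)
  qed
  obtain z where "z \<in> Collect reach" "\<And>j. j < m \<Longrightarrow> \<bar>\<Lambda> z j - \<Lambda> (F z) j\<bar> \<le> 1 / real (Suc m)"
  proof (rule approximate_fixed_point[of "Collect reach" F m \<Lambda> "\<Sum>j<m. g0 (fst (p j)) (snd (p j))" "\<lambda>n w t x y. \<Sum>i<n. t i *\<^sub>R w i x y" "1 / real (Suc m)"])
    show "Collect reach \<noteq> {}" using reach_zero by blast
    show "F z \<in> Collect reach" if "z \<in> Collect reach" for z using that reach_F by simp
    show "(\<lambda>x y. \<Sum>i<n. t i *\<^sub>R w i x y) \<in> Collect reach" if "\<And>i. i < n \<Longrightarrow> w i \<in> Collect reach" "t \<in> fun_simplex n" for n w t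
      using that reach_comb by simp
    show "\<Lambda> (\<lambda>x y. \<Sum>i<n. t i *\<^sub>R w i x y) j = (\<Sum>i<n. t i * \<Lambda> (w i) j)" for n w t j
      by (simp add: \<Lambda>_def blinfun.sum_right blinfun.scaleR_right)
  qed (use bdd cont in \<open>blast | simp\<close>)+
  then show thesis using that[of z] by (force simp: \<Lambda>_def p_def)
qed

lemma admissible_weak_limit:
  assumes u: "\<And>n. admissible (u n)" and lim: "\<And>x y. x \<in> T1 \<Longrightarrow> y \<in> T2 \<Longrightarrow> weakly_tendsto (\<lambda>n. u n x y) (z x y)"
  shows "admissible z"
  unfolding admissible_def
proof (intro conjI ballI)
  fix x y assume xy: "x \<in> T1" "y \<in> T2"
  show "z x y \<in> closure S"
    by (rule closed_subspace_weakly_closed[OF S(2) closed_closure lim[OF xy]]) (rule admissibleD(1)[OF u xy(1,1) xy(2,2)])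
  show "norm (z x y) \<le> g0 x y"
    by (rule weakly_tendsto_norm_le[OF lim[OF xy]]) (rule admissibleD(2)[OF u xy(1,1) xy(2,2)])
next
  fix x1 x2 y1 y2 assume xy: "x1 \<in> T1" "x2 \<in> T1" "y1 \<in> T2" "y2 \<in> T2"
  show "norm (z x1 y1 - z x2 y2) \<le> \<bar>D 0 x2 y1 y2 g\<bar> + \<bar>D x1 x2 0 y1 g\<bar>"
    by (rule weakly_tendsto_norm_le[OF weakly_tendsto_diff[OF lim[OF xy(1,3)] lim[OF xy(2,4)]]]) (rule admissibleD(3)[OF u xy])
  show "norm (z x2 y2 - z x2 y1 - z x1 y2 + z x1 y1) \<le> \<bar>D x1 x2 y1 y2 g\<bar>"
    by (rule weakly_tendsto_norm_le[OF weakly_tendsto_add[OF weakly_tendsto_diff[OF weakly_tendsto_diff[OF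
          lim[OF xy(2,4)] lim[OF xy(2,3)]] lim[OF xy(1,4)]] lim[OF xy(1,3)]]]) (rule admissibleD(4)[OF u xy])
qed

text \<open>A diagonal subsequence converges weakly at countably many dense points only.
  Equicontinuity carries convergence of norming coordinates to every point, and pointwise
  compactness upgrades it to weak convergence. The equation holds on the dense set and extends by
  norm continuity of both sides.\<close>

lemma fixed_point_exists:
  obtains z where "admissible z" "\<And>x y. x \<in> T1 \<Longrightarrow> y \<in> T2 \<Longrightarrow> z x y = F z x y"
proof -
  obtain \<xi> where \<xi>: "norming_for (closure S) \<xi>" by (rule norming_sequence[OF S])
  then have \<xi>1: "norm (\<xi> k) \<le> 1" for k by (simp add: norming_for_def)
  have "closure (\<rat> \<times> \<rat>) = (UNIV :: (real \<times> real) set)" by (simp add: closure_Times Rats_closure_real)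
  then have dense: "T1 \<times> T2 \<subseteq> closure (\<rat> \<times> \<rat>)" by simp
  have cnt: "countable (\<rat> \<times> \<rat> :: (real \<times> real) set)" by (intro countable_SIGMA countable_rat)
  obtain Q where Q: "countable Q" "Q \<subseteq> T1 \<times> T2" "T1 \<times> T2 \<subseteq> closure Q"
    by (rule separable_subset[OF cnt dense])
  have "Q \<noteq> {}" using Q(3) zero by auto
  then have Q_rng: "range (from_nat_into Q) = Q" using Q(1) by (rule range_from_nat_into)
  define q where "q = from_nat_into Q"
  have qT: "q i \<in> T1 \<times> T2" for i using Q_rng Q(2) by (auto simp: q_def)
  have "\<exists>z. reach z \<and> (\<forall>k i. prod_encode (k, i) < m \<longrightarrow>
      \<bar>\<xi> k (z (fst (q i)) (snd (q i))) - \<xi> k (F z (fst (q i)) (snd (q i)))\<bar> \<le> 1 / real (Suc m))" for m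
    by (rule approximate_solution[of \<xi> q m, OF \<xi>1 qT]) blast
  then have "\<forall>m. \<exists>z. reach z \<and> (\<forall>k i. prod_encode (k, i) < m \<longrightarrow>
      \<bar>\<xi> k (z (fst (q i)) (snd (q i))) - \<xi> k (F z (fst (q i)) (snd (q i)))\<bar> \<le> 1 / real (Suc m))" by (rule allI)
  from choice[OF this] obtain u where u: "\<forall>m. reach (u m) \<and> (\<forall>k i. prod_encode (k, i) < m \<longrightarrow>
      \<bar>\<xi> k (u m (fst (q i)) (snd (q i))) - \<xi> k (F (u m) (fst (q i)) (snd (q i)))\<bar> \<le> 1 / real (Suc m))" by (rule exE)
  have ru: "reach (u m)" and au: "admissible (u m)" for m using u reach_admissible by auto
  have mem: "u n x y \<in> VS {x} {y}" for n x y using ru[of n] by (auto simp: value_set_def)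
  have Qc: "weakly_seq_compact (VS {fst p} {snd p})" if "p \<in> Q" for p
    using that Q(2) by (intro reach_weakly_seq_compact) auto
  obtain s :: "nat \<Rightarrow> nat" where s: "strict_mono s"
    and sQ: "\<And>p. p \<in> Q \<Longrightarrow> \<exists>l. weakly_tendsto ((\<lambda>n. u n (fst p) (snd p)) \<circ> s) l"
    by (rule diagonal_weak_subseq[of Q "\<lambda>p. VS {fst p} {snd p}" "\<lambda>p n. u n (fst p) (snd p)", OF Q(1) Qc mem], assumption, rule that)
  define w where "w n = u (s n)" for n
  have aw: "admissible (w n)" for n by (simp add: w_def au)
  have "\<exists>l. weakly_tendsto (\<lambda>n. w n (fst p) (snd p)) l" if p: "p \<in> T1 \<times> T2" for p
  proof -
    have mS: "w n (fst p) (snd p) \<in> closure S" for n using admissibleD(1)[OF aw, of "fst p" "fst p" "snd p" "snd p"] p by auto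
    have conv: "convergent (\<lambda>n. \<xi> k (w n (fst p) (snd p)))" for k
    proof (rule Cauchy_convergent, rule metric_CauchyI)
      fix e :: real assume "e > 0"
      define r where "r = \<bar>fst p\<bar> + \<bar>snd p\<bar> + 1"
      obtain L where L: "L \<ge> 0" "\<And>z x1 x2 y1 y2. admissible z \<Longrightarrow> x1 \<in> {- r..r} \<inter> T1 \<Longrightarrow> x2 \<in> {- r..r} \<inter> T1 \<Longrightarrow>
          y1 \<in> {- r..r} \<inter> T2 \<Longrightarrow> y2 \<in> {- r..r} \<inter> T2 \<Longrightarrow> norm (z x1 y1 - z x2 y2) \<le> L * (\<bar>x2 - x1\<bar> + \<bar>y2 - y1\<bar>)"
        by (rule admissible_Lipschitz[of r], rule that)
      \<comment> \<open>The bound 1 keeps \<open>p'\<close> in the square of radius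
        \<open>r\<close>; the factor 6 makes the change from \<open>p\<close> to \<open>p'\<close>
        at most a third of \<open>e\<close>, with two such changes in the Cauchy estimate.\<close>
      define d where "d = min 1 (e / 6 / (L + 1))"
      have d: "d > 0" "d \<le> 1" "6 * (L * d) \<le> e"
      proof -
        show "d > 0" using \<open>e > 0\<close> L(1) by (simp add: d_def)
        have "L * d \<le> (L + 1) * (e / 6 / (L + 1))" using L(1) \<open>e > 0\<close> by (intro mult_mono) (auto simp: d_def)
        moreover have "(L + 1) * (c / (L + 1)) = c" for c using L(1) by simp
        ultimately show "6 * (L * d) \<le> e" by (simp only:)
      qed (simp add: d_def)
      have "p \<in> closure Q" using Q(3) p by blast
      then obtain p' where p': "p' \<in> Q" "dist p' p < d" unfolding closure_approachable using d(1) by blast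
      have near: "\<bar>fst p' - fst p\<bar> < d" "\<bar>snd p' - snd p\<bar> < d"
        using p'(2) dist_fst_le[of p' p] dist_snd_le[of p' p] by (auto simp: dist_real_def)
      have diff: "\<bar>\<xi> k (w n (fst p) (snd p)) - \<xi> k (w n (fst p') (snd p'))\<bar> \<le> e / 3" for n
      proof -
        have "norm (w n (fst p) (snd p) - w n (fst p') (snd p')) \<le> L * (\<bar>fst p' - fst p\<bar> + \<bar>snd p' - snd p\<bar>)"
        proof (rule L(2)[OF aw])
          show "fst p \<in> {- r..r} \<inter> T1" "snd p \<in> {- r..r} \<inter> T2" using p by (auto simp: r_def)
          show "fst p' \<in> {- r..r} \<inter> T1" "snd p' \<in> {- r..r} \<inter> T2"
            using p'(1) Q(2) near d(2) unfolding r_def by auto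
        qed
        also have "\<dots> \<le> L * (d + d)" using near L(1) by (intro mult_left_mono) auto
        also have "\<dots> \<le> e / 3" using d(3) by (simp add: distrib_left)
        finally show ?thesis
          using blinfun_le_norm[OF \<xi>1[of k], of "w n (fst p) (snd p) - w n (fst p') (snd p')"] by (simp add: blinfun.diff_right)
      qed
      obtain l where "weakly_tendsto ((\<lambda>n. u n (fst p') (snd p')) \<circ> s) l" using sQ[OF p'(1)] by blast
      then have "(\<lambda>n. \<xi> k (w n (fst p') (snd p'))) \<longlonglongrightarrow> \<xi> k l" by (simp add: weakly_tendsto_def w_def)
      then have "Cauchy (\<lambda>n. \<xi> k (w n (fst p') (snd p')))" by (rule LIMSEQ_imp_Cauchy)
      then obtain N where N: "\<And>m n. m \<ge> N \<Longrightarrow> n \<ge> N \<Longrightarrow> dist (\<xi> k (w m (fst p') (snd p'))) (\<xi> k (w n (fst p') (snd p'))) < e / 3"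
        using metric_CauchyD[of _ "e / 3"] \<open>e > 0\<close> by (metis divide_pos_pos zero_less_numeral)
      show "\<exists>N. \<forall>m\<ge>N. \<forall>n\<ge>N. dist (\<xi> k (w m (fst p) (snd p))) (\<xi> k (w n (fst p) (snd p))) < e"
      proof (intro exI[of _ N] allI impI)
        fix m n assume "m \<ge> N" "n \<ge> N"
        from N[OF this] diff[of m] diff[of n]
        show "dist (\<xi> k (w m (fst p) (snd p))) (\<xi> k (w n (fst p) (snd p))) < e" unfolding dist_real_def by linarith
      qed
    qed
    have wsc: "weakly_seq_compact (VS {fst p} {snd p})" using p by (intro reach_weakly_seq_compact) auto
    have mV: "w n (fst p) (snd p) \<in> VS {fst p} {snd p}" for n unfolding w_def by (rule mem)
    show ?thesis
      by (rule weakly_seq_compact_tendsto[of "VS {fst p} {snd p}" "\<lambda>n. w n (fst p) (snd p)" "closure S" \<xi>,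
            OF wsc mV S(2) closed_closure mS \<xi> conv]) (rule exI)
  qed
  then have "\<forall>p\<in>T1 \<times> T2. \<exists>l. weakly_tendsto (\<lambda>n. w n (fst p) (snd p)) l" by blast
  from bchoice[OF this] obtain l where l: "\<forall>p\<in>T1 \<times> T2. weakly_tendsto (\<lambda>n. w n (fst p) (snd p)) (l p)" by (rule exE)
  define z where "z x y = l (x, y)" for x y
  have lim: "weakly_tendsto (\<lambda>n. w n x y) (z x y)" if "x \<in> T1" "y \<in> T2" for x y
    using l[rule_format, of "(x, y)"] that by (simp add: z_def)
  have az: "admissible z" by (rule admissible_weak_limit[OF aw lim])
  note aF = F_admissible[OF az]
  have eqQ: "z (fst p) (snd p) = F z (fst p) (snd p)" if p: "p \<in> Q" for p
  proof -
    have pT: "fst p \<in> T1" "snd p \<in> T2" using p Q(2) by auto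
    obtain i where i: "p = q i" using p Q_rng by (auto simp: q_def)
    show ?thesis
    proof (rule norming_for_eqI[OF \<xi> S(2)])
      show "z (fst p) (snd p) \<in> closure S" by (rule admissibleD(1)[OF az pT(1,1) pT(2,2)])
      show "F z (fst p) (snd p) \<in> closure S" by (rule admissibleD(1)[OF aF pT(1,1) pT(2,2)])
      fix k
      have "(\<lambda>n. \<xi> k (w n (fst p) (snd p)) - \<xi> k (F (w n) (fst p) (snd p))) \<longlonglongrightarrow> \<xi> k (z (fst p) (snd p)) - \<xi> k (F z (fst p) (snd p))"
        using lim[OF pT] F_weakly_tendsto[OF aw az lim pT] unfolding weakly_tendsto_def by (intro tendsto_diff) auto
      moreover have "(\<lambda>n. \<xi> k (w n (fst p) (snd p)) - \<xi> k (F (w n) (fst p) (snd p))) \<longlonglongrightarrow> 0"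
      proof (rule Lim_null_comparison)
        have "norm (\<xi> k (w n (fst p) (snd p)) - \<xi> k (F (w n) (fst p) (snd p))) \<le> 1 / real (Suc n)"
          if "n > prod_encode (k, i)" for n
        proof -
          \<comment> \<open>Passing to a subsequence only improves the approximation and retains
            every test already met.\<close>
          have "n \<le> s n" by (rule seq_suble[OF s])
          then have "norm (\<xi> k (w n (fst p) (snd p)) - \<xi> k (F (w n) (fst p) (snd p))) \<le> 1 / real (Suc (s n))"
            using u[rule_format, of "s n"] that by (simp add: w_def i)
          also have "\<dots> \<le> 1 / real (Suc n)" using \<open>n \<le> s n\<close> by (intro divide_left_mono) auto
          finally show ?thesis .
        qed
        then show "eventually (\<lambda>n. norm (\<xi> k (w n (fst p) (snd p)) - \<xi> k (F (w n) (fst p) (snd p))) \<le> 1 / real (Suc n)) sequentially"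
          by (rule eventually_mono[OF eventually_gt_at_top])
        show "(\<lambda>n. 1 / real (Suc n)) \<longlonglongrightarrow> 0" using LIMSEQ_inverse_real_of_nat by (simp add: inverse_eq_divide)
      qed
      ultimately have "\<xi> k (z (fst p) (snd p)) - \<xi> k (F z (fst p) (snd p)) = 0" by (rule LIMSEQ_unique)
      then show "\<xi> k (z (fst p) (snd p)) = \<xi> k (F z (fst p) (snd p))" by simp
    qed
  qed
  show thesis
  proof (rule that[OF az])
    fix x y assume xy: "x \<in> T1" "y \<in> T2"
    then have "(x, y) \<in> closure Q" using Q(3) by auto
    then obtain r where r: "\<And>n. r n \<in> Q" "r \<longlonglongrightarrow> (x, y)" unfolding closure_sequential by blast
    have ev: "eventually (\<lambda>n. r n \<in> T1 \<times> T2) sequentially" using r(1) Q(2) by (intro always_eventually allI) blast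
    have "(\<lambda>n. z (fst (r n)) (snd (r n))) \<longlonglongrightarrow> z x y"
      using continuous_on_tendsto_compose[OF admissible_continuous[OF az] r(2) _ ev] xy by (simp add: case_prod_unfold)
    moreover have "(\<lambda>n. F z (fst (r n)) (snd (r n))) \<longlonglongrightarrow> F z x y"
      using continuous_on_tendsto_compose[OF admissible_continuous[OF aF] r(2) _ ev] xy by (simp add: case_prod_unfold)
    ultimately show "z x y = F z x y" unfolding eqQ[OF r(1)] by (rule LIMSEQ_unique)
  qed
qed

text \<open>The integral over \<open>t\<close> alone, for fixed \<open>x\<close>, will be the inner
  weak derivative. It has to exist as a vector of the space, not merely as a family of scalar
  integrals.\<close>

lemma section_integral:
  assumes z: "admissible z" and xy: "x \<in> T1" "y \<in> T2"
  obtains e where "\<And>\<xi> :: 'a \<Rightarrow>\<^sub>L real. blinfun_apply \<xi> e = delta_integral1 T2 0 y (\<lambda>t. \<xi> (f x t (z x t)))"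
proof (cases "{min 0 y..<max 0 y} \<inter> T2 = {}")
  case True
  then have eq0: "indicator T2 t * ori 0 y t = 0" for t by (auto simp: ori_eq indicator_def)
  have "blinfun_apply \<xi> 0 = delta_integral1 T2 0 y (\<lambda>t. \<xi> (f x t (z x t)))" for \<xi> :: "'a \<Rightarrow>\<^sub>L real"
    unfolding delta_integral1_def eq0 by simp
  then show thesis by (rule that)
next
  case False
  let ?R = "{min 0 y..<max 0 y} \<inter> T2"
  have R: "?R \<in> sets borel" using closed_ts by auto
  then have Rm: "?R \<in> sets (delta_measure T2)" by simp
  have "min 0 y \<in> T2" "max 0 y \<in> T2" using xy zero by (auto simp: min_def max_def)
  then have fin: "emeasure (delta_measure T2) ?R < \<infinity>" by (subst emeasure_delta_Int[OF ts(2)]) auto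
  have im: "(\<lambda>t. f x t (z x t)) ` ?R \<subseteq> closure S"
    using xy(1) f_closure admissibleD(1)[OF z xy(1,1)] by auto
  have meas: "(\<lambda>t. indicator ?R t *\<^sub>R \<xi> (f x t (z x t))) \<in> borel_measurable (delta_measure T2)" for \<xi> :: "'a \<Rightarrow>\<^sub>L real"
  proof -
    have "continuous_on T2 (\<lambda>t. \<xi> (f x t (z x t)))" by (rule continuous_section[OF admissible_weakly_continuous[OF z] xy(1)])
    then have "continuous_on ?R (\<lambda>t. \<xi> (f x t (z x t)))" by (rule continuous_on_subset) auto
    from borel_measurable_continuous_on_indicator[OF R this] show ?thesis by simp
  qed
  obtain M where M: "\<And>s t. s \<in> {x..x} \<inter> T1 \<Longrightarrow> t \<in> {min 0 y..max 0 y} \<inter> T2 \<Longrightarrow> \<bar>g s t\<bar> \<le> M"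
    by (rule g_bounded_on_rect[of x x "min 0 y" "max 0 y"]) (rule that)
  have bdd: "norm (f x t (z x t)) \<le> M" if "t \<in> ?R" for t
    using admissible_f_bound[OF z xy(1), of t] M[of x t] that xy(1) by auto
  obtain e where e: "\<And>\<xi> :: 'a \<Rightarrow>\<^sub>L real. blinfun_apply \<xi> e = (LINT t:?R|delta_measure T2. \<xi> (f x t (z x t)))"
    by (rule pettis_set_integral[OF Rm fin False S(1) im meas bdd], assumption, rule that)
  have "blinfun_apply \<xi> ((if 0 \<le> y then 1 else - 1) *\<^sub>R e) = delta_integral1 T2 0 y (\<lambda>t. \<xi> (f x t (z x t)))" for \<xi> :: "'a \<Rightarrow>\<^sub>L real"
    unfolding blinfun.scaleR_right e delta_integral1_def set_lebesgue_integral_def real_scaleR_def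
    by (subst integral_mult_right_zero[symmetric], intro Bochner_Integration.integral_cong) (auto simp: ori_eq indicator_def)
  then show thesis by (rule that)
qed

text \<open>Fubini's theorem makes each functional of \<open>z\<close> an iterated integral with
  continuous integrands, so one fundamental theorem in one variable is applied twice, first outside
  and then inside.\<close>

lemma weak_solution_exists: "\<exists>z. weak_solution T1 T2 f z"
proof -
  obtain z where z: "admissible z" "\<And>x y. x \<in> T1 \<Longrightarrow> y \<in> T2 \<Longrightarrow> z x y = F z x y" by (rule fixed_point_exists) (rule that)
  have "\<exists>e. \<forall>\<xi> :: 'a \<Rightarrow>\<^sub>L real. blinfun_apply \<xi> e = delta_integral1 T2 0 y (\<lambda>t. \<xi> (f x t (z x t)))"
    if "x \<in> T1" "y \<in> T2" for x y by (rule section_integral[OF z(1) that]) blast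
  then have "\<forall>p\<in>T1 \<times> T2. \<exists>e. \<forall>\<xi> :: 'a \<Rightarrow>\<^sub>L real. blinfun_apply \<xi> e = delta_integral1 T2 0 (snd p) (\<lambda>t. \<xi> (f (fst p) t (z (fst p) t)))"
    by auto
  from bchoice[OF this] obtain zG where
    zG: "\<forall>p\<in>T1 \<times> T2. \<forall>\<xi> :: 'a \<Rightarrow>\<^sub>L real. blinfun_apply \<xi> (zG p) = delta_integral1 T2 0 (snd p) (\<lambda>t. \<xi> (f (fst p) t (z (fst p) t)))"
    by (rule exE)
  have zG: "blinfun_apply \<xi> (zG (x, y)) = delta_integral1 T2 0 y (\<lambda>t. \<xi> (f x t (z x t)))"
    if "x \<in> T1" "y \<in> T2" for x y and \<xi> :: "'a \<Rightarrow>\<^sub>L real" using zG that by simp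
  note wc = admissible_weakly_continuous[OF z(1)]
  have dG: "has_Gamma_weak_deriv T1 z (zG (x, y)) x y" if xy: "x \<in> T1" "y \<in> T2" for x y
    unfolding has_Gamma_weak_deriv_def
  proof
    fix \<xi> :: "'a \<Rightarrow>\<^sub>L real"
    \<comment> \<open>The fixed point equation is rewritten for every \<open>x'\<close> in
      \<open>T1\<close>, since differentiation needs it at neighbouring points and at the forward
      jump.\<close>
    have "\<xi> (z x' y) = delta_integral1 T1 0 x' (\<lambda>s. delta_integral1 T2 0 y (\<lambda>t. \<xi> (f s t (z s t))))" if x': "x' \<in> T1" for x'
      unfolding z(2)[OF x' xy(2)] F_eq[OF z(1) x' xy(2)] by (rule delta_integral2_Fubini[OF wc zero(1) x' zero(2) xy(2)])
    then have "has_delta_deriv T1 (\<lambda>x. \<xi> (z x y)) (\<xi> (zG (x, y))) x \<longleftrightarrow>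
        has_delta_deriv T1 (\<lambda>x'. delta_integral1 T1 0 x' (\<lambda>s. delta_integral1 T2 0 y (\<lambda>t. \<xi> (f s t (z s t))))) (\<xi> (zG (x, y))) x"
      by (rule has_delta_deriv_cong[OF ts(1) xy(1)])
    then show "has_delta_deriv T1 (\<lambda>x. \<xi> (z x y)) (\<xi> (zG (x, y))) x"
      using delta_integral1_deriv[OF ts(1) zero(1) xy(1) continuous_delta_integral1[OF wc zero(2) xy(2)]] zG[OF xy] by simp
  qed
  have dD: "has_Delta_weak_deriv T2 (\<lambda>x y. zG (x, y)) (f x y (z x y)) x y" if xy: "x \<in> T1" "y \<in> T2" for x y
    unfolding has_Delta_weak_deriv_def
  proof
    fix \<xi> :: "'a \<Rightarrow>\<^sub>L real"
    have "has_delta_deriv T2 (\<lambda>y. \<xi> (zG (x, y))) (\<xi> (f x y (z x y))) y \<longleftrightarrow>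
        has_delta_deriv T2 (\<lambda>y. delta_integral1 T2 0 y (\<lambda>t. \<xi> (f x t (z x t)))) (\<xi> (f x y (z x y))) y"
      using zG[OF xy(1)] by (intro has_delta_deriv_cong[OF ts(2) xy(2)]) auto
    then show "has_delta_deriv T2 (\<lambda>y. \<xi> (zG (x, y))) (\<xi> (f x y (z x y))) y"
      using delta_integral1_deriv[OF ts(2) zero(2) xy(2) continuous_section[OF wc xy(1)]] by simp
  qed
  have "weakly_continuous_on2 T1 T2 z"
    unfolding weakly_continuous_on2_def
  proof
    fix \<xi> :: "'a \<Rightarrow>\<^sub>L real"
    show "continuous_on (T1 \<times> T2) (\<lambda>(x, y). \<xi> (z x y))"
      using continuous_on_compose2[OF linear_continuous_on[OF blinfun.bounded_linear_right[of \<xi>], of UNIV] admissible_continuous[OF z(1)]]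
      by (simp add: case_prod_unfold)
  qed
  moreover have "z x 0 = 0" if "x \<in> T1" for x using z(2)[OF that zero(2)] F_axis(1)[OF z(1) that] by simp
  moreover have "z 0 y = 0" if "y \<in> T2" for y using z(2)[OF zero(1) that] F_axis(2)[OF z(1) that] by simp
  moreover have "\<forall>x\<in>tskappa T1. \<forall>y\<in>T2. has_Gamma_weak_deriv T1 z (zG (x, y)) x y"
    using dG by (auto simp: tskappa_def)
  moreover have "\<forall>x\<in>tskappa T1. \<forall>y\<in>tskappa T2. has_Delta_weak_deriv T2 (\<lambda>x y. zG (x, y)) (f x y (z x y)) x y"
    using dD by (auto simp: tskappa_def)
  ultimately show ?thesis
    unfolding weak_solution_def by (intro exI[of _ z] exI[of _ "\<lambda>x y. zG (x, y)"] conjI ballI) auto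
qed

end

theorem theorem3p1:
  fixes T1 T2 :: "real set"
    and G h :: "real \<Rightarrow> real \<Rightarrow> real \<Rightarrow> real"
    and g0 :: "real \<Rightarrow> real \<Rightarrow> real"
    and f :: "real \<Rightarrow> real \<Rightarrow> 'a::banach \<Rightarrow> 'a"
  assumes T1: "time_scale T1" "0 \<in> T1"
    and T2: "time_scale T2" "0 \<in> T2"
    and G_nonneg: "\<And>x y r. x \<in> T1 \<Longrightarrow> y \<in> T2 \<Longrightarrow> r \<ge> 0 \<Longrightarrow> G x y r \<ge> 0"
    and G_cont: "continuous_on (T1 \<times> T2 \<times> {0..}) (\<lambda>(x, y, r). G x y r)"
    and G_mono: "\<And>x y. x \<in> T1 \<Longrightarrow> y \<in> T2 \<Longrightarrow> mono_on {0..} (G x y)"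
    and g0_nonneg: "\<And>x y. x \<in> T1 \<Longrightarrow> y \<in> T2 \<Longrightarrow> g0 x y \<ge> 0"
    and g0_bdd: "locally_bounded2 T1 T2 g0"
    and g0_sol: "majorant_solution T1 T2 G g0"
    and h_nonneg: "\<And>x y r. x \<in> T1 \<Longrightarrow> y \<in> T2 \<Longrightarrow> r \<ge> 0 \<Longrightarrow> h x y r \<ge> 0"
    and h_cont: "continuous_on (T1 \<times> T2 \<times> {0..}) (\<lambda>(x, y, r). h x y r)"
    and h_zero: "\<And>x y. x \<in> T1 \<Longrightarrow> y \<in> T2 \<Longrightarrow> h x y 0 = 0"
    and h_unique: "\<And>u. continuous_on (T1 \<times> T2) (\<lambda>(x, y). u x y) \<Longrightarrow>
          (\<forall>x\<in>T1. \<forall>y\<in>T2. u x y \<ge> 0) \<Longrightarrow> minorant_solution T1 T2 h u \<Longrightarrow> u 0 0 = 0 \<Longrightarrow>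
          (\<forall>x\<in>T1. \<forall>y\<in>T2. u x y = 0)"
    and C1: "\<And>x y u l. x \<in> T1 \<Longrightarrow> y \<in> T2 \<Longrightarrow> weakly_tendsto u l \<Longrightarrow>
          weakly_tendsto (\<lambda>n. f x y (u n)) (f x y l)"
    and C2: "\<And>z. strongly_AC2 T1 T2 z \<Longrightarrow> weakly_continuous_on2 T1 T2 (\<lambda>x y. f x y (z x y))"
    and C3: "\<And>x y u. x \<in> T1 \<Longrightarrow> y \<in> T2 \<Longrightarrow> norm (f x y u) \<le> G x y (norm u)"
    and C4: "\<And>W Ix Iy x y. W \<subseteq> B_set T1 T2 G g0 \<Longrightarrow> Ix \<subseteq> T1 \<Longrightarrow> Iy \<subseteq> T2 \<Longrightarrow>
          value_set W Ix Iy \<noteq> {} \<Longrightarrow> bounded (value_set W Ix Iy) \<Longrightarrow>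
          bounded {f s t u | s t u. s \<in> Ix \<and> t \<in> Iy \<and> u \<in> value_set W Ix Iy} \<Longrightarrow>
          x \<in> Ix \<Longrightarrow> y \<in> Iy \<Longrightarrow>
          deblasi {f s t u | s t u. s \<in> Ix \<and> t \<in> Iy \<and> u \<in> value_set W Ix Iy}
            \<le> h x y (deblasi (value_set W Ix Iy))"
  shows "\<exists>z. weak_solution T1 T2 f z"
proof -
  interpret weak_problem T1 T2 G h g0 f
    by unfold_locales (fact T1 T2 G_nonneg G_cont G_mono g0_nonneg g0_bdd g0_sol h_nonneg h_cont h_unique C1 C2 C3 C4)+
  obtain S :: "'a set" where S: "countable S" "subspace (closure S)"
    "\<And>s t u. s \<in> T1 \<Longrightarrow> t \<in> T2 \<Longrightarrow> u \<in> closure S \<Longrightarrow> f s t u \<in> closure S"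
    by (rule separable_invariant_subspace) (rule that)
  interpret weak_problem_separable T1 T2 G h g0 f S by unfold_locales (fact S)+
  show ?thesis by (rule weak_solution_exists)
qed

end
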